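(* For a Tychonoff space $X$ the following conditions are equivalent: (1) $C_p(X)$ has an infinite-dimensional Polishable quotient; (2) $C_p(X)$ contains a complemented infinite-dimensional Polishable subspace; (3) $C_p(X)$ contains a complemented subspace isomorphic to $\mathbb{R}^{\mathbb{N}}$ or to $c_0$; (4) $X$ is not pseudocompact or $C_p(X)$ has the Josefson-Nissenzweig property (JNP).
   Context: For a Tychonoff space $X$, $C_p(X)$ is the space of continuous real-valued functions on $X$ with the topology of pointwise convergence (the subspace topology from $\mathbb{R}^X$). $\mathbb{R}^{\mathbb{N}}$ carries the product topology, and $c_0$ denotes the linear subspace $\{(x_n)_{n\in\mathbb{N}}\in\mathbb{R}^{\mathbb{N}}: x_n\to 0\}$ endowed with the topology inherited from $\mathbb{R}^{\mathbb{N}}$ (not the sup-norm topology). "Isomorphic" means linearly homeomorphic. "Subspace" means linear subspace with the induced topology; it is complemented if it is the range of a continuous linear projection of the whole space. A quotient of $C_p(X)$ is a space $C_p(X)/Z$ with the quotient topology, where $Z$ is a closed linear subspace. A finitely supported sign-measure on $X$ is a finite linear combination $\mu=\sum_{x\in F}\alpha_x\delta_x$ of Dirac measures $\delta_x:f\mapsto f(x)$, where $F\subset X$ is finite and the $\alpha_x$ are non-zero reals; it acts on functions by $\mu(f)=\sum_{x\in F}\alpha_x f(x)$ and has norm $\|\mu\|=\sum_{x\in F}|\alpha_x|$. The space $C_p(X)$ satisfies the Josefson-Nissenzweig property (JNP) if there exists a sequence $(\mu_n)_{n\in\mathbb{N}}$ of finitely supported sign-measures on $X$ such that $\|\mu_n\|=1$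 for all $n\in\mathbb{N}$ and $\mu_n(f)\to 0$ as $n\to\infty$ for every $f\in C_p(X)$. A topological space is pseudocompact if it is Tychonoff and every continuous real-valued function on it is bounded. A locally convex space is Polishable if it admits a stronger (i.e. finer) separable Fréchet (complete metrizable locally convex) vector space topology. *)

theory Defs
  imports "HOL-Analysis.Analysis" "HOL-Algebra.AbelCoset"
    "Jordan_Normal_Form.Missing_VectorSpace"
begin

section \<open>Topological vector spaces with explicit carriers\<close>

text \<open>
  Linear algebra is that of the entry VectorSpace, over the field of reals. Quotients
  \<open>C_p(X)/Z\<close> depend on a set \<open>Z\<close>, so they cannot be types of class \<open>real_vector\<close>.
  The fields \<open>mult\<close> and \<open>one\<close>, which \<open>module\<close> inherits from \<open>ring\<close>, play no role
  and are always set to junk values.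
\<close>

definition real_field :: "real ring" where
  "real_field = \<lparr>carrier = UNIV, mult = (*), one = 1, zero = 0, add = (+)\<rparr>"

lemma field_real_field: "field real_field"
proof -
  have "\<exists>y::real. x + y = 0" for x
    by (rule exI[of _ "- x"]) simp
  then have "cring real_field"
    by (intro cringI abelian_groupI comm_monoidI)
       (auto simp: real_field_def algebra_simps)
  moreover have "\<exists>y::real. x * y = 1" if "x \<noteq> 0" for x
    using that by (intro exI[of _ "inverse x"]) simp
  ultimately show ?thesis
    by (intro cring.cring_fieldI2) (auto simp: real_field_def)
qed

record 'v tvs = "(real, 'v) module" +
  vtop :: "'v topology"

locale topological_vector_space = VectorSpace.vectorspace real_field E
  for E :: "'v tvs" +
  assumes topspace_vtop: "topspace (vtop E) = carrier E"
    and continuous_add: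
      "continuous_map (prod_topology (vtop E) (vtop E)) (vtop E) (\<lambda>(x, y). x \<oplus>\<^bsub>E\<^esub> y)"
    and continuous_scale:
      "continuous_map (prod_topology euclideanreal (vtop E)) (vtop E) (\<lambda>(a, x). a \<odot>\<^bsub>E\<^esub> x)"

definition convex_in :: "'v tvs \<Rightarrow> 'v set \<Rightarrow> bool" where
  "convex_in E V \<longleftrightarrow>
     (\<forall>x\<in>V. \<forall>y\<in>V. \<forall>t\<in>{0..1}. ((1 - t) \<odot>\<^bsub>E\<^esub> x) \<oplus>\<^bsub>E\<^esub> (t \<odot>\<^bsub>E\<^esub> y) \<in> V)"

locale locally_convex_space = topological_vector_space +
  assumes locally_convex:
    "openin (vtop E) U \<Longrightarrow> \<zero>\<^bsub>E\<^esub> \<in> U \<Longrightarrow>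
     \<exists>V. openin (vtop E) V \<and> \<zero>\<^bsub>E\<^esub> \<in> V \<and> V \<subseteq> U \<and> convex_in E V"

text \<open>
  Translation invariance makes completeness of the metric the same as completeness of
  the topological vector space.
\<close>
locale frechet_space = locally_convex_space +
  assumes complete_metrizable:
    "\<exists>d. Metric_space (carrier E) d \<and>
         Metric_space.mtopology (carrier E) d = vtop E \<and>
         Metric_space.mcomplete (carrier E) d \<and>
         (\<forall>x\<in>carrier E. \<forall>y\<in>carrier E. \<forall>z\<in>carrier E. d (x \<oplus>\<^bsub>E\<^esub> z) (y \<oplus>\<^bsub>E\<^esub> z) = d x y)"

text \<open>
  Meant for locally convex \<open>E\<close>; every subspace and quotient of \<open>C_p(X)\<close> is locally convex.
\<close>
definition polishable :: "'v tvs \<Rightarrow> bool" where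
  "polishable E \<longleftrightarrow>
     (\<exists>T. (\<forall>U. openin (vtop E) U \<longrightarrow> openin T U) \<and>
          frechet_space (E\<lparr>vtop := T\<rparr>) \<and> separable_space T)"

definition infinite_dimensional :: "'v tvs \<Rightarrow> bool" where
  "infinite_dimensional E \<longleftrightarrow> \<not> VectorSpace.vectorspace.fin_dim real_field E"

definition subspace_tvs :: "'v tvs \<Rightarrow> 'v set \<Rightarrow> 'v tvs" where
  "subspace_tvs E Y = E\<lparr>carrier := Y, vtop := subtopology (vtop E) Y\<rparr>"

definition quotient_topology :: "'v tvs \<Rightarrow> 'v set \<Rightarrow> 'v set topology" where
  "quotient_topology E Z =
     topology (\<lambda>U. U \<subseteq> a_rcosets\<^bsub>E\<^esub> Z \<and> openin (vtop E) {x \<in> topspace (vtop E). Z +>\<^bsub>E\<^esub> x \<in> U})"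

lemma openin_quotient_topology:
  "openin (quotient_topology E Z) U \<longleftrightarrow>
     U \<subseteq> a_rcosets\<^bsub>E\<^esub> Z \<and> openin (vtop E) {x \<in> topspace (vtop E). Z +>\<^bsub>E\<^esub> x \<in> U}"
proof -
  let ?P = "\<lambda>U. {x \<in> topspace (vtop E). Z +>\<^bsub>E\<^esub> x \<in> U}"
  have "?P (S \<inter> T) = ?P S \<inter> ?P T" for S T by auto
  moreover have "?P (\<Union>\<K>) = \<Union>(?P ` \<K>)" for \<K> by auto
  ultimately have "istopology (\<lambda>U. U \<subseteq> a_rcosets\<^bsub>E\<^esub> Z \<and> openin (vtop E) (?P U))"
    unfolding istopology_def by (auto simp del: Union_iff)
  then show ?thesis
    by (simp add: quotient_topology_def topology_inverse')
qed

definition quotient_tvs :: "'v tvs \<Rightarrow> 'v set \<Rightarrow> 'v set tvs" where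
  "quotient_tvs E Z =
     \<lparr>carrier = a_rcosets\<^bsub>E\<^esub> Z,
      mult = (\<lambda>A B. Z), one = Z,
      zero = Z,
      add = (\<lambda>A B. A <+>\<^bsub>E\<^esub> B),
      smult = (\<lambda>a A. \<Union>x\<in>A. Z +>\<^bsub>E\<^esub> (a \<odot>\<^bsub>E\<^esub> x)),
      vtop = quotient_topology E Z\<rparr>"

definition closed_subspace :: "'v tvs \<Rightarrow> 'v set \<Rightarrow> bool" where
  "closed_subspace E Z \<longleftrightarrow> VectorSpace.subspace real_field Z E \<and> closedin (vtop E) Z"

definition complemented_subspace :: "'v tvs \<Rightarrow> 'v set \<Rightarrow> bool" where
  "complemented_subspace E Y \<longleftrightarrow>
     VectorSpace.subspace real_field Y E \<and>
     (\<exists>P. VectorSpace.linear_map real_field E E P \<and>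
          continuous_map (vtop E) (vtop E) P \<and>
          (\<forall>x\<in>carrier E. P (P x) = P x) \<and>
          P ` carrier E = Y)"

definition isomorphic_tvs :: "'v tvs \<Rightarrow> 'w tvs \<Rightarrow> bool" where
  "isomorphic_tvs E F \<longleftrightarrow>
     (\<exists>T. VectorSpace.linear_map real_field E F T \<and> homeomorphic_map (vtop E) (vtop F) T)"

definition has_inf_dim_polishable_quotient :: "'v tvs \<Rightarrow> bool" where
  "has_inf_dim_polishable_quotient E \<longleftrightarrow>
     (\<exists>Z. closed_subspace E Z \<and>
          infinite_dimensional (quotient_tvs E Z) \<and>
          polishable (quotient_tvs E Z))"

definition has_complemented_inf_dim_polishable_subspace :: "'v tvs \<Rightarrow> bool" where
  "has_complemented_inf_dim_polishable_subspace E \<longleftrightarrow>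
     (\<exists>Y. complemented_subspace E Y \<and>
          infinite_dimensional (subspace_tvs E Y) \<and>
          polishable (subspace_tvs E Y))"

definition has_complemented_copy :: "'v tvs \<Rightarrow> 'w tvs \<Rightarrow> bool" where
  "has_complemented_copy E F \<longleftrightarrow>
     (\<exists>Y. complemented_subspace E Y \<and> isomorphic_tvs (subspace_tvs E Y) F)"

section \<open>Function spaces\<close>

text \<open>
  As in \<open>powertop_real\<close>, a function on \<open>S\<close> is represented by the function that
  agrees with it on \<open>S\<close> and is \<open>undefined\<close> elsewhere.
\<close>
definition real_power :: "'a set \<Rightarrow> ('a \<Rightarrow> real) tvs" where
  "real_power S =
     \<lparr>carrier = S \<rightarrow>\<^sub>E UNIV,
      mult = (\<lambda>f g. \<lambda>x\<in>S. 0), one = (\<lambda>x\<in>S. 0),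
      zero = (\<lambda>x\<in>S. 0),
      add = (\<lambda>f g. \<lambda>x\<in>S. f x + g x),
      smult = (\<lambda>a f. \<lambda>x\<in>S. a * f x),
      vtop = powertop_real S\<rparr>"

definition Cp :: "'a topology \<Rightarrow> ('a \<Rightarrow> real) tvs" where
  "Cp X = subspace_tvs (real_power (topspace X))
            {f \<in> extensional (topspace X). continuous_map X euclideanreal f}"

definition RN :: "(nat \<Rightarrow> real) tvs" where
  "RN = real_power UNIV"

definition c0 :: "(nat \<Rightarrow> real) tvs" where
  "c0 = subspace_tvs RN {x. x \<longlonglongrightarrow> 0}"

section \<open>Tychonoff and pseudocompact spaces, the Josefson-Nissenzweig property\<close>

definition tychonoff_space :: "'a topology \<Rightarrow> bool" where
  "tychonoff_space X \<longleftrightarrow> completely_regular_space X \<and> Hausdorff_space X"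

definition pseudocompact_space :: "'a topology \<Rightarrow> bool" where
  "pseudocompact_space X \<longleftrightarrow>
     tychonoff_space X \<and>
     (\<forall>f. continuous_map X euclideanreal f \<longrightarrow> bounded (f ` topspace X))"

text \<open>
  The sign-measure \<open>\<Sum>x\<in>F. \<alpha> x * \<delta> x\<close> with non-zero coefficients is represented
  by its coefficient function, extended by zero; \<open>F\<close> is then its support.
\<close>
definition sign_measure_on :: "'a topology \<Rightarrow> ('a \<Rightarrow> real) \<Rightarrow> bool" where
  "sign_measure_on X \<mu> \<longleftrightarrow> finite {x. \<mu> x \<noteq> 0} \<and> {x. \<mu> x \<noteq> 0} \<subseteq> topspace X"

definition sm_apply :: "('a \<Rightarrow> real) \<Rightarrow> ('a \<Rightarrow> real) \<Rightarrow> real" where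
  "sm_apply \<mu> f = (\<Sum>x | \<mu> x \<noteq> 0. \<mu> x * f x)"

definition sm_norm :: "('a \<Rightarrow> real) \<Rightarrow> real" where
  "sm_norm \<mu> = (\<Sum>x | \<mu> x \<noteq> 0. \<bar>\<mu> x\<bar>)"

definition Cp_JNP :: "'a topology \<Rightarrow> bool" where
  "Cp_JNP X \<longleftrightarrow>
     (\<exists>\<mu> :: nat \<Rightarrow> 'a \<Rightarrow> real.
        (\<forall>n. sign_measure_on X (\<mu> n) \<and> sm_norm (\<mu> n) = 1) \<and>
        (\<forall>f\<in>carrier (Cp X). (\<lambda>n. sm_apply (\<mu> n) f) \<longlonglongrightarrow> 0))"

end

theory Submission
  imports Defs
begin

text \<open>
  The cycle runs from a complemented copy of \<open>\<real>\<^sup>\<nat>\<close> or \<open>c\<^sub>0\<close> to a complemented Polishable subspace, to a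
  Polishable quotient, to the alternative between non-pseudocompactness and the Josefson-Nissenzweig
  property, and back to a copy.

  Polishability passes along linear bijections that are open (\<open>polishable_pullback\<close>). The space
  \<open>\<real>\<^sup>\<nat>\<close> is itself a separable Frechet space, and \<open>c\<^sub>0\<close> becomes one under the sup norm, so a
  complemented copy of either is a complemented Polishable subspace; and the quotient by the kernel of a
  projection is mapped onto its range by an open linear bijection
  (\<open>polishable_quotient_of_complemented_subspace\<close>).

  Let now \<open>X\<close> be pseudocompact and let \<open>C\<^sub>p(X)/Z\<close> be infinite-dimensional and Polishable
  (\<open>JNP_of_polishable_quotient\<close>). All continuous functions on \<open>X\<close> are bounded, so they form a Banach
  space under the sup norm. The argument of the open mapping theorem, applied to this space and the finer
  Frechet topology, shows that the quotient map is open for the sup norm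
  (\<open>quotient_map_open\<close>). Instead of a closed graph it uses finitely supported measures that annihilate
  \<open>Z\<close>: they are continuous for both topologies and separate points from \<open>Z\<close>
  (\<open>annihilator_separates\<close>). So the quotient is separable in the quotient norm. As it is
  infinite-dimensional, for every \<open>n\<close> some measure of norm one annihilates \<open>Z\<close> together with the first \<open>n\<close>
  members of a dense sequence (\<open>annihilator_separates_span\<close>); these measures converge to zero on every
  continuous function.

  If \<open>X\<close> is not pseudocompact, narrow tents around a rapidly growing sequence of values of an unbounded
  function span a complemented copy of \<open>\<real>\<^sup>\<nat>\<close> (\<open>complemented_RN_of_unbounded\<close>).

  The Josefson-Nissenzweig property yields \<open>c\<^sub>0\<close> by a gliding hump argument. A null sequence of measures of
  norm one cannot keep most of its mass on a finite set, because only finitely many sign patterns occur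
  there (\<open>escaping_mass\<close>). So there are many disjoint finite pieces of supports with substantial mass, and
  among sufficiently many disjoint neighbourhoods of such pieces one is almost null for infinitely many of
  the remaining measures (\<open>next_hump\<close>). This gives disjointly supported continuous functions on which a
  subsequence of the measures acts by a lower triangular matrix with dominant diagonal
  (\<open>hump_sequence\<close>). Such a matrix can be inverted on null sequences (\<open>tri_solve_tendsto_0\<close>), which
  turns the measures into a continuous linear retraction onto the span of these functions
  (\<open>complemented_c0_of_JNP\<close>).
\<close>

section \<open>Linear algebra over the reals with explicit carriers\<close>

lemma real_field_simps [simp]:
  "carrier real_field = UNIV" "add real_field = (+)" "mult real_field = (*)"
  "zero real_field = 0" "one real_field = 1"
  by (simp_all add: real_field_def)

lemma linear_mapI:
  assumes "VectorSpace.vectorspace real_field E" "VectorSpace.vectorspace real_field F"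
    and "\<And>x. x \<in> carrier E \<Longrightarrow> T x \<in> carrier F"
    and "\<And>x y. x \<in> carrier E \<Longrightarrow> y \<in> carrier E \<Longrightarrow> T (x \<oplus>\<^bsub>E\<^esub> y) = T x \<oplus>\<^bsub>F\<^esub> T y"
    and "\<And>a x. x \<in> carrier E \<Longrightarrow> T (a \<odot>\<^bsub>E\<^esub> x) = a \<odot>\<^bsub>F\<^esub> T x"
  shows "VectorSpace.linear_map real_field E F T"
  using assms
  by (auto simp: VectorSpace.linear_map_def mod_hom_def mod_hom_axioms_def module_hom_def
      VectorSpace.vectorspace_def)

lemma linear_mapD:
  assumes "VectorSpace.linear_map real_field E F T"
  shows "VectorSpace.vectorspace real_field E" "VectorSpace.vectorspace real_field F"
    and "\<And>x. x \<in> carrier E \<Longrightarrow> T x \<in> carrier F"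
    and "\<And>x y. x \<in> carrier E \<Longrightarrow> y \<in> carrier E \<Longrightarrow> T (x \<oplus>\<^bsub>E\<^esub> y) = T x \<oplus>\<^bsub>F\<^esub> T y"
    and "\<And>a x. x \<in> carrier E \<Longrightarrow> T (a \<odot>\<^bsub>E\<^esub> x) = a \<odot>\<^bsub>F\<^esub> T x"
    and "T \<zero>\<^bsub>E\<^esub> = \<zero>\<^bsub>F\<^esub>"
proof -
  interpret VectorSpace.linear_map real_field E F T by fact
  show "VectorSpace.vectorspace real_field E" "VectorSpace.vectorspace real_field F"
    by unfold_locales
  show "\<And>x. x \<in> carrier E \<Longrightarrow> T x \<in> carrier F"
    and "\<And>x y. x \<in> carrier E \<Longrightarrow> y \<in> carrier E \<Longrightarrow> T (x \<oplus>\<^bsub>E\<^esub> y) = T x \<oplus>\<^bsub>F\<^esub> T y"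
    and "\<And>a x. x \<in> carrier E \<Longrightarrow> T (a \<odot>\<^bsub>E\<^esub> x) = a \<odot>\<^bsub>F\<^esub> T x"
    and "T \<zero>\<^bsub>E\<^esub> = \<zero>\<^bsub>F\<^esub>"
    by (auto simp: T_im f_add f_smult)
qed

lemma vectorspaceD:
  assumes "VectorSpace.vectorspace real_field E"
  shows "\<zero>\<^bsub>E\<^esub> \<in> carrier E"
    and "\<And>x y. x \<in> carrier E \<Longrightarrow> y \<in> carrier E \<Longrightarrow> x \<oplus>\<^bsub>E\<^esub> y \<in> carrier E"
    and "\<And>a x. x \<in> carrier E \<Longrightarrow> a \<odot>\<^bsub>E\<^esub> x \<in> carrier E"
    and "\<And>x y z. x \<in> carrier E \<Longrightarrow> y \<in> carrier E \<Longrightarrow> z \<in> carrier E \<Longrightarrow>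
           (x \<oplus>\<^bsub>E\<^esub> y) \<oplus>\<^bsub>E\<^esub> z = x \<oplus>\<^bsub>E\<^esub> (y \<oplus>\<^bsub>E\<^esub> z)"
    and "\<And>x y. x \<in> carrier E \<Longrightarrow> y \<in> carrier E \<Longrightarrow> x \<oplus>\<^bsub>E\<^esub> y = y \<oplus>\<^bsub>E\<^esub> x"
    and "\<And>x. x \<in> carrier E \<Longrightarrow> x \<oplus>\<^bsub>E\<^esub> \<zero>\<^bsub>E\<^esub> = x"
    and "\<And>x. x \<in> carrier E \<Longrightarrow> \<zero>\<^bsub>E\<^esub> \<oplus>\<^bsub>E\<^esub> x = x"
    and "\<And>x. x \<in> carrier E \<Longrightarrow> x \<oplus>\<^bsub>E\<^esub> ((-1) \<odot>\<^bsub>E\<^esub> x) = \<zero>\<^bsub>E\<^esub>"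
    and "\<And>a x y. x \<in> carrier E \<Longrightarrow> y \<in> carrier E \<Longrightarrow>
           a \<odot>\<^bsub>E\<^esub> (x \<oplus>\<^bsub>E\<^esub> y) = (a \<odot>\<^bsub>E\<^esub> x) \<oplus>\<^bsub>E\<^esub> (a \<odot>\<^bsub>E\<^esub> y)"
    and "\<And>a b x. x \<in> carrier E \<Longrightarrow> (a + b) \<odot>\<^bsub>E\<^esub> x = (a \<odot>\<^bsub>E\<^esub> x) \<oplus>\<^bsub>E\<^esub> (b \<odot>\<^bsub>E\<^esub> x)"
    and "\<And>a b x. x \<in> carrier E \<Longrightarrow> (a * b) \<odot>\<^bsub>E\<^esub> x = a \<odot>\<^bsub>E\<^esub> (b \<odot>\<^bsub>E\<^esub> x)"
    and "\<And>x. x \<in> carrier E \<Longrightarrow> 1 \<odot>\<^bsub>E\<^esub> x = x"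
    and "\<And>x. x \<in> carrier E \<Longrightarrow> 0 \<odot>\<^bsub>E\<^esub> x = \<zero>\<^bsub>E\<^esub>"
    and "\<And>a. a \<odot>\<^bsub>E\<^esub> \<zero>\<^bsub>E\<^esub> = \<zero>\<^bsub>E\<^esub>"
proof -
  interpret VectorSpace.vectorspace real_field E by fact
  show "\<zero>\<^bsub>E\<^esub> \<in> carrier E"
    and "\<And>x y. x \<in> carrier E \<Longrightarrow> y \<in> carrier E \<Longrightarrow> x \<oplus>\<^bsub>E\<^esub> y \<in> carrier E"
    and scl: "\<And>a x. x \<in> carrier E \<Longrightarrow> a \<odot>\<^bsub>E\<^esub> x \<in> carrier E"
    and "\<And>x y z. x \<in> carrier E \<Longrightarrow> y \<in> carrier E \<Longrightarrow> z \<in> carrier E \<Longrightarrow>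
           (x \<oplus>\<^bsub>E\<^esub> y) \<oplus>\<^bsub>E\<^esub> z = x \<oplus>\<^bsub>E\<^esub> (y \<oplus>\<^bsub>E\<^esub> z)"
    and "\<And>x y. x \<in> carrier E \<Longrightarrow> y \<in> carrier E \<Longrightarrow> x \<oplus>\<^bsub>E\<^esub> y = y \<oplus>\<^bsub>E\<^esub> x"
    and "\<And>x. x \<in> carrier E \<Longrightarrow> x \<oplus>\<^bsub>E\<^esub> \<zero>\<^bsub>E\<^esub> = x"
    and "\<And>x. x \<in> carrier E \<Longrightarrow> \<zero>\<^bsub>E\<^esub> \<oplus>\<^bsub>E\<^esub> x = x"
    and "\<And>a x y. x \<in> carrier E \<Longrightarrow> y \<in> carrier E \<Longrightarrow>
           a \<odot>\<^bsub>E\<^esub> (x \<oplus>\<^bsub>E\<^esub> y) = (a \<odot>\<^bsub>E\<^esub> x) \<oplus>\<^bsub>E\<^esub> (a \<odot>\<^bsub>E\<^esub> y)"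
    and d: "\<And>a b x. x \<in> carrier E \<Longrightarrow> (a + b) \<odot>\<^bsub>E\<^esub> x = (a \<odot>\<^bsub>E\<^esub> x) \<oplus>\<^bsub>E\<^esub> (b \<odot>\<^bsub>E\<^esub> x)"
    and "\<And>a b x. x \<in> carrier E \<Longrightarrow> (a * b) \<odot>\<^bsub>E\<^esub> x = a \<odot>\<^bsub>E\<^esub> (b \<odot>\<^bsub>E\<^esub> x)"
    and o: "\<And>x. x \<in> carrier E \<Longrightarrow> 1 \<odot>\<^bsub>E\<^esub> x = x"
    and n: "\<And>x. x \<in> carrier E \<Longrightarrow> 0 \<odot>\<^bsub>E\<^esub> x = \<zero>\<^bsub>E\<^esub>"
    using smult_l_distr smult_r_distr smult_assoc1 smult_one smult_l_null smult_closed
    by (simp_all add: M.a_assoc) (simp add: M.a_comm)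
  show "\<And>a. a \<odot>\<^bsub>E\<^esub> \<zero>\<^bsub>E\<^esub> = \<zero>\<^bsub>E\<^esub>"
    using smult_r_null by simp
  show "\<And>x. x \<in> carrier E \<Longrightarrow> x \<oplus>\<^bsub>E\<^esub> ((-1) \<odot>\<^bsub>E\<^esub> x) = \<zero>\<^bsub>E\<^esub>"
    using d[of _ 1 "-1"] o n by simp
qed

text \<open>
  Subspaces, and quotients by the kernel of a projection, inherit the vector space axioms along an
  injection into a known space that respects the operations.
\<close>
lemma vectorspace_pullback:
  assumes F: "VectorSpace.vectorspace real_field F"
    and inj: "inj_on T (carrier E)"
    and T: "\<And>x. x \<in> carrier E \<Longrightarrow> T x \<in> carrier F"
    and zero: "\<zero>\<^bsub>E\<^esub> \<in> carrier E" "T \<zero>\<^bsub>E\<^esub> = \<zero>\<^bsub>F\<^esub>"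
    and add: "\<And>x y. x \<in> carrier E \<Longrightarrow> y \<in> carrier E \<Longrightarrow> x \<oplus>\<^bsub>E\<^esub> y \<in> carrier E"
      "\<And>x y. x \<in> carrier E \<Longrightarrow> y \<in> carrier E \<Longrightarrow> T (x \<oplus>\<^bsub>E\<^esub> y) = T x \<oplus>\<^bsub>F\<^esub> T y"
    and smult: "\<And>a x. x \<in> carrier E \<Longrightarrow> a \<odot>\<^bsub>E\<^esub> x \<in> carrier E"
      "\<And>a x. x \<in> carrier E \<Longrightarrow> T (a \<odot>\<^bsub>E\<^esub> x) = a \<odot>\<^bsub>F\<^esub> T x"
  shows "VectorSpace.vectorspace real_field E"
proof -
  note FD = vectorspaceD[OF F]
  have eqI: "x = y" if "x \<in> carrier E" "y \<in> carrier E" "T x = T y" for x y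
    using that inj by (meson inj_onD)
  show ?thesis
  proof (rule vs_criteria[OF field_real_field], goal_cases)
    case 3
    have "x \<oplus>\<^bsub>E\<^esub> ((-1) \<odot>\<^bsub>E\<^esub> x) = \<zero>\<^bsub>E\<^esub>" if "x \<in> carrier E" for x
      using that by (intro eqI) (auto simp: zero add smult FD T)
    then show ?case using smult by blast
  next
    case 6
    show ?case by (auto intro!: eqI simp: zero add smult T FD(4))
  qed (auto intro!: eqI simp: zero add smult T FD)
qed

lemma vectorspace_subset:
  assumes F: "VectorSpace.vectorspace real_field F"
    and ops: "zero E = zero F" "add E = add F" "smult E = smult F"
    and W: "carrier E \<subseteq> carrier F" "\<zero>\<^bsub>F\<^esub> \<in> carrier E"
      "\<And>x y. x \<in> carrier E \<Longrightarrow> y \<in> carrier E \<Longrightarrow> x \<oplus>\<^bsub>F\<^esub> y \<in> carrier E"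
      "\<And>a x. x \<in> carrier E \<Longrightarrow> a \<odot>\<^bsub>F\<^esub> x \<in> carrier E"
  shows "VectorSpace.vectorspace real_field E"
  by (rule vectorspace_pullback[OF F, where T = "\<lambda>x. x"]) (use assms in auto)

lemma subspaceI:
  assumes F: "VectorSpace.vectorspace real_field F"
    and W: "W \<subseteq> carrier F" "\<zero>\<^bsub>F\<^esub> \<in> W"
      "\<And>x y. x \<in> W \<Longrightarrow> y \<in> W \<Longrightarrow> x \<oplus>\<^bsub>F\<^esub> y \<in> W"
      "\<And>a x. x \<in> W \<Longrightarrow> a \<odot>\<^bsub>F\<^esub> x \<in> W"
  shows "VectorSpace.subspace real_field W F"
  using assms by (auto simp: VectorSpace.subspace_def submodule_def VectorSpace.vectorspace_def)

lemma subspaceD: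
  assumes "VectorSpace.subspace real_field W F"
  shows "VectorSpace.vectorspace real_field F" "W \<subseteq> carrier F" "\<zero>\<^bsub>F\<^esub> \<in> W"
    and "\<And>x y. x \<in> W \<Longrightarrow> y \<in> W \<Longrightarrow> x \<oplus>\<^bsub>F\<^esub> y \<in> W"
    and "\<And>a x. x \<in> W \<Longrightarrow> a \<odot>\<^bsub>F\<^esub> x \<in> W"
  using assms by (auto simp: VectorSpace.subspace_def submodule_def)

lemma subspace_tvs_simps [simp]:
  "carrier (subspace_tvs E Y) = Y" "add (subspace_tvs E Y) = add E"
  "zero (subspace_tvs E Y) = zero E" "smult (subspace_tvs E Y) = smult E"
  "vtop (subspace_tvs E Y) = subtopology (vtop E) Y"
  by (simp_all add: subspace_tvs_def)

lemma vectorspace_subspace_tvs: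
  assumes "VectorSpace.subspace real_field W E"
  shows "VectorSpace.vectorspace real_field (subspace_tvs E W)"
  by (rule vectorspace_subset[OF subspaceD(1)[OF assms]]) (simp_all add: subspaceD[OF assms])

lemma infinite_dimensional_preimage:
  assumes "VectorSpace.linear_map real_field E F T" "T ` carrier E = carrier F"
    and "infinite_dimensional F"
  shows "infinite_dimensional E"
  using linear_map.surj_fin_dim[OF assms(1) _ assms(2)] assms(3)
  unfolding infinite_dimensional_def by blast

text \<open>
  A biorthogonal sequence spans arbitrarily large independent sets, since the functional
  \<open>p k\<close> reads off the coefficient at \<open>e k\<close>.
\<close>
lemma infinite_dimensional_biorthogonal:
  assumes E: "VectorSpace.vectorspace real_field E"
    and e: "\<And>k::nat. e k \<in> carrier E"
    and p_add: "\<And>k x y. x \<in> carrier E \<Longrightarrow> y \<in> carrier E \<Longrightarrow> p k (x \<oplus>\<^bsub>E\<^esub> y) = p k x + p k y"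
    and p_smult: "\<And>k a x. x \<in> carrier E \<Longrightarrow> p k (a \<odot>\<^bsub>E\<^esub> x) = a * p k x"
    and dual: "\<And>k j. p k (e j) = (if j = k then 1 else 0 :: real)"
  shows "infinite_dimensional E"
proof -
  interpret VectorSpace.vectorspace real_field E by fact
  have inj: "inj e"
    using dual by (metis injI zero_neq_one)
  have p0: "p k \<zero>\<^bsub>E\<^esub> = 0" for k
    using p_add[of "\<zero>\<^bsub>E\<^esub>" "\<zero>\<^bsub>E\<^esub>" k] by simp
  have p_sum: "p k (lincomb a A) = (\<Sum>v\<in>A. a v * p k v)"
    if "finite A" "A \<subseteq> carrier E" for k a A
    using that
  proof (induction A rule: finite_induct)
    case empty
    then show ?case by (simp add: lincomb_def p0)
  next
    case (insert x A)
    have "lincomb a (insert x A) = a x \<odot>\<^bsub>E\<^esub> x \<oplus>\<^bsub>E\<^esub> lincomb a A"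
      unfolding lincomb_def using insert by (intro M.finsum_insert) auto
    moreover have "lincomb a A \<in> carrier E"
      using insert by (intro lincomb_closed) auto
    ultimately show ?case
      using insert by (simp add: p_add p_smult)
  qed
  have indep: "lin_indpt (range e)"
  proof
    assume "lin_dep (range e)"
    then obtain A a v where A: "finite A" "A \<subseteq> range e" "lincomb a A = \<zero>\<^bsub>E\<^esub>" "v \<in> A" "a v \<noteq> 0"
      unfolding lin_dep_def by auto
    then obtain k where k: "v = e k" by auto
    have "0 = (\<Sum>w\<in>A. a w * p k w)"
      using A e p_sum[of A k a] p0 by (metis image_subset_iff subset_trans top_greatest)
    also have "\<dots> = (\<Sum>w\<in>A. if w = v then a w else 0)"
      using A(2) k dual inj by (intro sum.cong) (auto simp: inj_eq)
    also have "\<dots> = a v" using A by simp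
    finally show False using A by simp
  qed
  have "\<not> fin_dim"
  proof
    assume "fin_dim"
    then have "finite (range e)"
      using fin_dim_li_fin[OF _ indep] e by blast
    then show False using inj finite_imageD by blast
  qed
  then show ?thesis unfolding infinite_dimensional_def .
qed

section \<open>Transport of Polishability\<close>

text \<open>
  A Frechet topology pulled back along a linear bijection is Frechet: along such a map the
  neighbourhoods of zero, their convexity and the invariant metric all correspond.
\<close>
lemma frechet_space_pullback:
  assumes F: "frechet_space F" and lin: "VectorSpace.linear_map real_field E F T"
    and bij: "bij_betw T (carrier E) (carrier F)"
  shows "frechet_space (E\<lparr>vtop := pullback_topology (carrier E) T (vtop F)\<rparr>)" (is "frechet_space ?E")
proof -
  interpret F: frechet_space F by fact
  note L = linear_mapD[OF lin]
  note ED = vectorspaceD[OF L(1)] and FD = vectorspaceD[OF L(2)]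
  let ?P = "pullback_topology (carrier E) T (vtop F)"
  have inj: "inj_on T (carrier E)" and surj: "T ` carrier E = carrier F"
    using bij by (auto simp: bij_betw_def)
  have vs: "VectorSpace.vectorspace real_field ?E"
    by (rule vectorspace_subset[OF L(1)]) (simp_all add: ED)
  have top: "topspace ?P = carrier E"
    using L(3) by (auto simp: topspace_pullback_topology F.topspace_vtop)
  have contT: "continuous_map ?P (vtop F) T"
    using continuous_map_pullback[OF continuous_map_id] by (simp add: id_def o_def)
  have into: "continuous_map Z ?P g"
    if "continuous_map Z (vtop F) h" "\<And>z. z \<in> topspace Z \<Longrightarrow> g z \<in> carrier E"
      "\<And>z. z \<in> topspace Z \<Longrightarrow> T (g z) = h z" for Z :: "'z topology" and g h
    using that by (intro continuous_map_pullback') (auto intro: continuous_map_eq)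
  have addc: "continuous_map (prod_topology ?P ?P) ?P (\<lambda>(x, y). x \<oplus>\<^bsub>E\<^esub> y)"
  proof (rule into)
    show "continuous_map (prod_topology ?P ?P) (vtop F) ((\<lambda>(x, y). x \<oplus>\<^bsub>F\<^esub> y) \<circ> (\<lambda>(x, y). (T x, T y)))"
      by (intro continuous_map_compose[OF _ F.continuous_add] continuous_map_prod_top[THEN iffD2])
        (simp add: contT)
  qed (auto simp: top ED L)
  have scalec: "continuous_map (prod_topology euclideanreal ?P) ?P (\<lambda>(a, x). a \<odot>\<^bsub>E\<^esub> x)"
  proof (rule into)
    show "continuous_map (prod_topology euclideanreal ?P) (vtop F)
            ((\<lambda>(a, x). a \<odot>\<^bsub>F\<^esub> x) \<circ> (\<lambda>(a, x). (id a, T x)))"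
      by (intro continuous_map_compose[OF _ F.continuous_scale] continuous_map_prod_top[THEN iffD2])
        (simp add: contT)
  qed (auto simp: top ED L)
  have lc: "\<exists>V. openin ?P V \<and> \<zero>\<^bsub>E\<^esub> \<in> V \<and> V \<subseteq> U \<and> convex_in ?E V"
    if U: "openin ?P U" "\<zero>\<^bsub>E\<^esub> \<in> U" for U
  proof -
    obtain W where W: "openin (vtop F) W" "U = T -` W \<inter> carrier E"
      using U by (auto simp: openin_pullback_topology)
    then have "\<zero>\<^bsub>F\<^esub> \<in> W" using U L by auto
    then obtain V where V: "openin (vtop F) V" "\<zero>\<^bsub>F\<^esub> \<in> V" "V \<subseteq> W" "convex_in F V"
      using F.locally_convex W by blast
    show ?thesis
    proof (intro exI conjI)
      show "openin ?P (T -` V \<inter> carrier E)"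
        using V openin_pullback_topology by blast
      show "convex_in ?E (T -` V \<inter> carrier E)"
        using V(4) unfolding convex_in_def by (auto simp: ED(1-3) L)
    qed (use V W L ED in auto)
  qed
  obtain d where d: "Metric_space (carrier F) d" "Metric_space.mtopology (carrier F) d = vtop F"
      "Metric_space.mcomplete (carrier F) d"
      "\<And>x y z. x \<in> carrier F \<Longrightarrow> y \<in> carrier F \<Longrightarrow> z \<in> carrier F \<Longrightarrow> d (x \<oplus>\<^bsub>F\<^esub> z) (y \<oplus>\<^bsub>F\<^esub> z) = d x y"
    using F.complete_metrizable by blast
  interpret MF: Metric_space "carrier F" d by fact
  let ?d = "\<lambda>x y. d (T x) (T y)"
  interpret ME: Metric_space "carrier E" ?d
    using inj by unfold_locales
      (auto simp: MF.commute L(3) MF.triangle MF.zero dest: inj_onD)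
  have ball: "ME.mball x r = T -` MF.mball (T x) r \<inter> carrier E" if "x \<in> carrier E" for x r
    using that L(3) by (auto simp: ME.mball_def MF.mball_def)
  have topeq: "ME.mtopology = ?P"
    unfolding topology_eq
  proof (intro allI iffI)
    fix U assume "openin ?P U"
    then obtain W where W: "openin MF.mtopology W" "U = T -` W \<inter> carrier E"
      by (auto simp: openin_pullback_topology d(2))
    have "\<exists>r>0. ME.mball x r \<subseteq> U" if "x \<in> U" for x
    proof -
      have "T x \<in> W" using W that by auto
      then obtain r where "r > 0" "MF.mball (T x) r \<subseteq> W"
        using W(1) MF.openin_mtopology by blast
      then show ?thesis using that W ball by (intro exI[of _ r]) auto
    qed
    then show "openin ME.mtopology U"
      using W by (auto simp: ME.openin_mtopology)
  next
    fix U assume U: "openin ME.mtopology U"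
    then have UE: "U \<subseteq> carrier E" by (simp add: ME.openin_mtopology)
    have "openin MF.mtopology (T ` U)"
      unfolding MF.openin_mtopology
    proof (intro conjI ballI allI impI)
      show "T ` U \<subseteq> carrier F" using UE L(3) by auto
      fix y assume "y \<in> T ` U"
      then obtain x where x: "x \<in> U" "y = T x" by auto
      then obtain r where r: "r > 0" "ME.mball x r \<subseteq> U"
        using U ME.openin_mtopology by blast
      have "MF.mball y r \<subseteq> T ` U"
      proof
        fix z assume z: "z \<in> MF.mball y r"
        then obtain w where "w \<in> carrier E" "z = T w"
          using surj by (metis MF.in_mball imageE)
        then have "w \<in> ME.mball x r" using ball x UE z by auto
        then show "z \<in> T ` U" using r \<open>z = T w\<close> by auto
      qed
      then show "\<exists>r>0. MF.mball y r \<subseteq> T ` U" using r by auto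
    qed
    moreover have "U = T -` (T ` U) \<inter> carrier E"
      using UE inj by (auto dest: inj_onD)
    ultimately show "openin ?P U"
      by (auto simp: openin_pullback_topology d(2))
  qed
  have "ME.mcomplete"
    unfolding ME.mcomplete_def
  proof (intro allI impI)
    fix s assume s: "ME.MCauchy s"
    then have "MF.MCauchy (T \<circ> s)"
      using L(3) unfolding ME.MCauchy_def MF.MCauchy_def by (auto simp: image_subset_iff)
    then obtain y where y: "limitin MF.mtopology (T \<circ> s) y sequentially"
      using d(3) unfolding MF.mcomplete_def by auto
    then obtain x where x: "x \<in> carrier E" "y = T x"
      using surj MF.limitin_mspace by blast
    have "range s \<subseteq> carrier E" using s ME.MCauchy_def by auto
    then have "limitin ME.mtopology s x sequentially"
      using y x unfolding ME.limit_metric_sequentially MF.limit_metric_sequentially by fastforce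
    then show "\<exists>x. limitin ME.mtopology s x sequentially" by auto
  qed
  moreover have "?d (x \<oplus>\<^bsub>E\<^esub> z) (y \<oplus>\<^bsub>E\<^esub> z) = ?d x y"
    if "x \<in> carrier E" "y \<in> carrier E" "z \<in> carrier E" for x y z
    using that L d(4) by simp
  ultimately have met: "\<exists>d. Metric_space (carrier E) d \<and>
         Metric_space.mtopology (carrier E) d = ?P \<and>
         Metric_space.mcomplete (carrier E) d \<and>
         (\<forall>x\<in>carrier E. \<forall>y\<in>carrier E. \<forall>z\<in>carrier E. d (x \<oplus>\<^bsub>E\<^esub> z) (y \<oplus>\<^bsub>E\<^esub> z) = d x y)"
    using ME.Metric_space_axioms topeq by (intro exI[of _ ?d]) auto
  show ?thesis
    unfolding frechet_space_def locally_convex_space_def topological_vector_space_def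
      topological_vector_space_axioms_def locally_convex_space_axioms_def frechet_space_axioms_def
    using vs top addc scalec lc met by simp
qed

text \<open>
  The finer topology on \<open>F\<close> is pulled back to \<open>E\<close>; there it refines the given topology because \<open>T\<close> is
  open.
\<close>
lemma polishable_pullback:
  assumes F: "polishable F" and lin: "VectorSpace.linear_map real_field E F T"
    and bij: "bij_betw T (carrier E) (carrier F)"
    and top: "topspace (vtop E) = carrier E"
    and opn: "\<And>U. openin (vtop E) U \<Longrightarrow> openin (vtop F) (T ` U)"
  shows "polishable E"
proof -
  obtain t where t: "\<And>U. openin (vtop F) U \<Longrightarrow> openin t U" "frechet_space (F\<lparr>vtop := t\<rparr>)"
      "separable_space t"
    using F unfolding polishable_def by auto
  let ?F = "F\<lparr>vtop := t\<rparr>"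
  interpret F: frechet_space ?F by fact
  note L = linear_mapD[OF lin]
  have tF: "topspace t = carrier F" using F.topspace_vtop by simp
  have inj: "inj_on T (carrier E)" and surj: "T ` carrier E = carrier F"
    using bij by (auto simp: bij_betw_def)
  have "VectorSpace.vectorspace real_field ?F" ..
  then have lin': "VectorSpace.linear_map real_field E ?F T"
    using L by (intro linear_mapI) auto
  let ?P = "pullback_topology (carrier E) T t"
  have "frechet_space (E\<lparr>vtop := ?P\<rparr>)"
    using frechet_space_pullback[OF t(2) lin'] bij by simp
  moreover have "openin ?P U" if "openin (vtop E) U" for U
  proof -
    have "U \<subseteq> carrier E" using that openin_subset top by blast
    then have "U = T -` (T ` U) \<inter> carrier E" using inj by (auto dest: inj_onD)
    then show ?thesis using t(1)[OF opn[OF that]] openin_pullback_topology by blast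
  qed
  moreover have "separable_space ?P"
  proof -
    let ?g = "inv_into (carrier E) T"
    have TP: "topspace ?P = carrier E"
      using L(3) tF by (auto simp: topspace_pullback_topology)
    have "continuous_map t ?P ?g"
      using surj tF
      by (intro continuous_map_pullback' continuous_map_eq[OF continuous_map_id])
        (auto simp: f_inv_into_f inv_into_into)
    moreover have "?g ` topspace t = topspace ?P"
      using bij_betw_inv_into[OF bij] TP tF by (simp add: bij_betw_def)
    ultimately show ?thesis
      using t(3) separable_space_continuous_map_image by metis
  qed
  ultimately show ?thesis unfolding polishable_def by auto
qed

section \<open>Complemented copies and quotients\<close>

text \<open>
  A continuous linear right inverse \<open>R\<close> of \<open>S\<close> embeds \<open>F\<close> as the range of the projection \<open>R \<circ> S\<close>.
\<close>
lemma has_complemented_copyI: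
  assumes S: "VectorSpace.linear_map real_field E F S" "continuous_map (vtop E) (vtop F) S"
    and R: "VectorSpace.linear_map real_field F E R" "continuous_map (vtop F) (vtop E) R"
    and SR: "\<And>y. y \<in> carrier F \<Longrightarrow> S (R y) = y"
    and top: "topspace (vtop E) = carrier E" "topspace (vtop F) = carrier F"
  shows "has_complemented_copy E F"
proof -
  note SD = linear_mapD[OF S(1)] and RD = linear_mapD[OF R(1)]
  let ?Y = "R ` carrier F"
  have sub: "VectorSpace.subspace real_field ?Y E"
  proof (rule subspaceI[OF SD(1)])
    show "\<zero>\<^bsub>E\<^esub> \<in> ?Y"
      using RD(6) vectorspaceD(1)[OF SD(2)] by (metis imageI)
    fix x y a assume x: "x \<in> ?Y"
    then obtain x' where x': "x' \<in> carrier F" "x = R x'" by auto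
    show "a \<odot>\<^bsub>E\<^esub> x \<in> ?Y"
      using x' vectorspaceD(3)[OF SD(2)] by (metis RD(5) imageI)
    assume "y \<in> ?Y"
    then obtain y' where y': "y' \<in> carrier F" "y = R y'" by auto
    show "x \<oplus>\<^bsub>E\<^esub> y \<in> ?Y"
      using x' y' vectorspaceD(2)[OF SD(2)] by (metis RD(4) imageI)
  qed (use RD in auto)
  let ?P = "R \<circ> S"
  have "complemented_subspace E ?Y"
    unfolding complemented_subspace_def
  proof (intro conjI exI sub ballI)
    show "VectorSpace.linear_map real_field E E ?P"
      using SD(1) by (intro linear_mapI) (auto simp: SD RD)
    show "continuous_map (vtop E) (vtop E) ?P"
      using S R continuous_map_compose by blast
    show "?P (?P x) = ?P x" if "x \<in> carrier E" for x
      using that SR SD(3) by simp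
    have "y \<in> ?P ` carrier E" if y: "y \<in> ?Y" for y
    proof -
      obtain z where z: "z \<in> carrier F" "y = R z" using y by auto
      then have "y = ?P (R z)" using SR by simp
      then show ?thesis using z RD(3) by blast
    qed
    then show "?P ` carrier E = ?Y"
      using SD(3) by auto
  qed
  moreover have "isomorphic_tvs (subspace_tvs E ?Y) F"
    unfolding isomorphic_tvs_def
  proof (intro exI conjI)
    have YE: "?Y \<subseteq> carrier E" using RD(3) by auto
    show "VectorSpace.linear_map real_field (subspace_tvs E ?Y) F S"
      by (rule linear_mapI[OF vectorspace_subspace_tvs[OF sub] SD(2)]) (auto simp: SD(3-5) RD(3))
    have "homeomorphic_maps (subtopology (vtop E) ?Y) (vtop F) S R"
      unfolding homeomorphic_maps_def
      using S(2) R(2) SR top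
      by (auto intro: continuous_map_from_subtopology simp: continuous_map_in_subtopology)
    then show "homeomorphic_map (vtop (subspace_tvs E ?Y)) (vtop F) S"
      using homeomorphic_maps_map by auto
  qed
  ultimately show ?thesis unfolding has_complemented_copy_def by blast
qed

lemma complemented_polishable_subspace_of_copy:
  assumes "has_complemented_copy E F" "topspace (vtop E) = carrier E"
    and "polishable F" "infinite_dimensional F"
    and "topspace (vtop F) = carrier F"
  shows "has_complemented_inf_dim_polishable_subspace E"
proof -
  obtain Y T where Y: "complemented_subspace E Y"
      and T: "VectorSpace.linear_map real_field (subspace_tvs E Y) F T"
        "homeomorphic_map (vtop (subspace_tvs E Y)) (vtop F) T"
    using assms(1) unfolding has_complemented_copy_def isomorphic_tvs_def by auto
  have "Y \<subseteq> carrier E"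
    using Y subspaceD(2) unfolding complemented_subspace_def by blast
  then have top: "topspace (vtop (subspace_tvs E Y)) = carrier (subspace_tvs E Y)"
    using assms(2) by auto
  have bij: "bij_betw T (carrier (subspace_tvs E Y)) (carrier F)"
    using homeomorphic_imp_injective_map[OF T(2)] homeomorphic_imp_surjective_map[OF T(2)]
      top assms(5) by (simp add: bij_betw_def)
  have "openin (vtop F) (T ` U)" if "openin (vtop (subspace_tvs E Y)) U" for U
    using that homeomorphic_imp_open_map[OF T(2)] unfolding open_map_def by blast
  then have "polishable (subspace_tvs E Y)"
    using polishable_pullback[OF assms(3) T(1) bij top] by blast
  moreover have "infinite_dimensional (subspace_tvs E Y)"
    using infinite_dimensional_preimage[OF T(1) _ assms(4)] bij by (simp add: bij_betw_def)
  ultimately show ?thesis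
    using Y unfolding has_complemented_inf_dim_polishable_subspace_def by blast
qed

lemma quotient_tvs_simps [simp]:
  "carrier (quotient_tvs E Z) = a_rcosets\<^bsub>E\<^esub> Z"
  "zero (quotient_tvs E Z) = Z"
  "A \<oplus>\<^bsub>quotient_tvs E Z\<^esub> B = A <+>\<^bsub>E\<^esub> B"
  "vtop (quotient_tvs E Z) = quotient_topology E Z"
  by (simp_all add: quotient_tvs_def)

context
  fixes E :: "'v tvs" and Z :: "'v set"
  assumes Z: "VectorSpace.subspace real_field Z E"
begin

lemma coset_mem_iff:
  assumes "x \<in> carrier E"
  shows "y \<in> Z +>\<^bsub>E\<^esub> x \<longleftrightarrow> y \<in> carrier E \<and> y \<oplus>\<^bsub>E\<^esub> ((-1) \<odot>\<^bsub>E\<^esub> x) \<in> Z"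
proof -
  note ED = vectorspaceD[OF subspaceD(1)[OF Z]] and ZD = subspaceD[OF Z]
  have neg: "((-1) \<odot>\<^bsub>E\<^esub> x) \<oplus>\<^bsub>E\<^esub> x = \<zero>\<^bsub>E\<^esub>"
    using ED(5)[of "(-1) \<odot>\<^bsub>E\<^esub> x" x] ED(8)[of x] ED(3)[of x "-1"] assms by simp
  show ?thesis
  proof
    assume "y \<in> Z +>\<^bsub>E\<^esub> x"
    then obtain z where z: "z \<in> Z" "y = z \<oplus>\<^bsub>E\<^esub> x" by (auto simp: a_r_coset_def')
    have "z \<in> carrier E" using z ZD(2) by auto
    then have "y \<oplus>\<^bsub>E\<^esub> ((-1) \<odot>\<^bsub>E\<^esub> x) = z"
      using z assms ED(4)[of z x "(-1) \<odot>\<^bsub>E\<^esub> x"] by (simp add: ED(3,6,8))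
    then show "y \<in> carrier E \<and> y \<oplus>\<^bsub>E\<^esub> ((-1) \<odot>\<^bsub>E\<^esub> x) \<in> Z"
      using z assms \<open>z \<in> carrier E\<close> ED(2) by simp
  next
    assume y: "y \<in> carrier E \<and> y \<oplus>\<^bsub>E\<^esub> ((-1) \<odot>\<^bsub>E\<^esub> x) \<in> Z"
    then have "y = (y \<oplus>\<^bsub>E\<^esub> ((-1) \<odot>\<^bsub>E\<^esub> x)) \<oplus>\<^bsub>E\<^esub> x"
      using assms ED(4)[of y "(-1) \<odot>\<^bsub>E\<^esub> x" x] neg by (simp add: ED(3,6))
    then show "y \<in> Z +>\<^bsub>E\<^esub> x" using y unfolding a_r_coset_def' by auto
  qed
qed

interpretation abelian_subgroup Z E
proof (rule abelian_subgroupI3)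
  interpret VectorSpace.vectorspace real_field E by (rule subspaceD(1)[OF Z])
  note ED = vectorspaceD[OF subspaceD(1)[OF Z]] and ZD = subspaceD[OF Z]
  show "abelian_group E" ..
  show "additive_subgroup Z E"
    unfolding additive_subgroup_def
  proof (rule M.add.subgroupI)
    fix a assume a: "a \<in> Z"
    have "\<ominus>\<^bsub>E\<^esub> a = (-1) \<odot>\<^bsub>E\<^esub> a"
    proof (rule M.minus_equality)
      show "a \<in> carrier E" "(-1) \<odot>\<^bsub>E\<^esub> a \<in> carrier E" using a ZD(2) ED(3) by auto
      then show "((-1) \<odot>\<^bsub>E\<^esub> a) \<oplus>\<^bsub>E\<^esub> a = \<zero>\<^bsub>E\<^esub>"
        using ED(5)[of "(-1) \<odot>\<^bsub>E\<^esub> a" a] ED(8)[of a] by simp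
    qed
    then show "\<ominus>\<^bsub>E\<^esub> a \<in> Z" using a ZD(5) by simp
  qed (use ZD in auto)
qed

lemma coset_self: "x \<in> carrier E \<Longrightarrow> x \<in> Z +>\<^bsub>E\<^esub> x"
  by (rule a_rcos_self)

lemma coset_eq_iff:
  assumes "x \<in> carrier E" "y \<in> carrier E"
  shows "Z +>\<^bsub>E\<^esub> x = Z +>\<^bsub>E\<^esub> y \<longleftrightarrow> x \<oplus>\<^bsub>E\<^esub> ((-1) \<odot>\<^bsub>E\<^esub> y) \<in> Z"
  using a_repr_independence[OF _ assms(2) a_subgroup, of x] coset_self[OF assms(1)]
    coset_mem_iff[OF assms(2), of x] assms by metis

lemma carrier_quotient: "a_rcosets\<^bsub>E\<^esub> Z = (\<lambda>x. Z +>\<^bsub>E\<^esub> x) ` carrier E"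
  by (auto simp: A_RCOSETS_def')

lemma quotient_zero: "Z +>\<^bsub>E\<^esub> \<zero>\<^bsub>E\<^esub> = Z"
  using a_coset_add_zero subspaceD(2)[OF Z] by blast

lemma quotient_add:
  "x \<in> carrier E \<Longrightarrow> y \<in> carrier E \<Longrightarrow> (Z +>\<^bsub>E\<^esub> x) <+>\<^bsub>E\<^esub> (Z +>\<^bsub>E\<^esub> y) = Z +>\<^bsub>E\<^esub> (x \<oplus>\<^bsub>E\<^esub> y)"
  by (rule a_rcos_sum)

text \<open>
  Multiplication by zero would send a coset to the single point zero, so the product with a scalar is a
  union of cosets, all of which coincide.
\<close>
lemma quotient_smult:
  assumes x: "x \<in> carrier E"
  shows "a \<odot>\<^bsub>quotient_tvs E Z\<^esub> (Z +>\<^bsub>E\<^esub> x) = Z +>\<^bsub>E\<^esub> (a \<odot>\<^bsub>E\<^esub> x)"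
proof -
  note ED = vectorspaceD[OF subspaceD(1)[OF Z]] and ZD = subspaceD[OF Z]
  have "Z +>\<^bsub>E\<^esub> (a \<odot>\<^bsub>E\<^esub> y) = Z +>\<^bsub>E\<^esub> (a \<odot>\<^bsub>E\<^esub> x)" if "y \<in> Z +>\<^bsub>E\<^esub> x" for y
  proof -
    have y: "y \<in> carrier E" "y \<oplus>\<^bsub>E\<^esub> ((-1) \<odot>\<^bsub>E\<^esub> x) \<in> Z" using that coset_mem_iff x by auto
    have "a \<odot>\<^bsub>E\<^esub> (y \<oplus>\<^bsub>E\<^esub> ((-1) \<odot>\<^bsub>E\<^esub> x)) = (a \<odot>\<^bsub>E\<^esub> y) \<oplus>\<^bsub>E\<^esub> ((-1) \<odot>\<^bsub>E\<^esub> (a \<odot>\<^bsub>E\<^esub> x))"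
      using x y ED(11)[of x a "-1"] ED(11)[of x "-1" a] by (simp add: ED(3,9))
    moreover have "a \<odot>\<^bsub>E\<^esub> (y \<oplus>\<^bsub>E\<^esub> ((-1) \<odot>\<^bsub>E\<^esub> x)) \<in> Z" using y ZD(5) by blast
    ultimately show ?thesis
      using coset_eq_iff[OF ED(3)[OF y(1)] ED(3)[OF x]] by simp
  qed
  then have "(\<lambda>y. Z +>\<^bsub>E\<^esub> (a \<odot>\<^bsub>E\<^esub> y)) ` (Z +>\<^bsub>E\<^esub> x) = {Z +>\<^bsub>E\<^esub> (a \<odot>\<^bsub>E\<^esub> x)}"
    using coset_self[OF x] by blast
  then show ?thesis
    by (simp add: quotient_tvs_def)
qed

end

text \<open>
  The projection \<open>P\<close> onto \<open>Y\<close> induces a linear bijection from the quotient by its kernel onto \<open>Y\<close>.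
  This bijection is open, because the image of a set of cosets is the trace on \<open>Y\<close> of its union.
\<close>
lemma polishable_quotient_of_complemented_subspace:
  assumes "has_complemented_inf_dim_polishable_subspace E"
    and top: "topspace (vtop E) = carrier E" and haus: "Hausdorff_space (vtop E)"
  shows "has_inf_dim_polishable_quotient E"
proof -
  obtain Y P where Y: "VectorSpace.subspace real_field Y E"
      "infinite_dimensional (subspace_tvs E Y)" "polishable (subspace_tvs E Y)"
      and P: "VectorSpace.linear_map real_field E E P" "continuous_map (vtop E) (vtop E) P"
      "\<And>x. x \<in> carrier E \<Longrightarrow> P (P x) = P x" "P ` carrier E = Y"
    using assms(1)
    unfolding has_complemented_inf_dim_polishable_subspace_def complemented_subspace_def by auto
  note PD = linear_mapD[OF P(1)]
  note ED = vectorspaceD[OF PD(1)]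
  define Z where "Z = {x \<in> carrier E. P x = \<zero>\<^bsub>E\<^esub>}"
  have Z: "VectorSpace.subspace real_field Z E"
    by (rule subspaceI[OF PD(1)]) (auto simp: Z_def PD(3-6) ED(1,2,3,6,14))
  have "closedin (vtop E) {x \<in> topspace (vtop E). P x \<in> {\<zero>\<^bsub>E\<^esub>}}"
    using P(2) closedin_Hausdorff_singleton[OF haus] ED(1) top
    by (intro closedin_continuous_map_preimage) auto
  then have closed: "closed_subspace E Z"
    using Z top by (simp add: closed_subspace_def Z_def)
  let ?Q = "quotient_tvs E Z" and ?q = "\<lambda>x. Z +>\<^bsub>E\<^esub> x"
  have q_eq: "?q x = ?q y \<longleftrightarrow> P x = P y" if "x \<in> carrier E" "y \<in> carrier E" for x y
  proof -
    have "P (x \<oplus>\<^bsub>E\<^esub> ((-1) \<odot>\<^bsub>E\<^esub> y)) = P x \<oplus>\<^bsub>E\<^esub> ((-1) \<odot>\<^bsub>E\<^esub> P y)"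
      using that by (simp add: PD ED(3))
    moreover have "P x \<oplus>\<^bsub>E\<^esub> ((-1) \<odot>\<^bsub>E\<^esub> P y) = \<zero>\<^bsub>E\<^esub> \<longleftrightarrow> P x = P y"
    proof
      assume eq: "P x \<oplus>\<^bsub>E\<^esub> ((-1) \<odot>\<^bsub>E\<^esub> P y) = \<zero>\<^bsub>E\<^esub>"
      have c: "P x \<in> carrier E" "P y \<in> carrier E" "(-1) \<odot>\<^bsub>E\<^esub> P y \<in> carrier E"
        using that by (auto simp: PD ED(3))
      have "P x = P x \<oplus>\<^bsub>E\<^esub> (P y \<oplus>\<^bsub>E\<^esub> ((-1) \<odot>\<^bsub>E\<^esub> P y))"
        using c by (simp add: ED(6,8))
      also have "\<dots> = (P x \<oplus>\<^bsub>E\<^esub> ((-1) \<odot>\<^bsub>E\<^esub> P y)) \<oplus>\<^bsub>E\<^esub> P y"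
        using c ED(4)[of "P x" "(-1) \<odot>\<^bsub>E\<^esub> P y" "P y"] ED(5)[of "P y" "(-1) \<odot>\<^bsub>E\<^esub> P y"] by simp
      also have "\<dots> = P y" unfolding eq using c by (simp add: ED(7))
      finally show "P x = P y" .
    qed (use that in \<open>simp add: PD ED(8)\<close>)
    ultimately show ?thesis
      using coset_eq_iff[OF Z that] that by (auto simp: Z_def ED(2,3))
  qed
  define T where "T A = P (SOME x. x \<in> carrier E \<and> A = ?q x)" for A
  have T: "T (?q x) = P x" if "x \<in> carrier E" for x
  proof -
    let ?y = "SOME y. y \<in> carrier E \<and> ?q x = ?q y"
    have "?y \<in> carrier E \<and> ?q x = ?q ?y"
      by (rule someI[of _ x]) (use that in simp)
    then show ?thesis using q_eq that unfolding T_def by metis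
  qed
  have vY: "VectorSpace.vectorspace real_field (subspace_tvs E Y)"
    by (rule vectorspace_subspace_tvs[OF Y(1)])
  have cQ: "carrier ?Q = ?q ` carrier E"
    by (simp add: carrier_quotient[OF Z])
  have injT: "inj_on T (carrier ?Q)"
    unfolding cQ by (auto simp: inj_on_def T q_eq)
  have TY: "T A \<in> Y" if "A \<in> carrier ?Q" for A
    using that T P(4) unfolding cQ by auto
  have Tadd: "T (A \<oplus>\<^bsub>?Q\<^esub> B) = T A \<oplus>\<^bsub>E\<^esub> T B" "A \<oplus>\<^bsub>?Q\<^esub> B \<in> carrier ?Q"
    if "A \<in> carrier ?Q" "B \<in> carrier ?Q" for A B
    using that unfolding cQ by (auto simp: quotient_add[OF Z] T PD ED(2))
  have Tsm: "T (a \<odot>\<^bsub>?Q\<^esub> A) = a \<odot>\<^bsub>E\<^esub> T A" "a \<odot>\<^bsub>?Q\<^esub> A \<in> carrier ?Q"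
    if "A \<in> carrier ?Q" for A a
    using that unfolding cQ by (auto simp: quotient_smult[OF Z] T PD ED(3))
  have Q0: "Z \<in> carrier ?Q" "T Z = \<zero>\<^bsub>E\<^esub>"
    using quotient_zero[OF Z] T[OF ED(1)] PD(6) ED(1) unfolding cQ by force+
  have vQ: "VectorSpace.vectorspace real_field ?Q"
    by (rule vectorspace_pullback[OF vY injT]) (use TY Tadd Tsm Q0 in auto)
  have lin: "VectorSpace.linear_map real_field ?Q (subspace_tvs E Y) T"
    by (rule linear_mapI[OF vQ vY]) (use TY Tadd Tsm in auto)
  have "T ` carrier ?Q = Y"
    unfolding cQ image_image using T P(4) by auto
  then have bij: "bij_betw T (carrier ?Q) (carrier (subspace_tvs E Y))"
    using injT by (simp add: bij_betw_def)
  have topQ: "topspace (vtop ?Q) = carrier ?Q"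
  proof -
    have "{x \<in> topspace (vtop E). ?q x \<in> a_rcosets\<^bsub>E\<^esub> Z} = topspace (vtop E)"
      using top by (auto simp: carrier_quotient[OF Z])
    then have "openin (quotient_topology E Z) (a_rcosets\<^bsub>E\<^esub> Z)"
      unfolding openin_quotient_topology by simp
    moreover have "topspace (quotient_topology E Z) \<subseteq> a_rcosets\<^bsub>E\<^esub> Z"
      using openin_topspace[of "quotient_topology E Z"] unfolding openin_quotient_topology by blast
    ultimately show ?thesis
      using openin_subset by fastforce
  qed
  have opn: "openin (vtop (subspace_tvs E Y)) (T ` U)" if U: "openin (vtop ?Q) U" for U
  proof -
    let ?V = "{x \<in> topspace (vtop E). ?q x \<in> U}"
    have V: "openin (vtop E) ?V" and UQ: "U \<subseteq> ?q ` carrier E"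
      using U by (auto simp: openin_quotient_topology carrier_quotient[OF Z])
    have YE: "Y \<subseteq> carrier E" using Y(1) subspaceD(2) by blast
    have PY: "P y = y" if "y \<in> Y" for y using that P(3,4) by auto
    have "T ` U = ?V \<inter> Y"
    proof (intro subset_antisym subsetI)
      fix y assume "y \<in> T ` U"
      then obtain x where x: "x \<in> carrier E" "?q x \<in> U" "y = P x" using UQ T by auto
      then have "y \<in> Y" using P(4) by auto
      moreover have "?q y = ?q x" using x P(3) YE \<open>y \<in> Y\<close> by (subst q_eq) auto
      ultimately show "y \<in> ?V \<inter> Y" using x YE top by auto
    next
      fix y assume y: "y \<in> ?V \<inter> Y"
      then have "y = T (?q y)" using T YE PY by auto
      then show "y \<in> T ` U" using y by auto
    qed
    then show ?thesis using V by (auto simp: openin_subtopology)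
  qed
  have "polishable ?Q"
    by (rule polishable_pullback[OF Y(3) lin bij topQ opn])
  moreover have "infinite_dimensional ?Q"
    using infinite_dimensional_preimage[OF lin _ Y(2)] bij by (simp add: bij_betw_def)
  ultimately show ?thesis
    using closed unfolding has_inf_dim_polishable_quotient_def by blast
qed

section \<open>Function spaces\<close>

lemma real_power_simps [simp]:
  "carrier (real_power S) = S \<rightarrow>\<^sub>E UNIV" "zero (real_power S) = (\<lambda>x\<in>S. 0)"
  "f \<oplus>\<^bsub>real_power S\<^esub> g = (\<lambda>x\<in>S. f x + g x)" "a \<odot>\<^bsub>real_power S\<^esub> f = (\<lambda>x\<in>S. a * f x)"
  "vtop (real_power S) = powertop_real S"
  by (simp_all add: real_power_def)

lemma vectorspace_real_power: "VectorSpace.vectorspace real_field (real_power S)"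
proof (rule vs_criteria[OF field_real_field], goal_cases)
  case 3
  have "f \<oplus>\<^bsub>real_power S\<^esub> (\<lambda>x\<in>S. - f x) = zero (real_power S)" for f
    by auto
  then show ?case by (metis real_power_simps(1) restrict_PiE_iff UNIV_I)
qed (auto simp: algebra_simps PiE_def extensional_def restrict_def fun_eq_iff)

lemma Cp_simps [simp]:
  "carrier (Cp X) = {f \<in> extensional (topspace X). continuous_map X euclideanreal f}"
  "zero (Cp X) = (\<lambda>x\<in>topspace X. 0)"
  "f \<oplus>\<^bsub>Cp X\<^esub> g = (\<lambda>x\<in>topspace X. f x + g x)" "a \<odot>\<^bsub>Cp X\<^esub> f = (\<lambda>x\<in>topspace X. a * f x)"
  by (simp_all add: Cp_def)

lemma restrict_in_Cp:
  assumes "continuous_map X euclideanreal f"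
  shows "restrict f (topspace X) \<in> carrier (Cp X)"
  using continuous_map_eq[OF assms, of "restrict f (topspace X)"] by simp

lemma vectorspace_Cp: "VectorSpace.vectorspace real_field (Cp X)"
proof (rule vectorspace_subset[OF vectorspace_real_power[of "topspace X"]])
  show "\<zero>\<^bsub>real_power (topspace X)\<^esub> \<in> carrier (Cp X)"
    using restrict_in_Cp[of X "\<lambda>x. 0"] by simp
  fix f g a assume f: "f \<in> carrier (Cp X)"
  show "a \<odot>\<^bsub>real_power (topspace X)\<^esub> f \<in> carrier (Cp X)"
    using restrict_in_Cp[of X "\<lambda>x. a * f x"] f by (simp add: continuous_map_real_mult_left)
  assume "g \<in> carrier (Cp X)"
  then show "f \<oplus>\<^bsub>real_power (topspace X)\<^esub> g \<in> carrier (Cp X)"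
    using restrict_in_Cp[of X "\<lambda>x. f x + g x"] f by (simp add: continuous_map_add)
next
  show "carrier (Cp X) \<subseteq> carrier (real_power (topspace X))"
    by (rule subsetI) (simp add: PiE_def)
qed (simp_all add: Cp_def)

lemma vtop_Cp: "vtop (Cp X) = subtopology (powertop_real (topspace X)) (carrier (Cp X))"
  by (simp add: Cp_def)

lemma topspace_Cp [simp]: "topspace (vtop (Cp X)) = carrier (Cp X)"
proof -
  have "carrier (Cp X) \<subseteq> topspace X \<rightarrow>\<^sub>E UNIV"
    by (rule subsetI) (simp add: PiE_def)
  then show ?thesis unfolding vtop_Cp by auto
qed

lemma Hausdorff_Cp: "Hausdorff_space (vtop (Cp X))"
  unfolding vtop_Cp by (intro Hausdorff_space_subtopology) (simp add: Hausdorff_space_product_topology)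

lemma continuous_map_evaluation:
  assumes "x \<in> topspace X"
  shows "continuous_map (vtop (Cp X)) euclideanreal (\<lambda>f. f x)"
  unfolding vtop_Cp
  by (intro continuous_map_from_subtopology continuous_map_product_projection assms)

lemma RN_simps [simp]:
  "carrier RN = UNIV" "zero RN = (\<lambda>n. 0)" "f \<oplus>\<^bsub>RN\<^esub> g = (\<lambda>n. f n + g n)"
  "a \<odot>\<^bsub>RN\<^esub> f = (\<lambda>n. a * f n)" "vtop RN = powertop_real UNIV"
  by (simp_all add: RN_def PiE_UNIV_domain restrict_UNIV)

lemma c0_simps [simp]:
  "carrier c0 = {x. x \<longlonglongrightarrow> 0}" "zero c0 = (\<lambda>n. 0)" "f \<oplus>\<^bsub>c0\<^esub> g = (\<lambda>n. f n + g n)"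
  "a \<odot>\<^bsub>c0\<^esub> f = (\<lambda>n. a * f n)" "vtop c0 = subtopology (powertop_real UNIV) {x. x \<longlonglongrightarrow> 0}"
  by (simp_all add: c0_def)

lemma vectorspace_RN: "VectorSpace.vectorspace real_field RN"
  unfolding RN_def by (rule vectorspace_real_power)

lemma vectorspace_c0: "VectorSpace.vectorspace real_field c0"
  by (rule vectorspace_subset[OF vectorspace_RN])
    (auto simp: c0_def intro: tendsto_add_zero tendsto_mult_right_zero)

lemma infinite_dimensional_RN: "infinite_dimensional RN"
  by (rule infinite_dimensional_biorthogonal[OF vectorspace_RN,
        where e = "\<lambda>k n. if n = k then 1 else 0" and p = "\<lambda>k x. x k"]) auto

lemma infinite_dimensional_c0: "infinite_dimensional c0"
proof (rule infinite_dimensional_biorthogonal[OF vectorspace_c0,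
        where e = "\<lambda>k n. if n = k then 1 else 0" and p = "\<lambda>k x. x k"])
  fix k :: nat
  have "eventually (\<lambda>n. (if n = k then 1 else 0 :: real) = 0) sequentially"
    using eventually_gt_at_top[of k] by eventually_elim auto
  then show "(\<lambda>n. if n = k then 1 else 0) \<in> carrier c0"
    by (simp add: tendsto_eventually)
qed auto

section \<open>Polishability of the two sequence spaces\<close>

lemma separable_space_euclidean:
  "separable_space (euclidean :: 'a::second_countable_topology topology)"
proof -
  obtain D :: "'a set" where D: "countable D" "\<And>X. open X \<Longrightarrow> X \<noteq> {} \<Longrightarrow> \<exists>d\<in>D. d \<in> X"
    using countable_dense_exists by blast
  have "euclidean closure_of D = UNIV"
    using D(2) by (auto simp: in_closure_of simp del: euclidean_closure_of) blast
  then show ?thesis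
    unfolding separable_space_def using D(1) by auto
qed

lemma frechet_space_RN: "frechet_space RN"
proof -
  let ?P = "powertop_real (UNIV :: nat set)"
  have proj: "continuous_map ?P euclideanreal (\<lambda>f. f n)" for n
    by (intro continuous_map_product_projection) simp
  have add: "continuous_map (prod_topology ?P ?P) ?P (\<lambda>(x, y). (\<lambda>n. x n + y n))"
    unfolding continuous_map_componentwise_UNIV case_prod_unfold
    by (intro allI continuous_map_add continuous_map_compose[OF continuous_map_fst proj, unfolded o_def]
        continuous_map_compose[OF continuous_map_snd proj, unfolded o_def])
  have scale: "continuous_map (prod_topology euclideanreal ?P) ?P (\<lambda>(a, x). (\<lambda>n. a * x n))"
    unfolding continuous_map_componentwise_UNIV case_prod_unfold
    by (intro allI continuous_map_real_mult continuous_map_fst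
        continuous_map_compose[OF continuous_map_snd proj, unfolded o_def])
  have lc: "\<exists>V. openin ?P V \<and> (\<lambda>n. 0) \<in> V \<and> V \<subseteq> U \<and> convex_in RN V"
    if U: "openin ?P U" "(\<lambda>n. 0) \<in> U" for U
  proof -
    obtain A where A: "(\<lambda>n. 0) \<in> Pi\<^sub>E UNIV A" "\<And>i. open (A i)" "finite {i. A i \<noteq> UNIV}" "Pi\<^sub>E UNIV A \<subseteq> U"
      using product_topology_open_contains_basis[OF U] by auto
    have "\<exists>e>0. ball 0 e \<subseteq> A i" for i
    proof -
      have "0 \<in> A i" using A(1) by (auto simp: PiE_iff)
      then show ?thesis using A(2)[of i] openE by blast
    qed
    then obtain e where e: "\<And>i. e i > 0" "\<And>i. ball 0 (e i) \<subseteq> A i" by metis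
    define B where "B i = (if A i = UNIV then UNIV else ball (0::real) (e i))" for i
    let ?V = "Pi\<^sub>E UNIV B"
    have "finite {i. B i \<noteq> UNIV}" using A(3) by (rule rev_finite_subset) (auto simp: B_def)
    then have "openin ?P ?V"
      by (intro product_topology_basis) (auto simp: B_def)
    moreover have "?V \<subseteq> Pi\<^sub>E UNIV A"
      using e(2) by (intro PiE_mono) (auto simp: B_def)
    then have "?V \<subseteq> U" using A(4) by blast
    moreover have "convex_in RN ?V"
    proof -
      have "(1 - t) * x + t * y \<in> B i" if "x \<in> B i" "y \<in> B i" "t \<in> {0..1}" for x y t :: real and i
      proof -
        have cB: "convex (B i)"
          unfolding B_def by (rule if_split[THEN iffD2]) (intro conjI impI convex_UNIV convex_ball)
        show ?thesis
          using convexD_alt[OF cB that(1,2), of t] that(3) by (simp only: real_scaleR_def atLeastAtMost_iff)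
      qed
      then show ?thesis unfolding convex_in_def by (simp add: PiE_iff)
    qed
    moreover have "(\<lambda>n. 0) \<in> ?V" using e(1) by (auto simp: B_def)
    ultimately show ?thesis by blast
  qed
  have "Metric_space (UNIV :: (nat \<Rightarrow> real) set) dist"
    by (rule Met_TC.Metric_space_axioms)
  moreover have "Met_TC.mtopology = ?P"
    by (simp add: euclidean_product_topology)
  moreover have "Met_TC.mcomplete TYPE(nat \<Rightarrow> real)"
    using complete_UNIV mcomplete_iff_complete by blast
  moreover have "dist (\<lambda>n. x n + z n) (\<lambda>n. y n + z n) = dist x y" for x y z :: "nat \<Rightarrow> real"
    by (simp add: dist_fun_def dist_real_def)
  ultimately have "\<exists>d. Metric_space (carrier RN) d \<and>
         Metric_space.mtopology (carrier RN) d = vtop RN \<and>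
         Metric_space.mcomplete (carrier RN) d \<and>
         (\<forall>x\<in>carrier RN. \<forall>y\<in>carrier RN. \<forall>z\<in>carrier RN. d (x \<oplus>\<^bsub>RN\<^esub> z) (y \<oplus>\<^bsub>RN\<^esub> z) = d x y)"
    by (intro exI[of _ dist]) simp
  then show ?thesis
    unfolding frechet_space_def locally_convex_space_def topological_vector_space_def
      topological_vector_space_axioms_def locally_convex_space_axioms_def frechet_space_axioms_def
    using vectorspace_RN add scale lc by (simp add: PiE_UNIV_domain)
qed

lemma polishable_RN: "polishable RN"
proof -
  have "RN\<lparr>vtop := vtop RN\<rparr> = RN" by simp
  then have "frechet_space (RN\<lparr>vtop := vtop RN\<rparr>)"
    using frechet_space_RN by (simp only:)
  moreover have "separable_space (vtop RN)"
    using separable_space_euclidean[where ?'a = "nat \<Rightarrow> real"] by (simp add: euclidean_product_topology)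
  ultimately show ?thesis
    unfolding polishable_def by blast
qed

definition normed_tvs :: "'b::real_normed_vector set \<Rightarrow> 'b tvs" where
  "normed_tvs W = \<lparr>carrier = W, mult = (\<lambda>x y. 0), one = 0, zero = 0, add = (+), smult = scaleR,
     vtop = top_of_set W\<rparr>"

lemma normed_tvs_simps [simp]:
  "carrier (normed_tvs W) = W" "zero (normed_tvs W) = 0" "add (normed_tvs W) = (+)"
  "smult (normed_tvs W) = scaleR" "vtop (normed_tvs W) = top_of_set W"
  by (simp_all add: normed_tvs_def)

lemma vectorspace_normed_tvs:
  assumes "Real_Vector_Spaces.subspace W"
  shows "VectorSpace.vectorspace real_field (normed_tvs W)"
  by (rule vs_criteria[OF field_real_field])
    (auto simp: subspace_0 subspace_add subspace_scale algebra_simps assms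
      intro!: bexI[of _ "- _"] subspace_neg)

lemma frechet_space_normed_tvs:
  assumes W: "Real_Vector_Spaces.subspace W" "complete W"
  shows "frechet_space (normed_tvs W)"
proof -
  have add: "continuous_map (prod_topology (top_of_set W) (top_of_set W)) (top_of_set W) (\<lambda>(x, y). x + y)"
    using W(1) by (auto simp: continuous_map_in_subtopology case_prod_unfold subspace_add
        intro!: continuous_intros)
  have "continuous_map (prod_topology (top_of_set UNIV) (top_of_set W)) (top_of_set W) (\<lambda>(a::real, x). a *\<^sub>R x)"
    unfolding prod_topology_subtopology_eu
    using W(1) by (auto simp: continuous_map_in_subtopology case_prod_unfold subspace_scale
        intro!: continuous_intros)
  then have scale: "continuous_map (prod_topology euclideanreal (top_of_set W)) (top_of_set W) (\<lambda>(a, x). a *\<^sub>R x)"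
    by simp
  have lc: "\<exists>V. openin (top_of_set W) V \<and> 0 \<in> V \<and> V \<subseteq> U \<and> convex_in (normed_tvs W) V"
    if U: "openin (top_of_set W) U" "0 \<in> U" for U
  proof -
    obtain e where e: "e > 0" "ball 0 e \<inter> W \<subseteq> U"
      using U by (meson openin_contains_ball)
    have "convex (ball 0 e \<inter> W)"
      using W(1) by (intro convex_Int convex_ball subspace_imp_convex)
    then have "convex_in (normed_tvs W) (ball 0 e \<inter> W)"
      unfolding convex_alt convex_in_def by auto
    moreover have "openin (top_of_set W) (ball 0 e \<inter> W)"
      using openin_open_Int[of "ball 0 e" W] by (simp add: Int_commute)
    ultimately show ?thesis
      using e W(1) by (intro exI[of _ "ball 0 e \<inter> W"]) (auto simp: subspace_0)
  qed
  interpret SM: Submetric UNIV dist W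
    by unfold_locales auto
  have "SM.sub.mtopology = top_of_set W"
    using SM.mtopology_submetric by simp
  moreover have "SM.sub.mcomplete"
    unfolding SM.sub.mcomplete_def
  proof (intro allI impI)
    fix s assume s: "SM.sub.MCauchy s"
    then have sW: "\<forall>n. s n \<in> W" and "Cauchy s"
      unfolding SM.sub.MCauchy_def Cauchy_def by auto
    then obtain l where l: "l \<in> W" "s \<longlonglongrightarrow> l"
      using W(2) unfolding complete_def by (metis (full_types))
    show "\<exists>x. limitin SM.sub.mtopology s x sequentially"
      unfolding SM.sub.limit_metric_sequentially
      by (rule exI[of _ l]) (use sW l in \<open>simp add: lim_sequentially\<close>)
  qed
  ultimately have "\<exists>d. Metric_space W d \<and> Metric_space.mtopology W d = top_of_set W \<and>
         Metric_space.mcomplete W d \<and> (\<forall>x\<in>W. \<forall>y\<in>W. \<forall>z\<in>W. d (x + z) (y + z) = d x y)"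
    using SM.sub.Metric_space_axioms by (intro exI[of _ dist]) (simp add: dist_norm)
  then show ?thesis
    unfolding frechet_space_def locally_convex_space_def topological_vector_space_def
      topological_vector_space_axioms_def locally_convex_space_axioms_def frechet_space_axioms_def
    using vectorspace_normed_tvs[OF W(1)] add scale lc by simp
qed

text \<open>The set underlying \<open>c\<^sub>0\<close> as a subspace of the Banach space of bounded sequences.\<close>
definition null_bcontfuns :: "(nat \<Rightarrow>\<^sub>C real) set" where
  "null_bcontfuns = {f. apply_bcontfun f \<longlonglongrightarrow> 0}"

lemma subspace_null_bcontfuns: "Real_Vector_Spaces.subspace null_bcontfuns"
  unfolding Real_Vector_Spaces.subspace_def null_bcontfuns_def
  by (auto intro: tendsto_add_zero tendsto_mult_right_zero)

lemma closed_null_bcontfuns: "closed null_bcontfuns"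
proof -
  have "f \<in> null_bcontfuns" if f: "f \<in> closure null_bcontfuns" for f
  proof -
    have "\<exists>N. \<forall>n\<ge>N. norm (apply_bcontfun f n - 0) < e" if "e > 0" for e
    proof -
      obtain g where g: "apply_bcontfun g \<longlonglongrightarrow> 0" "dist g f < e/2"
        using f \<open>e > 0\<close> unfolding closure_approachable null_bcontfuns_def
        by (metis half_gt_zero mem_Collect_eq)
      obtain N where N: "\<And>n. n \<ge> N \<Longrightarrow> \<bar>apply_bcontfun g n\<bar> < e/2"
        using LIMSEQ_D[OF g(1), of "e/2"] \<open>e > 0\<close> by auto
      have "\<bar>apply_bcontfun f n\<bar> < e" if "n \<ge> N" for n
        using N[OF that] dist_fun_lt_imp_dist_val_lt[OF g(2), of n] unfolding dist_real_def by linarith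
      then show ?thesis by auto
    qed
    then show ?thesis unfolding null_bcontfuns_def by (simp add: LIMSEQ_iff)
  qed
  then show ?thesis unfolding closure_subset_eq[symmetric] by blast
qed

lemma complete_null_bcontfuns: "complete null_bcontfuns"
  unfolding complete_def
proof (intro allI impI, elim conjE)
  fix f :: "nat \<Rightarrow> nat \<Rightarrow>\<^sub>C real" assume f: "\<forall>n. f n \<in> null_bcontfuns" "Cauchy f"
  then obtain g where "uniform_limit UNIV f g sequentially"
    using uniformly_convergent_eq_cauchy[of "\<lambda>_. True" f]
    unfolding Cauchy_def uniform_limit_sequentially_iff
    by (metis dist_fun_lt_imp_dist_val_lt)
  then obtain l where "f \<longlonglongrightarrow> l"
    using uniform_limit_bcontfunE[OF _ sequentially_bot] by metis
  then show "\<exists>l\<in>null_bcontfuns. f \<longlonglongrightarrow> l"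
    using closed_sequentially[OF closed_null_bcontfuns] f(1) by blast
qed

lemma null_sequence_bcontfun:
  fixes x :: "nat \<Rightarrow> real"
  assumes "x \<longlonglongrightarrow> 0"
  shows "apply_bcontfun (Bcontfun x) = x"
proof (rule Bcontfun_inverse)
  have "bounded (range x)" using assms convergent_imp_bounded by blast
  then show "x \<in> bcontfun" by (simp add: bcontfun_def)
qed

lemma separable_null_bcontfuns: "separable_space (top_of_set null_bcontfuns)"
proof -
  define r where "r l n = (if n < length l then real_of_rat (l ! n) else 0)" for l and n :: nat
  have r0: "r l \<longlonglongrightarrow> 0" for l
  proof -
    have "eventually (\<lambda>n. r l n = 0) sequentially"
      using eventually_ge_at_top[of "length l"] by eventually_elim (simp add: r_def)
    then show ?thesis by (simp add: tendsto_eventually)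
  qed
  define D where "D = range (\<lambda>l. Bcontfun (r l))"
  have DW: "D \<subseteq> null_bcontfuns"
    by (auto simp: D_def null_bcontfuns_def null_sequence_bcontfun[OF r0] r0)
  have "null_bcontfuns \<subseteq> closure D"
  proof
    fix f assume "f \<in> null_bcontfuns"
    then have f: "apply_bcontfun f \<longlonglongrightarrow> 0" by (simp add: null_bcontfuns_def)
    show "f \<in> closure D"
      unfolding closure_approachable
    proof (intro allI impI)
      fix e :: real assume e: "e > 0"
      obtain N where N: "\<And>n. n \<ge> N \<Longrightarrow> \<bar>apply_bcontfun f n\<bar> < e/2"
        using LIMSEQ_D[OF f, of "e/2"] e by auto
      have "\<exists>q. \<bar>real_of_rat q - apply_bcontfun f n\<bar> < e/2" for n
      proof -
        obtain q where "apply_bcontfun f n < real_of_rat q" "real_of_rat q < apply_bcontfun f n + e/2"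
          using of_rat_dense[of "apply_bcontfun f n" "apply_bcontfun f n + e/2"] e by auto
        then show ?thesis by (intro exI[of _ q]) simp
      qed
      then obtain q where q: "\<And>n. \<bar>real_of_rat (q n) - apply_bcontfun f n\<bar> < e/2" by metis
      let ?g = "r (map q [0..<N])"
      have "dist (Bcontfun ?g) f \<le> e/2"
      proof (rule dist_bound)
        fix n
        show "dist (apply_bcontfun (Bcontfun ?g) n) (apply_bcontfun f n) \<le> e/2"
          using q[of n] N[of n] unfolding null_sequence_bcontfun[OF r0]
          by (cases "n < N") (simp_all add: r_def dist_real_def less_imp_le not_less)
      qed
      then show "\<exists>y\<in>D. dist y f < e"
        using e unfolding D_def by (intro bexI[OF _ rangeI[of _ "map q [0..<N]"]]) simp
    qed
  qed
  moreover have "countable D" unfolding D_def by simp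
  ultimately show ?thesis
    unfolding separable_space_def using DW
    by (intro exI[of _ D]) (auto simp: closure_of_subtopology Int_absorb1)
qed

text \<open>
  The sup norm makes \<open>c\<^sub>0\<close> a separable Banach space, and its topology is finer than that of
  pointwise convergence.
\<close>
lemma polishable_c0: "polishable c0"
proof (rule polishable_pullback)
  let ?W = null_bcontfuns
  show "polishable (normed_tvs ?W)"
  proof -
    have "(normed_tvs ?W)\<lparr>vtop := top_of_set ?W\<rparr> = normed_tvs ?W"
      by (simp add: normed_tvs_def)
    then have "frechet_space ((normed_tvs ?W)\<lparr>vtop := top_of_set ?W\<rparr>)"
      using frechet_space_normed_tvs[OF subspace_null_bcontfuns complete_null_bcontfuns] by (simp only:)
    then show ?thesis
      unfolding polishable_def using separable_null_bcontfuns
      by (intro exI[of _ "top_of_set ?W"]) simp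
  qed
  have ab: "apply_bcontfun (Bcontfun x) = x" if "x \<in> carrier c0" for x
    using that null_sequence_bcontfun by simp
  show "VectorSpace.linear_map real_field c0 (normed_tvs ?W) Bcontfun"
  proof (rule linear_mapI[OF vectorspace_c0 vectorspace_normed_tvs[OF subspace_null_bcontfuns]])
    fix x y a assume x: "x \<in> carrier c0"
    then show "Bcontfun x \<in> carrier (normed_tvs ?W)"
      by (simp add: null_bcontfuns_def null_sequence_bcontfun)
    have "a \<odot>\<^bsub>c0\<^esub> x \<in> carrier c0" using x vectorspaceD(3)[OF vectorspace_c0] by blast
    then show "Bcontfun (a \<odot>\<^bsub>c0\<^esub> x) = a \<odot>\<^bsub>normed_tvs ?W\<^esub> Bcontfun x"
      using x by (intro bcontfun_eqI) (simp only: ab, simp add: null_sequence_bcontfun)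
    assume y: "y \<in> carrier c0"
    have "x \<oplus>\<^bsub>c0\<^esub> y \<in> carrier c0" using x y vectorspaceD(2)[OF vectorspace_c0] by blast
    then show "Bcontfun (x \<oplus>\<^bsub>c0\<^esub> y) = Bcontfun x \<oplus>\<^bsub>normed_tvs ?W\<^esub> Bcontfun y"
      using x y by (intro bcontfun_eqI) (simp only: ab, simp add: null_sequence_bcontfun)
  qed
  have inv: "Bcontfun (apply_bcontfun f) = f" for f :: "nat \<Rightarrow>\<^sub>C real"
    by (rule apply_bcontfun_inverse)
  show "bij_betw Bcontfun (carrier c0) (carrier (normed_tvs ?W))"
    by (rule bij_betw_byWitness[where f' = apply_bcontfun])
      (auto simp: null_bcontfuns_def null_sequence_bcontfun inv)
  show "topspace (vtop c0) = carrier c0"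
    by (simp add: PiE_UNIV_domain)
  fix U assume U: "openin (vtop c0) U"
  have "continuous_on UNIV (\<lambda>f::nat \<Rightarrow>\<^sub>C real. apply_bcontfun f n)" for n
    by (rule continuous_onI) (metis dist_bounded order_le_less_trans less_imp_le)
  then have "continuous_map (top_of_set ?W) (vtop c0) apply_bcontfun"
    by (auto simp: continuous_map_in_subtopology continuous_map_componentwise_UNIV null_bcontfuns_def
        intro: continuous_on_subset)
  then have "openin (top_of_set ?W) {f \<in> ?W. apply_bcontfun f \<in> U}"
    using U by (metis (no_types, lifting) Collect_cong continuous_map_def topspace_euclidean_subtopology)
  moreover have "{f \<in> ?W. apply_bcontfun f \<in> U} = Bcontfun ` U"
  proof -
    have "U \<subseteq> {x. x \<longlonglongrightarrow> 0}" using openin_subset[OF U] by simp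
    then show ?thesis
      using inv by (auto simp: null_bcontfuns_def null_sequence_bcontfun image_iff) metis
  qed
  ultimately show "openin (vtop (normed_tvs ?W)) (Bcontfun ` U)" by simp
qed

section \<open>Finitely supported measures\<close>

text \<open>The total variation of a measure on a set.\<close>
definition sm_mass :: "('a \<Rightarrow> real) \<Rightarrow> 'a set \<Rightarrow> real" where
  "sm_mass \<mu> A = (\<Sum>x\<in>{x. \<mu> x \<noteq> 0} \<inter> A. \<bar>\<mu> x\<bar>)"

lemma sm_mass_mono:
  assumes "finite {x. \<mu> x \<noteq> 0}" "{x. \<mu> x \<noteq> 0} \<inter> A \<subseteq> B"
  shows "sm_mass \<mu> A \<le> sm_mass \<mu> B"
  unfolding sm_mass_def using assms by (intro sum_mono2) auto

lemma sm_mass_Un: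
  assumes "finite {x. \<mu> x \<noteq> 0}"
  shows "sm_mass \<mu> (A \<union> B) \<le> sm_mass \<mu> A + sm_mass \<mu> B"
proof -
  let ?S = "{x. \<mu> x \<noteq> 0}"
  have "sm_mass \<mu> (A \<union> B) + (\<Sum>x\<in>(?S \<inter> A) \<inter> (?S \<inter> B). \<bar>\<mu> x\<bar>) = sm_mass \<mu> A + sm_mass \<mu> B"
    unfolding sm_mass_def Int_Un_distrib using assms by (intro sum.union_inter) auto
  moreover have "0 \<le> (\<Sum>x\<in>(?S \<inter> A) \<inter> (?S \<inter> B). \<bar>\<mu> x\<bar>)"
    by (intro sum_nonneg) auto
  ultimately show ?thesis by linarith
qed

lemma sm_mass_Diff:
  assumes "finite {x. \<mu> x \<noteq> 0}"
  shows "sm_mass \<mu> A - sm_mass \<mu> B \<le> sm_mass \<mu> (A - B)"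
proof -
  have "sm_mass \<mu> A \<le> sm_mass \<mu> ((A - B) \<union> B)"
    using assms by (intro sm_mass_mono) auto
  then show ?thesis using sm_mass_Un[OF assms, of "A - B" B] by linarith
qed

lemma sum_sm_mass_disjoint:
  assumes fin: "finite {x. \<mu> x \<noteq> 0}" and I: "finite I"
    and disj: "\<And>i j. i \<in> I \<Longrightarrow> j \<in> I \<Longrightarrow> i \<noteq> j \<Longrightarrow> A i \<inter> A j = {}"
  shows "(\<Sum>i\<in>I. sm_mass \<mu> (A i)) \<le> sm_norm \<mu>"
proof -
  have "(\<Sum>i\<in>I. sm_mass \<mu> (A i)) = (\<Sum>x\<in>(\<Union>i\<in>I. {x. \<mu> x \<noteq> 0} \<inter> A i). \<bar>\<mu> x\<bar>)"
    unfolding sm_mass_def using fin I disj by (intro sum.UNION_disjoint[symmetric]) blast+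
  also have "\<dots> \<le> sm_norm \<mu>"
    unfolding sm_norm_def using fin by (intro sum_mono2) auto
  finally show ?thesis .
qed

lemma sm_apply_cong:
  assumes "sign_measure_on X \<mu>" "\<And>x. x \<in> topspace X \<Longrightarrow> f x = g x"
  shows "sm_apply \<mu> f = sm_apply \<mu> g"
  unfolding sm_apply_def using assms by (intro sum.cong) (auto simp: sign_measure_on_def)

lemma sm_apply_add: "sm_apply \<mu> (\<lambda>x. f x + g x) = sm_apply \<mu> f + sm_apply \<mu> g"
  by (simp add: sm_apply_def sum.distrib distrib_left)

lemma sm_apply_mult: "sm_apply \<mu> (\<lambda>x. a * f x) = a * sm_apply \<mu> f"
  by (simp add: sm_apply_def sum_distrib_left mult.left_commute)

lemma continuous_map_sm_apply:
  assumes "sign_measure_on X \<mu>"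
  shows "continuous_map (vtop (Cp X)) euclideanreal (sm_apply \<mu>)"
  unfolding sm_apply_def
  using assms by (intro continuous_map_sum continuous_map_real_mult_left continuous_map_evaluation)
    (auto simp: sign_measure_on_def)

section \<open>Interpolation in Tychonoff spaces\<close>

lemma tychonoff_interpolation:
  assumes X: "tychonoff_space X" and F: "finite F" "F \<subseteq> topspace X"
    and D: "closedin X D" "F \<inter> D = {}" and M: "0 \<le> M" "\<And>x. x \<in> F \<Longrightarrow> \<bar>v x\<bar> \<le> M"
  obtains g where "continuous_map X euclideanreal g" "\<And>x. x \<in> F \<Longrightarrow> g x = v x"
    "\<And>x. x \<in> D \<Longrightarrow> g x = 0" "\<And>x. \<bar>g x\<bar> \<le> M"
proof -
  have "\<exists>b. continuous_map X euclideanreal b \<and> b x = 1 \<and> (\<forall>y\<in>D \<union> (F - {x}). b y = 0)" if x: "x \<in> F" for x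
  proof -
    have "closedin X (D \<union> (F - {x}))"
      using X F by (intro closedin_Un D(1) closedin_Hausdorff_finite[of X "F - {x}"])
        (auto simp: tychonoff_space_def)
    moreover have "x \<in> topspace X - (D \<union> (F - {x}))" using x F D(2) by auto
    ultimately obtain f where f: "continuous_map X euclideanreal f" "f x = 0" "f ` (D \<union> (F - {x})) \<subseteq> {1}"
      using X unfolding tychonoff_space_def completely_regular_space_alt by blast
    show ?thesis
      using f by (intro exI[of _ "\<lambda>y. 1 - f y"] conjI continuous_map_diff) auto
  qed
  then obtain b where b: "\<And>x. x \<in> F \<Longrightarrow> continuous_map X euclideanreal (b x)"
      "\<And>x. x \<in> F \<Longrightarrow> b x x = 1" "\<And>x y. x \<in> F \<Longrightarrow> y \<in> D \<union> (F - {x}) \<Longrightarrow> b x y = 0"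
    by metis
  let ?G = "\<lambda>y. \<Sum>x\<in>F. v x * b x y"
  have GF: "?G y = v y" if y: "y \<in> F" for y
  proof -
    have "?G y = (\<Sum>x\<in>F. if x = y then v y else 0)"
      using y by (intro sum.cong) (auto simp: b)
    then show ?thesis using y F(1) by simp
  qed
  have GD: "?G y = 0" if "y \<in> D" for y
    using that by (intro sum.neutral) (auto simp: b)
  show thesis
  proof
    show "continuous_map X euclideanreal (\<lambda>y. max (- M) (min M (?G y)))"
      using F(1) b(1)
      by (intro continuous_map_real_max continuous_map_real_min continuous_map_sum
          continuous_map_real_mult_left) auto
    show "max (- M) (min M (?G x)) = v x" if "x \<in> F" for x
      using M(2)[OF that] by (simp add: GF[OF that] abs_le_iff)
    show "max (- M) (min M (?G x)) = 0" if "x \<in> D" for x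
      using M(1) by (simp add: GD[OF that])
    show "\<bar>max (- M) (min M (?G x))\<bar> \<le> M" for x
      using M(1) by (simp add: abs_le_iff)
  qed
qed

section \<open>Copies of sequence spaces from disjointly supported functions\<close>

text \<open>
  At every point at most one of the functions \<open>\<phi> j\<close> is non-zero, so the value of
  \<open>\<Sum>j. x j * \<phi> j\<close> at that point depends on a single coordinate of \<open>x\<close>.
\<close>
definition disjoint_combination :: "(nat \<Rightarrow> 'a \<Rightarrow> real) \<Rightarrow> (nat \<Rightarrow> real) \<Rightarrow> 'a \<Rightarrow> real" where
  "disjoint_combination \<phi> x p = x (SOME j. \<phi> j p \<noteq> 0) * \<phi> (SOME j. \<phi> j p \<noteq> 0) p"

lemma disjoint_combination_eq_sum:
  assumes "\<And>i j. i \<noteq> j \<Longrightarrow> \<phi> i p = 0 \<or> \<phi> j p = 0"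
    and "finite A" "\<And>j. \<phi> j p \<noteq> 0 \<Longrightarrow> j \<in> A"
  shows "disjoint_combination \<phi> x p = (\<Sum>j\<in>A. x j * \<phi> j p)"
proof (cases "\<exists>j. \<phi> j p \<noteq> 0")
  case True
  let ?j = "SOME j. \<phi> j p \<noteq> 0"
  have j: "\<phi> ?j p \<noteq> 0" using True by (rule someI_ex)
  have "(\<Sum>j\<in>A. x j * \<phi> j p) = (\<Sum>j\<in>A. if j = ?j then x ?j * \<phi> ?j p else 0)"
    using assms(1) j by (intro sum.cong) auto
  then show ?thesis using assms(2,3) j by (simp add: disjoint_combination_def)
next
  case False
  then show ?thesis by (simp add: disjoint_combination_def)
qed

lemma subspace_tvs_carrier:
  assumes "topspace (vtop E) = carrier E"
  shows "subspace_tvs E (carrier E) = E"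
proof -
  have "subtopology (vtop E) (carrier E) = vtop E"
    using subtopology_topspace[of "vtop E"] unfolding assms .
  then show ?thesis by (simp add: subspace_tvs_def)
qed

text \<open>
  Combining the functions \<open>\<phi> k\<close> with coefficients from \<open>V\<close> is a right inverse to reading off coefficients
  with the functionals \<open>s k\<close>. It is continuous since each value of the combination involves one
  coefficient.
\<close>
lemma has_complemented_copy_disjoint_functions:
  assumes V: "VectorSpace.subspace real_field V RN"
    and \<phi>: "\<And>x. x \<in> V \<Longrightarrow> continuous_map X euclideanreal (disjoint_combination \<phi> x)"
    and s: "\<And>k. continuous_map (vtop (Cp X)) euclideanreal (\<lambda>f. s f k)"
      "\<And>f. f \<in> carrier (Cp X) \<Longrightarrow> s f \<in> V"
      "\<And>f g k. f \<in> carrier (Cp X) \<Longrightarrow> g \<in> carrier (Cp X) \<Longrightarrow> s (f \<oplus>\<^bsub>Cp X\<^esub> g) k = s f k + s g k"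
      "\<And>f a k. f \<in> carrier (Cp X) \<Longrightarrow> s (a \<odot>\<^bsub>Cp X\<^esub> f) k = a * s f k"
    and dual: "\<And>x k. x \<in> V \<Longrightarrow> s (restrict (disjoint_combination \<phi> x) (topspace X)) k = x k"
  shows "has_complemented_copy (Cp X) (subspace_tvs RN V)"
proof (rule has_complemented_copyI)
  let ?R = "\<lambda>x. restrict (disjoint_combination \<phi> x) (topspace X)"
  have vV: "VectorSpace.vectorspace real_field (subspace_tvs RN V)"
    by (rule vectorspace_subspace_tvs[OF V])
  show "VectorSpace.linear_map real_field (Cp X) (subspace_tvs RN V) s"
    by (rule linear_mapI[OF vectorspace_Cp vV]) (use s in \<open>auto simp del: Cp_simps\<close>)
  show "continuous_map (vtop (Cp X)) (vtop (subspace_tvs RN V)) s"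
    using s(1,2) by (auto simp: continuous_map_in_subtopology continuous_map_componentwise_UNIV
        simp del: Cp_simps)
  show "VectorSpace.linear_map real_field (subspace_tvs RN V) (Cp X) ?R"
    by (rule linear_mapI[OF vV vectorspace_Cp])
      (use restrict_in_Cp[OF \<phi>] in \<open>auto simp: disjoint_combination_def algebra_simps restrict_def fun_eq_iff\<close>)
  have "continuous_map (subtopology (powertop_real UNIV) V) (powertop_real (topspace X)) ?R"
    unfolding continuous_map_componentwise
  proof (intro conjI ballI)
    fix p assume p: "p \<in> topspace X"
    have "continuous_map (powertop_real UNIV) euclideanreal (\<lambda>x. x j * c)" for j :: nat and c
      by (intro continuous_map_real_mult_right continuous_map_product_projection) simp
    then show "continuous_map (subtopology (powertop_real UNIV) V) euclideanreal (\<lambda>x. ?R x p)"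
      using p by (simp add: disjoint_combination_def continuous_map_from_subtopology)
  qed auto
  moreover have "?R x \<in> carrier (Cp X)" if "x \<in> V" for x
    using restrict_in_Cp[OF \<phi>[OF that]] .
  ultimately show "continuous_map (vtop (subspace_tvs RN V)) (vtop (Cp X)) ?R"
    unfolding vtop_Cp by (auto simp: continuous_map_in_subtopology simp del: Cp_simps)
  show "s (?R y) = y" if "y \<in> carrier (subspace_tvs RN V)" for y
    using dual that by (simp add: fun_eq_iff)
  show "topspace (vtop (subspace_tvs RN V)) = carrier (subspace_tvs RN V)"
    by (simp add: PiE_UNIV_domain)
qed simp

lemma continuous_map_locally_eq:
  assumes "\<And>x. x \<in> topspace X \<Longrightarrow>
    \<exists>U h. openin X U \<and> x \<in> U \<and> continuous_map X Y h \<and> (\<forall>y\<in>U. f y = h y)"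
  shows "continuous_map X Y f"
  unfolding continuous_map_def
proof (intro conjI allI impI)
  show "f \<in> topspace X \<rightarrow> topspace Y"
    using assms by (fastforce simp: continuous_map_def)
  fix W assume W: "openin Y W"
  show "openin X {x \<in> topspace X. f x \<in> W}"
  proof (subst openin_subopen, intro ballI)
    fix x assume x: "x \<in> {x \<in> topspace X. f x \<in> W}"
    then obtain U h where U: "openin X U" "x \<in> U" "continuous_map X Y h" "\<forall>y\<in>U. f y = h y"
      using assms by blast
    have "openin X (U \<inter> {y \<in> topspace X. h y \<in> W})"
      using U W by (intro openin_Int openin_continuous_map_preimage)
    then show "\<exists>T. openin X T \<and> x \<in> T \<and> T \<subseteq> {x \<in> topspace X. f x \<in> W}"
      using U x by (intro exI[of _ "U \<inter> {y \<in> topspace X. h y \<in> W}"]) auto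
  qed
qed

text \<open>
  An unbounded continuous function takes values \<open>t\<^sub>0, t\<^sub>1, \<dots>\<close> with gaps at least one. Its composites
  with narrow tents around these values form a disjoint and locally finite sequence, so all
  their combinations are continuous.
\<close>
lemma complemented_RN_of_unbounded:
  assumes f: "continuous_map X euclideanreal f" "\<not> bounded (f ` topspace X)"
  shows "has_complemented_copy (Cp X) RN"
proof -
  let ?g = "\<lambda>p. \<bar>f p\<bar>"
  have g: "continuous_map X euclideanreal ?g" using f(1) by (rule continuous_map_real_abs)
  have unb: "\<exists>p\<in>topspace X. ?g p > b" for b
    using f(2) unfolding bounded_iff by (metis imageE not_le real_norm_def)
  have "\<exists>P. \<forall>k. P k \<in> topspace X \<and> ?g (P (Suc k)) > ?g (P k) + 1"
    using dependent_nat_choice[of "\<lambda>k p. p \<in> topspace X" "\<lambda>k p q. ?g q > ?g p + 1"] unb by metis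
  then obtain P where P: "\<And>k. P k \<in> topspace X" "\<And>k. ?g (P (Suc k)) > ?g (P k) + 1" by blast
  define t where "t k = ?g (P k)" for k
  have gap: "t j + real (k - j) \<le> t k" if "j \<le> k" for j k
    using that
  proof (induction k rule: dec_induct)
    case (step n)
    then show ?case using P(2)[of n] by (simp add: t_def Suc_diff_le)
  qed simp
  define \<phi> where "\<phi> k p = max 0 (1 - 2 * \<bar>?g p - t k\<bar>)" for k p
  have \<phi>_nz: "\<bar>?g p - t k\<bar> < 1/2" if "\<phi> k p \<noteq> 0" for k p
    using that unfolding \<phi>_def by (auto simp: max_def split: if_splits)
  have disj: "\<phi> i p = 0 \<or> \<phi> j p = 0" if "i \<noteq> j" for i j p
  proof (rule ccontr)
    assume "\<not> ?thesis"
    then have a: "\<bar>?g p - t i\<bar> < 1/2" "\<bar>?g p - t j\<bar> < 1/2" using \<phi>_nz by auto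
    have "i < j \<or> j < i" using that by auto
    then show False
    proof
      assume "i < j"
      then have "real (j - i) \<ge> 1" by simp
      then show False using gap[of i j] \<open>i < j\<close> a by linarith
    next
      assume "j < i"
      then have "real (i - j) \<ge> 1" by simp
      then show False using gap[of j i] \<open>j < i\<close> a by linarith
    qed
  qed
  have cont: "continuous_map X euclideanreal (disjoint_combination \<phi> x)" for x
  proof (rule continuous_map_locally_eq)
    fix p assume p: "p \<in> topspace X"
    obtain n where n: "real n > ?g p + 2" using reals_Archimedean2 by blast
    let ?U = "{q \<in> topspace X. ?g q \<in> {..<?g p + 1}}"
    let ?h = "\<lambda>q. \<Sum>j<n. x j * \<phi> j q"
    have "openin X ?U"
      using g by (intro openin_continuous_map_preimage[OF g]) simp
    moreover have "continuous_map X euclideanreal ?h"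
      unfolding \<phi>_def
      by (intro continuous_map_sum continuous_map_real_mult_left continuous_map_real_max
          continuous_map_diff continuous_map_real_abs f(1)) auto
    moreover have "disjoint_combination \<phi> x q = ?h q" if q: "q \<in> ?U" for q
    proof (rule disjoint_combination_eq_sum)
      show "\<phi> i q = 0 \<or> \<phi> j q = 0" if "i \<noteq> j" for i j using disj[OF that] .
      fix j assume "\<phi> j q \<noteq> 0"
      then have "\<bar>?g q - t j\<bar> < 1/2" by (rule \<phi>_nz)
      moreover have "?g q < ?g p + 1" using q by simp
      ultimately have "t j < ?g p + 2" by linarith
      moreover have "real j \<le> t j" using gap[of 0 j] by (simp add: t_def)
      ultimately show "j \<in> {..<n}" using n by simp
    qed simp
    ultimately show "\<exists>U h. openin X U \<and> p \<in> U \<and> continuous_map X euclideanreal h \<and>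
        (\<forall>y\<in>U. disjoint_combination \<phi> x y = h y)"
      using p by (intro exI[of _ ?U] exI[of _ ?h]) auto
  qed
  have "has_complemented_copy (Cp X) (subspace_tvs RN UNIV)"
  proof (rule has_complemented_copy_disjoint_functions[where s = "\<lambda>f k. f (P k)"])
    show "VectorSpace.subspace real_field UNIV RN"
      by (rule subspaceI[OF vectorspace_RN]) auto
    show "continuous_map X euclideanreal (disjoint_combination \<phi> x)" for x by (rule cont)
    show "continuous_map (vtop (Cp X)) euclideanreal (\<lambda>f. f (P k))" for k
      by (rule continuous_map_evaluation[OF P(1)])
    have one: "\<phi> k (P k) = 1" for k by (simp add: \<phi>_def t_def)
    have "disjoint_combination \<phi> x (P k) = (\<Sum>j\<in>{k}. x j * \<phi> j (P k))" for x k
      by (rule disjoint_combination_eq_sum) (use disj one[of k] in \<open>auto, metis zero_neq_one\<close>)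
    then show "restrict (disjoint_combination \<phi> x) (topspace X) (P k) = x k" for x k
      using P(1) one by simp
  qed (use P(1) in auto)
  then show ?thesis
    using subspace_tvs_carrier[of RN] by (simp add: PiE_UNIV_domain)
qed

section \<open>Lower triangular systems on null sequences\<close>

text \<open>The solution \<open>s\<close> of \<open>\<Sum>j\<le>k. a k j * s j = t k\<close> by forward substitution.\<close>
fun tri_solve :: "(nat \<Rightarrow> nat \<Rightarrow> real) \<Rightarrow> (nat \<Rightarrow> real) \<Rightarrow> nat \<Rightarrow> real" where
  "tri_solve a t k = (t k - (\<Sum>j<k. a k j * tri_solve a t j)) / a k k"

declare tri_solve.simps [simp del]

lemma tri_solve_add: "tri_solve a (\<lambda>k. t k + u k) k = tri_solve a t k + tri_solve a u k"
proof (induction k rule: less_induct)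
  case (less k)
  have "(\<Sum>j<k. a k j * tri_solve a (\<lambda>k. t k + u k) j) =
      (\<Sum>j<k. a k j * tri_solve a t j) + (\<Sum>j<k. a k j * tri_solve a u j)"
    unfolding sum.distrib[symmetric] by (intro sum.cong) (simp_all add: less distrib_left)
  then show ?case
    by (simp add: tri_solve.simps[of _ _ k] add_divide_distrib[symmetric])
qed

lemma tri_solve_mult: "tri_solve a (\<lambda>k. c * t k) k = c * tri_solve a t k"
proof (induction k rule: less_induct)
  case (less k)
  have "(\<Sum>j<k. a k j * tri_solve a (\<lambda>k. c * t k) j) = c * (\<Sum>j<k. a k j * tri_solve a t j)"
    unfolding sum_distrib_left by (intro sum.cong) (simp_all add: less)
  then show ?case
    by (simp add: tri_solve.simps[of _ _ k] right_diff_distrib)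
qed

lemma tri_solve_unique:
  assumes "\<And>k. a k k \<noteq> 0" "\<And>k. t k = (\<Sum>j\<le>k. a k j * x j)"
  shows "tri_solve a t k = x k"
proof (induction k rule: less_induct)
  case (less k)
  have "(\<Sum>j<k. a k j * tri_solve a t j) = (\<Sum>j<k. a k j * x j)"
    by (intro sum.cong) (simp_all add: less)
  moreover have "t k = (\<Sum>j<k. a k j * x j) + a k k * x k"
    unfolding assms(2) by (simp add: lessThan_Suc_atMost[symmetric])
  ultimately show ?case
    using assms(1)[of k] by (simp add: tri_solve.simps[of _ _ k])
qed

lemma continuous_map_tri_solve:
  assumes "\<And>k. continuous_map Z euclideanreal (\<lambda>z. t z k)"
  shows "continuous_map Z euclideanreal (\<lambda>z. tri_solve a (t z) k)"
proof (induction k rule: less_induct)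
  case (less k)
  have "continuous_map Z euclideanreal
      (\<lambda>z. (t z k - (\<Sum>j<k. a k j * tri_solve a (t z) j)) * inverse (a k k))"
    by (intro continuous_map_real_mult_right continuous_map_diff assms continuous_map_sum
        continuous_map_real_mult_left) (auto simp: less)
  then show ?case by (subst tri_solve.simps) (simp add: divide_inverse)
qed

lemma tri_solve_bounded:
  assumes c: "c > 0" "\<And>k. a k k \<ge> c"
    and row: "\<And>k. (\<Sum>j<k. \<bar>a k j\<bar>) \<le> c / 3"
    and t: "\<And>k. \<bar>t k\<bar> \<le> T"
  shows "\<bar>tri_solve a t k\<bar> \<le> 3 / 2 * T / c"
proof (induction k rule: less_induct)
  case (less k)
  define B where "B = 3 / 2 * T / c"
  have T: "T \<ge> 0" using t[of 0] by linarith
  then have B: "B \<ge> 0" using c by (simp add: B_def)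
  have "\<bar>\<Sum>j<k. a k j * tri_solve a t j\<bar> \<le> (\<Sum>j<k. \<bar>a k j\<bar> * B)"
  proof (rule order_trans[OF sum_abs sum_mono])
    fix j assume "j \<in> {..<k}"
    then show "\<bar>a k j * tri_solve a t j\<bar> \<le> \<bar>a k j\<bar> * B"
      unfolding abs_mult B_def by (intro mult_left_mono less) auto
  qed
  also have "\<dots> = (\<Sum>j<k. \<bar>a k j\<bar>) * B" by (simp add: sum_distrib_right)
  also have "\<dots> \<le> c / 3 * B" using row B by (intro mult_right_mono)
  also have "\<dots> = T / 2" using c by (simp add: B_def)
  finally have "\<bar>t k - (\<Sum>j<k. a k j * tri_solve a t j)\<bar> \<le> 3 / 2 * T"
    using t[of k] by linarith
  then have "\<bar>t k - (\<Sum>j<k. a k j * tri_solve a t j)\<bar> / a k k \<le> 3 / 2 * T / a k k"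
    using c(1) c(2)[of k] by (intro divide_right_mono) auto
  also have "\<dots> \<le> 3 / 2 * T / c"
    using c(1) c(2)[of k] T by (intro divide_left_mono) auto
  finally show ?case
    using c(1) c(2)[of k] by (subst tri_solve.simps) (simp add: abs_divide)
qed

text \<open>
  Once the solution is eventually bounded by \<open>M\<close>, the entries of a row beyond a fixed column
  contribute at most \<open>M / 3\<close>, while the fixed columns and the right-hand side tend to zero.
  So the eventual bound can be halved again and again.
\<close>
lemma tri_solve_tendsto_0:
  assumes c: "c > 0" "\<And>k. a k k \<ge> c"
    and row: "\<And>k. (\<Sum>j<k. \<bar>a k j\<bar>) \<le> c / 3"
    and col: "\<And>j. (\<lambda>k. a k j) \<longlonglongrightarrow> 0"
    and t: "t \<longlonglongrightarrow> 0"
  shows "tri_solve a t \<longlonglongrightarrow> 0"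
proof -
  let ?s = "tri_solve a t"
  have halve: "eventually (\<lambda>k. \<bar>?s k\<bar> \<le> M / 2) sequentially"
    if M: "M > 0" "eventually (\<lambda>k. \<bar>?s k\<bar> \<le> M) sequentially" for M
  proof -
    obtain J where J: "\<And>k. k \<ge> J \<Longrightarrow> \<bar>?s k\<bar> \<le> M"
      using M(2) unfolding eventually_sequentially by blast
    define u where "u k = \<bar>t k\<bar> + (\<Sum>j<J. \<bar>a k j\<bar> * \<bar>?s j\<bar>)" for k
    have "u \<longlonglongrightarrow> 0"
      unfolding u_def
      by (intro tendsto_add_zero tendsto_null_sum tendsto_mult_left_zero tendsto_rabs_zero t col)
    moreover have "M * c / 6 > 0" using M c by simp
    ultimately have "eventually (\<lambda>k. u k < M * c / 6) sequentially"
      by (rule order_tendstoD)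
    then show ?thesis
      using eventually_ge_at_top[of J]
    proof eventually_elim
      case (elim k)
      have "\<bar>\<Sum>j<k. a k j * ?s j\<bar> \<le> (\<Sum>j<k. \<bar>a k j\<bar> * \<bar>?s j\<bar>)"
        by (rule order_trans[OF sum_abs]) (simp add: abs_mult)
      also have "\<dots> = (\<Sum>j<J. \<bar>a k j\<bar> * \<bar>?s j\<bar>) + (\<Sum>j=J..<k. \<bar>a k j\<bar> * \<bar>?s j\<bar>)"
        using elim(2) by (simp add: lessThan_atLeast0 sum.atLeastLessThan_concat)
      also have "(\<Sum>j=J..<k. \<bar>a k j\<bar> * \<bar>?s j\<bar>) \<le> (\<Sum>j=J..<k. \<bar>a k j\<bar> * M)"
        using J by (intro sum_mono mult_left_mono) auto
      also have "\<dots> = (\<Sum>j=J..<k. \<bar>a k j\<bar>) * M" by (simp add: sum_distrib_right)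
      also have "\<dots> \<le> c / 3 * M"
      proof (rule mult_right_mono)
        have "(\<Sum>j=J..<k. \<bar>a k j\<bar>) \<le> (\<Sum>j<k. \<bar>a k j\<bar>)" by (intro sum_mono2) auto
        then show "(\<Sum>j=J..<k. \<bar>a k j\<bar>) \<le> c / 3" using row[of k] by linarith
      qed (use M in simp)
      finally have "\<bar>t k - (\<Sum>j<k. a k j * ?s j)\<bar> \<le> u k + c / 3 * M"
        unfolding u_def by linarith
      also have "\<dots> \<le> M / 2 * c" using elim(1) by (simp add: field_simps)
      finally have "\<bar>t k - (\<Sum>j<k. a k j * ?s j)\<bar> / a k k \<le> M / 2 * c / a k k"
        using c(1) c(2)[of k] by (intro divide_right_mono) auto
      also have "\<dots> \<le> M / 2"
        using c(1) c(2)[of k] M by (simp add: field_simps)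
      finally show ?case
        using c(1) c(2)[of k] by (subst tri_solve.simps) (simp add: abs_divide)
    qed
  qed
  obtain T where T: "T > 0" "\<And>k. \<bar>t k\<bar> \<le> T"
    using Bseq_def convergent_imp_Bseq t unfolding convergent_def by (metis real_norm_def)
  define B where "B = 3 / 2 * T / c"
  have B: "B > 0" using T c by (simp add: B_def)
  have ev: "eventually (\<lambda>k. \<bar>?s k\<bar> \<le> B / 2 ^ i) sequentially" for i
  proof (induction i)
    case 0
    show ?case using tri_solve_bounded[OF c row T(2)] by (simp add: B_def)
  next
    case (Suc i)
    have "eventually (\<lambda>k. \<bar>?s k\<bar> \<le> B / 2 ^ i / 2) sequentially"
      using Suc B by (intro halve) auto
    then show ?case by (simp add: mult.commute)
  qed
  show ?thesis
    unfolding tendsto_iff dist_real_def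
  proof (intro allI impI)
    fix e :: real assume e: "e > 0"
    obtain i where "(1/2) ^ i < e / B"
      using real_arch_pow_inv[of "e / B" "1/2"] B e by auto
    then have "(1/2) ^ i * B < e" using B by (simp only: pos_less_divide_eq)
    then have "B / 2 ^ i < e" by (simp add: power_one_over)
    then show "eventually (\<lambda>k. \<bar>?s k - 0\<bar> < e) sequentially"
      using ev[of i] by (auto elim: eventually_mono)
  qed
qed

section \<open>Gliding humps along a Josefson-Nissenzweig sequence\<close>

locale jn_sequence =
  fixes X :: "'a topology" and \<mu> :: "nat \<Rightarrow> 'a \<Rightarrow> real"
  assumes tychonoff: "tychonoff_space X"
    and sign_measure: "\<And>n. sign_measure_on X (\<mu> n)"
    and norm_one: "\<And>n. sm_norm (\<mu> n) = 1"
    and null: "\<And>f. f \<in> carrier (Cp X) \<Longrightarrow> (\<lambda>n. sm_apply (\<mu> n) f) \<longlonglongrightarrow> 0"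
begin

abbreviation supp :: "nat \<Rightarrow> 'a set" where
  "supp n \<equiv> {x. \<mu> n x \<noteq> 0}"

lemma finite_supp: "finite (supp n)" and supp_subset: "supp n \<subseteq> topspace X"
  using sign_measure by (auto simp: sign_measure_on_def)

lemma null_continuous:
  assumes "continuous_map X euclideanreal f"
  shows "(\<lambda>n. sm_apply (\<mu> n) f) \<longlonglongrightarrow> 0"
proof -
  have "sm_apply (\<mu> n) (restrict f (topspace X)) = sm_apply (\<mu> n) f" for n
    by (rule sm_apply_cong[OF sign_measure]) simp
  then show ?thesis using null[OF restrict_in_Cp[OF assms]] by simp
qed

lemma mass_UNIV: "sm_mass (\<mu> n) UNIV = 1"
  using norm_one[of n] by (simp add: sm_mass_def sm_norm_def)

text \<open>
  If almost all the mass stayed on a finite set \<open>S\<close>, then one of the finitely many sign patterns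
  on \<open>S\<close>, extended to a continuous function, would pick it up infinitely often.
\<close>
lemma escaping_mass:
  assumes N: "infinite N" and S: "finite S"
  shows "\<exists>n\<in>N. sm_mass (\<mu> n) (- S) \<ge> 1/4"
proof (rule ccontr)
  assume "\<not> ?thesis"
  then have small: "sm_mass (\<mu> n) (- S) < 1/4" if "n \<in> N" for n using that by force
  let ?S = "S \<inter> topspace X"
  have "\<exists>f. continuous_map X euclideanreal f \<and> (\<forall>x\<in>?S. f x = (if x \<in> P then 1 else -1)) \<and> (\<forall>x. \<bar>f x\<bar> \<le> 1)"
    for P
  proof -
    obtain f where "continuous_map X euclideanreal f" "\<And>x. x \<in> ?S \<Longrightarrow> f x = (if x \<in> P then 1 else -1)"
      "\<And>x. \<bar>f x\<bar> \<le> 1"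
      by (rule tychonoff_interpolation[OF tychonoff, of ?S "{}" 1 "\<lambda>x. if x \<in> P then 1 else -1"])
        (use S in auto)
    then show ?thesis by blast
  qed
  then obtain f where f: "\<And>P. continuous_map X euclideanreal (f P)"
      "\<And>P x. x \<in> ?S \<Longrightarrow> f P x = (if x \<in> P then 1 else -1)" "\<And>P x. \<bar>f P x\<bar> \<le> 1" by metis
  have "eventually (\<lambda>n. \<bar>sm_apply (\<mu> n) (f P)\<bar> < 1/2) sequentially" for P
    using tendstoD[OF null_continuous[OF f(1)], of "1/2" P] by (simp add: dist_real_def)
  then have "eventually (\<lambda>n. \<forall>P\<in>Pow ?S. \<bar>sm_apply (\<mu> n) (f P)\<bar> < 1/2) sequentially"
    using S by (intro eventually_ball_finite) auto
  then obtain n0 where n0: "\<And>n P. n \<ge> n0 \<Longrightarrow> P \<subseteq> ?S \<Longrightarrow> \<bar>sm_apply (\<mu> n) (f P)\<bar> < 1/2"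
    unfolding eventually_sequentially by blast
  obtain n where n: "n \<in> N" "n \<ge> n0" using N by (meson infinite_nat_iff_unbounded_le)
  \<comment> \<open>The sign pattern of \<open>\<mu> n\<close> on \<open>S\<close> itself.\<close>
  define P where "P = {x \<in> ?S. \<mu> n x > 0}"
  have "sm_apply (\<mu> n) (f P) = (\<Sum>x\<in>supp n \<inter> S. \<mu> n x * f P x) + (\<Sum>x\<in>supp n \<inter> - S. \<mu> n x * f P x)"
    unfolding sm_apply_def using finite_supp
    by (subst sum.union_disjoint[symmetric]) (auto intro!: sum.cong)
  moreover have "(\<Sum>x\<in>supp n \<inter> S. \<mu> n x * f P x) = sm_mass (\<mu> n) S"
    unfolding sm_mass_def using supp_subset[of n] by (intro sum.cong) (auto simp: f(2) P_def)
  moreover have "\<bar>\<Sum>x\<in>supp n \<inter> - S. \<mu> n x * f P x\<bar> \<le> sm_mass (\<mu> n) (- S)"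
    unfolding sm_mass_def
  proof (rule order_trans[OF sum_abs sum_mono])
    show "\<bar>\<mu> n x * f P x\<bar> \<le> \<bar>\<mu> n x\<bar>" for x
      using mult_left_mono[OF f(3), of "\<bar>\<mu> n x\<bar>" P x] by (simp add: abs_mult)
  qed
  moreover have "sm_mass (\<mu> n) S \<ge> 1 - sm_mass (\<mu> n) (- S)"
    using sm_mass_Un[OF finite_supp, of n S "- S"] mass_UNIV[of n] by simp
  moreover have "\<bar>sm_apply (\<mu> n) (f P)\<bar> < 1/2" using n0[OF n(2), of P] by (auto simp: P_def)
  ultimately show False using small[OF n(1)] by linarith
qed

text \<open>
  Among sufficiently many disjoint closed neighbourhoods of new pieces of supports, one has small
  measure for infinitely many of the remaining \<open>\<mu> n\<close>; the next hump is placed there.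
\<close>
lemma next_hump:
  assumes C: "closedin X C" and S: "finite S" "S \<subseteq> topspace X"
    and N: "infinite N" "\<And>n. n \<in> N \<Longrightarrow> sm_mass (\<mu> n) C \<le> 1/16" and e: "e > 0"
  obtains m \<phi> C' N' where "m \<in> N" "closedin X C'" "C \<subseteq> C'" "infinite N'" "N' \<subseteq> N" "\<And>n. n \<in> N' \<Longrightarrow> m < n"
    "\<And>n. n \<in> N' \<Longrightarrow> sm_mass (\<mu> n) C' \<le> sm_mass (\<mu> n) C + e"
    "continuous_map X euclideanreal \<phi>" "\<And>x. \<bar>\<phi> x\<bar> \<le> 1" "\<And>x. x \<in> topspace X - C' \<Longrightarrow> \<phi> x = 0"
    "\<And>x. x \<in> C \<union> S \<Longrightarrow> \<phi> x = 0" "sm_apply (\<mu> m) \<phi> \<ge> 3/16"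
proof -
  have haus: "Hausdorff_space X" using tychonoff by (simp add: tychonoff_space_def)
  obtain K :: nat where K: "1 / e < real K" using reals_Archimedean2 by blast
  have K0: "K > 0" using K e by (cases K) auto
  have Ke: "1 / real K \<le> e" using K K0 e by (simp add: field_simps)
  have "\<exists>g :: nat \<Rightarrow> nat. \<forall>l. g l \<in> N \<and> sm_mass (\<mu> (g l)) (- (S \<union> (\<Union>i<l. supp (g i)))) \<ge> 1/4"
  proof (rule dependent_wellorder_choice)
    show "\<exists>r. r \<in> N \<and> sm_mass (\<mu> r) (- (S \<union> (\<Union>i<l. supp (g i)))) \<ge> 1/4" for l and g :: "nat \<Rightarrow> nat"
      using escaping_mass[OF N(1), of "S \<union> (\<Union>i<l. supp (g i))"] S finite_supp by auto
  qed auto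
  then obtain g :: "nat \<Rightarrow> nat" where g: "\<And>l. g l \<in> N"
      "\<And>l. sm_mass (\<mu> (g l)) (- (S \<union> (\<Union>i<l. supp (g i)))) \<ge> 1/4" by blast
  define F where "F l = supp (g l) - (C \<union> S \<union> (\<Union>i<l. supp (g i)))" for l
  have F_mass: "sm_mass (\<mu> (g l)) (F l) \<ge> 3/16" for l
  proof -
    let ?A = "- (S \<union> (\<Union>i<l. supp (g i)))"
    have "sm_mass (\<mu> (g l)) (?A - C) \<le> sm_mass (\<mu> (g l)) (F l)"
      by (intro sm_mass_mono finite_supp) (auto simp: F_def)
    then show ?thesis
      using sm_mass_Diff[OF finite_supp, of "g l" ?A C] g(2)[of l] N(2)[OF g(1), of l] by linarith
  qed
  have F_disj: "F i \<inter> F j = {}" if "i \<noteq> j" for i j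
    using that by (cases i j rule: linorder_cases) (auto simp: F_def)
  have F_fin: "finite (F l)" "F l \<subseteq> topspace X" for l
    using finite_supp[of "g l"] supp_subset[of "g l"] by (auto simp: F_def intro: finite_subset)
  \<comment> \<open>One continuous function with value \<open>l + 1\<close> on \<open>F l\<close> and zero on \<open>C \<union> S\<close> separates all these sets at once;
    the values start at one to keep away from the value zero.\<close>
  define v where "v x = real (Suc (THE l. x \<in> F l))" for x
  have v: "v x = real (Suc l)" if "x \<in> F l" for x l
  proof -
    have "(THE l. x \<in> F l) = l" using that F_disj by (intro the_equality) auto
    then show ?thesis by (simp add: v_def)
  qed
  have D: "closedin X (C \<union> S)"
    using C closedin_Hausdorff_finite[OF haus S(2,1)] by blast
  obtain f where f: "continuous_map X euclideanreal f" "\<And>x. x \<in> (\<Union>l<K. F l) \<Longrightarrow> f x = v x"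
      "\<And>x. x \<in> C \<union> S \<Longrightarrow> f x = 0"
  proof (rule tychonoff_interpolation[OF tychonoff _ _ D, of "\<Union>l<K. F l" "real K" v])
    show "\<bar>v x\<bar> \<le> real K" if "x \<in> (\<Union>l<K. F l)" for x using that v by auto
  qed (use F_fin in \<open>auto simp: F_def\<close>)
  define B where "B l = {x \<in> topspace X. f x \<in> {real (Suc l) - 1/3 .. real (Suc l) + 1/3}}" for l
  have B_closed: "closedin X (B l)" for l
    unfolding B_def using f(1) by (intro closedin_continuous_map_preimage) auto
  have B_disj: "B i \<inter> B j = {}" if "i \<noteq> j" for i j
  proof -
    have "\<bar>real i - real j\<bar> \<ge> 1" using that by (cases i j rule: linorder_cases) auto
    then show ?thesis by (auto simp: B_def)
  qed
  \<comment> \<open>The \<open>K\<close> disjoint sets share a total mass of one, so some \<open>l\<close> serves infinitely many \<open>n\<close>.\<close>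
  have "\<exists>l\<in>{..<K}. sm_mass (\<mu> n) (B l) \<le> 1 / real K" for n
  proof (rule ccontr)
    assume "\<not> ?thesis"
    then have "(\<Sum>l<K. 1 / real K) < (\<Sum>l<K. sm_mass (\<mu> n) (B l))"
      using K0 by (intro sum_strict_mono) (auto simp: not_le)
    also have "\<dots> \<le> 1"
      using sum_sm_mass_disjoint[OF finite_supp, of "{..<K}" B n] B_disj norm_one by simp
    finally show False using K0 by simp
  qed
  then obtain l where l: "l < K" "infinite {n \<in> N. sm_mass (\<mu> n) (B l) \<le> 1 / real K}"
    using pigeonhole_infinite_rel[OF N(1), of "{..<K}" "\<lambda>n l. sm_mass (\<mu> n) (B l) \<le> 1 / real K"] by auto
  let ?N = "{n \<in> N. sm_mass (\<mu> n) (B l) \<le> 1 / real K} - {..g l}"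
  let ?U = "{x \<in> topspace X. f x \<in> {real (Suc l) - 1/3 <..< real (Suc l) + 1/3}}"
  have U: "openin X ?U" using f(1) by (intro openin_continuous_map_preimage) auto
  let ?D = "(topspace X - ?U) \<union> (supp (g l) - F l)"
  have D_closed: "closedin X ?D"
    using U closedin_Hausdorff_finite[OF haus, of "supp (g l) - F l"] finite_supp supp_subset
    by (intro closedin_Un) auto
  have FU: "F l \<subseteq> ?U"
    using f(2) v l(1) F_fin(2) by force
  obtain \<phi> where \<phi>: "continuous_map X euclideanreal \<phi>" "\<And>x. x \<in> F l \<Longrightarrow> \<phi> x = sgn (\<mu> (g l) x)"
      "\<And>x. x \<in> ?D \<Longrightarrow> \<phi> x = 0" "\<And>x. \<bar>\<phi> x\<bar> \<le> 1"
  proof (rule tychonoff_interpolation[OF tychonoff F_fin D_closed, of l 1 "\<lambda>x. sgn (\<mu> (g l) x)"])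
    show "F l \<inter> ?D = {}" using FU by auto
  qed (auto simp: abs_sgn_eq)
  show thesis
  proof (rule that)
    show "g l \<in> N" by (rule g(1))
    show "closedin X (C \<union> B l)" using C B_closed by blast
    show "infinite ?N" using l(2) by (intro Diff_infinite_finite) auto
    show "sm_mass (\<mu> n) (C \<union> B l) \<le> sm_mass (\<mu> n) C + e" if "n \<in> ?N" for n
      using that Ke sm_mass_Un[OF finite_supp, of n C "B l"] by auto
    show "\<phi> x = 0" if "x \<in> topspace X - (C \<union> B l)" for x
      using that by (intro \<phi>(3)) (auto simp: B_def)
    show "\<phi> x = 0" if "x \<in> C \<union> S" for x
    proof (rule \<phi>(3))
      have "x \<in> topspace X" using that closedin_subset[OF C] S by auto
      then show "x \<in> ?D" using f(3)[OF that] by auto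
    qed
    have "sm_apply (\<mu> (g l)) \<phi> = (\<Sum>x\<in>supp (g l) \<inter> F l. \<bar>\<mu> (g l) x\<bar>)"
      unfolding sm_apply_def
    proof (rule sum.mono_neutral_cong_right[OF finite_supp])
      show "\<mu> (g l) x * \<phi> x = \<bar>\<mu> (g l) x\<bar>" if "x \<in> supp (g l) \<inter> F l" for x
        using that \<phi>(2) by (simp add: abs_sgn mult.commute)
    qed (use \<phi>(3) in auto)
    then show "sm_apply (\<mu> (g l)) \<phi> \<ge> 3/16"
      using F_mass[of l] by (simp add: sm_mass_def)
  qed (use \<phi> in auto)
qed


text \<open>
  Iterating the choice of humps. Besides \<open>\<mu> (m k)\<close> and its hump \<open>\<phi> k\<close>, a stage records a closed set \<open>C\<close>
  covering all humps so far, the finite set \<open>S\<close> of points already charged, and the infinite set \<open>N\<close> of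
  admissible later indices, for which \<open>C\<close> has mass below \<open>1/16\<close>. Later humps vanish on \<open>C\<close> and on \<open>S\<close>: the
  former makes them disjoint, the latter makes the matrix of the \<open>\<mu> (m k)\<close> against the \<open>\<phi> j\<close> lower
  triangular, and the mass bound makes its diagonal dominant.
\<close>
lemma hump_sequence:
  obtains m :: "nat \<Rightarrow> nat" and \<phi> where "strict_mono m" "\<And>k. continuous_map X euclideanreal (\<phi> k)"
    "\<And>k x. \<bar>\<phi> k x\<bar> \<le> 1" "\<And>i j x. i \<noteq> j \<Longrightarrow> x \<in> topspace X \<Longrightarrow> \<phi> i x = 0 \<or> \<phi> j x = 0"
    "\<And>j k x. k < j \<Longrightarrow> x \<in> supp (m k) \<Longrightarrow> \<phi> j x = 0"
    "\<And>k. sm_apply (\<mu> (m k)) (\<phi> k) \<ge> 3/16"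
    "\<And>k. (\<Sum>j<k. \<bar>sm_apply (\<mu> (m k)) (\<phi> j)\<bar>) \<le> 1/16"
proof -
  define P :: "nat \<Rightarrow> nat \<times> ('a \<Rightarrow> real) \<times> 'a set \<times> 'a set \<times> nat set \<Rightarrow> bool" where
    "P i = (\<lambda>(m, \<phi>, C, S, N). closedin X C \<and> finite S \<and> S \<subseteq> topspace X \<and> supp m \<subseteq> S \<and> infinite N \<and>
      (\<forall>n\<in>N. m < n \<and> sm_mass (\<mu> n) C \<le> 1/16 * (1 - (1/2) ^ Suc i)) \<and>
      continuous_map X euclideanreal \<phi> \<and> (\<forall>x. \<bar>\<phi> x\<bar> \<le> 1) \<and> (\<forall>x\<in>topspace X - C. \<phi> x = 0) \<and>
      sm_apply (\<mu> m) \<phi> \<ge> 3/16)" for i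
  define Q :: "nat \<times> ('a \<Rightarrow> real) \<times> 'a set \<times> 'a set \<times> nat set \<Rightarrow>
      nat \<times> ('a \<Rightarrow> real) \<times> 'a set \<times> 'a set \<times> nat set \<Rightarrow> bool" where
    "Q = (\<lambda>(m, \<phi>, C, S, N) (m', \<phi>', C', S', N'). m' \<in> N \<and> C \<subseteq> C' \<and> S \<subseteq> S' \<and> N' \<subseteq> N \<and>
      (\<forall>x\<in>C \<union> S. \<phi>' x = 0))"
  have step: "\<exists>st'. P i st' \<and> (case st' of (m', \<phi>', C', S', N') \<Rightarrow> m' \<in> N \<and> C \<subseteq> C' \<and> S \<subseteq> S' \<and> N' \<subseteq> N \<and>
      (\<forall>x\<in>C \<union> S. \<phi>' x = 0))"
    if C: "closedin X C" and S: "finite S" "S \<subseteq> topspace X" and N: "infinite N"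
      and mass: "\<And>n. n \<in> N \<Longrightarrow> sm_mass (\<mu> n) C \<le> 1/16 * (1 - (1/2) ^ i)" for i C S N
  proof -
    have le: "sm_mass (\<mu> n) C \<le> 1/16" if "n \<in> N" for n
    proof -
      have le: "x \<le> 1/16" if "x \<le> 1/16 * (1 - p)" "0 \<le> p" for x p :: real
        using that by (simp add: field_simps)
      show ?thesis by (rule le[OF mass[OF that]]) simp
    qed
    obtain m \<phi> C' N' where h: "m \<in> N" "closedin X C'" "C \<subseteq> C'" "infinite N'" "N' \<subseteq> N" "\<And>n. n \<in> N' \<Longrightarrow> m < n"
      "\<And>n. n \<in> N' \<Longrightarrow> sm_mass (\<mu> n) C' \<le> sm_mass (\<mu> n) C + 1/16 * (1/2) ^ Suc i"
      "continuous_map X euclideanreal \<phi>" "\<And>x. \<bar>\<phi> x\<bar> \<le> 1" "\<And>x. x \<in> topspace X - C' \<Longrightarrow> \<phi> x = 0"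
      "\<And>x. x \<in> C \<union> S \<Longrightarrow> \<phi> x = 0" "sm_apply (\<mu> m) \<phi> \<ge> 3/16"
      by (rule next_hump[OF C S N le, of "1/16 * (1/2) ^ Suc i"]) simp_all
    have "sm_mass (\<mu> n) C' \<le> 1/16 * (1 - (1/2) ^ Suc i)" if "n \<in> N'" for n
    proof -
      have "n \<in> N" using that h(5) by auto
      then show ?thesis using h(7)[OF that] mass[of n] by (simp add: algebra_simps)
    qed
    then show ?thesis
      using h S finite_supp supp_subset
      by (intro exI[of _ "(m, \<phi>, C', S \<union> supp m, N')"]) (simp add: P_def)
  qed
  have "\<exists>st. \<forall>i. P i (st i) \<and> Q (st i) (st (Suc i))"
  proof (rule dependent_nat_choice)
    show "\<exists>st. P 0 st"
      using step[of "{}" "{}" UNIV 0] by (auto simp: sm_mass_def)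
    fix st i assume "P i st"
    moreover obtain m \<phi> C S N where st: "st = (m, \<phi>, C, S, N)" by (cases st)
    ultimately show "\<exists>st'. P (Suc i) st' \<and> Q st st'"
      using step[of C S N "Suc i"] by (simp add: P_def Q_def)
  qed
  then obtain st where st: "\<And>i. P i (st i)" "\<And>i. Q (st i) (st (Suc i))" by blast
  define m where "m k = fst (st k)" for k
  define \<phi> where "\<phi> k = fst (snd (st k))" for k
  define C where "C k = fst (snd (snd (st k)))" for k
  define S where "S k = fst (snd (snd (snd (st k))))" for k
  define N where "N k = snd (snd (snd (snd (st k))))" for k
  have st_eq: "st k = (m k, \<phi> k, C k, S k, N k)" for k
    by (simp add: m_def \<phi>_def C_def S_def N_def)
  have P: "closedin X (C k)" "supp (m k) \<subseteq> S k" "\<And>n. n \<in> N k \<Longrightarrow> m k < n"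
      "\<And>n. n \<in> N k \<Longrightarrow> sm_mass (\<mu> n) (C k) \<le> 1/16 * (1 - (1/2) ^ Suc k)"
      "continuous_map X euclideanreal (\<phi> k)" "\<And>x. \<bar>\<phi> k x\<bar> \<le> 1"
      "\<And>x. x \<in> topspace X - C k \<Longrightarrow> \<phi> k x = 0" "sm_apply (\<mu> (m k)) (\<phi> k) \<ge> 3/16" for k
    using st(1)[of k] unfolding st_eq P_def by auto
  have Q: "m (Suc k) \<in> N k" "C k \<subseteq> C (Suc k)" "S k \<subseteq> S (Suc k)" "N (Suc k) \<subseteq> N k"
      "\<And>x. x \<in> C k \<union> S k \<Longrightarrow> \<phi> (Suc k) x = 0" for k
    using st(2)[of k] unfolding st_eq Q_def by auto
  have monoC: "C j \<subseteq> C k" and monoS: "S j \<subseteq> S k" if "j \<le> k" for j k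
    using that Q(2,3) by (auto simp: lift_Suc_mono_le)
  have vanish: "\<phi> k x = 0" if jk: "j < k" and x: "x \<in> C j \<union> S j" for j k x
  proof (cases k)
    case (Suc l)
    then have "x \<in> C l \<union> S l" using jk x monoC[of j l] monoS[of j l] by auto
    then show ?thesis using Q(5) Suc by simp
  qed (use jk in simp)
  have disj: "\<phi> i x = 0 \<or> \<phi> j x = 0" if ij: "i \<noteq> j" and x: "x \<in> topspace X" for i j x
  proof -
    have *: "\<phi> i x = 0 \<or> \<phi> j x = 0" if "i < j" for i j
      using vanish[OF that, of x] P(7)[of x i] x by auto
    show ?thesis using ij * by (cases i j rule: linorder_cases) auto
  qed
  have row: "(\<Sum>j<k. \<bar>sm_apply (\<mu> (m k)) (\<phi> j)\<bar>) \<le> 1/16" for k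
  proof (cases k)
    case (Suc l)
    let ?n = "m k"
    have pt: "(\<Sum>j<k. \<bar>\<phi> j x\<bar>) \<le> (if x \<in> C l then 1 else 0)" if x: "x \<in> topspace X" for x
    proof (cases "\<exists>j<k. \<phi> j x \<noteq> 0")
      case True
      then obtain j where j: "j < k" "\<phi> j x \<noteq> 0" by blast
      then have "(\<Sum>i<k. \<bar>\<phi> i x\<bar>) = (\<Sum>i<k. if i = j then \<bar>\<phi> j x\<bar> else 0)"
        using disj[OF _ x] by (intro sum.cong) auto
      also have "\<dots> = \<bar>\<phi> j x\<bar>" using j by simp
      finally have "(\<Sum>i<k. \<bar>\<phi> i x\<bar>) \<le> 1" using P(6)[of j x] by simp
      moreover have "x \<in> C l" using P(7)[of x j] j x monoC[of j l] Suc by auto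
      ultimately show ?thesis by simp
    next
      case False
      then have "(\<Sum>j<k. \<bar>\<phi> j x\<bar>) = 0" by (intro sum.neutral) auto
      then show ?thesis by simp
    qed
    have "(\<Sum>j<k. \<bar>sm_apply (\<mu> ?n) (\<phi> j)\<bar>) \<le> (\<Sum>j<k. \<Sum>x\<in>supp ?n. \<bar>\<mu> ?n x\<bar> * \<bar>\<phi> j x\<bar>)"
      unfolding sm_apply_def by (intro sum_mono order_trans[OF sum_abs]) (simp add: abs_mult)
    also have "\<dots> = (\<Sum>x\<in>supp ?n. \<bar>\<mu> ?n x\<bar> * (\<Sum>j<k. \<bar>\<phi> j x\<bar>))"
      by (subst sum.swap) (simp add: sum_distrib_left)
    also have "\<dots> \<le> (\<Sum>x\<in>supp ?n. \<bar>\<mu> ?n x\<bar> * (if x \<in> C l then 1 else 0))"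
      using supp_subset[of ?n] by (intro sum_mono mult_left_mono pt) auto
    also have "\<dots> = sm_mass (\<mu> ?n) (C l)"
      unfolding sm_mass_def using finite_supp by (simp add: sum.inter_restrict if_distrib cong: if_cong)
    also have "\<dots> \<le> 1/16 * (1 - (1/2) ^ Suc l)" using P(4) Q(1) Suc by blast
    also have "\<dots> \<le> 1/16" by simp
    finally show ?thesis .
  qed simp
  have "strict_mono m"
    unfolding strict_mono_Suc_iff using P(3) Q(1) by blast
  then show thesis
  proof (rule that[of m \<phi>])
    show "\<phi> j x = 0" if "k < j" "x \<in> supp (m k)" for j k x
      using vanish[OF that(1), of x] P(2)[of k] that(2) by blast
  qed (use P(5,6,8) disj row in auto)
qed

end

lemma sm_apply_sum:
  "sm_apply \<mu> (\<lambda>p. \<Sum>j\<in>A. x j * \<phi> j p) = (\<Sum>j\<in>A. x j * sm_apply \<mu> (\<phi> j))"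
  unfolding sm_apply_def sum_distrib_left by (subst sum.swap) (simp add: mult.left_commute)

text \<open>
  Disjointness bounds the tail of the series uniformly by the largest remaining coefficient.
\<close>
lemma continuous_map_null_combination:
  assumes \<phi>: "\<And>k. continuous_map X euclideanreal (\<phi> k)" "\<And>k p. \<bar>\<phi> k p\<bar> \<le> 1"
    and disj: "\<And>i j p. i \<noteq> j \<Longrightarrow> p \<in> topspace X \<Longrightarrow> \<phi> i p = 0 \<or> \<phi> j p = 0"
    and x: "x \<longlonglongrightarrow> 0"
  shows "continuous_map X euclideanreal (disjoint_combination \<phi> x)"
proof -
  let ?s = "\<lambda>n p. \<Sum>j<n. x j * \<phi> j p"
  have close: "\<bar>?s n p - disjoint_combination \<phi> x p\<bar> < e"
    if n: "\<And>j. j \<ge> n \<Longrightarrow> \<bar>x j\<bar> < e" and p: "p \<in> topspace X" and e: "e > 0" for n p e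
  proof (cases "\<forall>j\<ge>n. \<phi> j p = 0")
    case True
    have "disjoint_combination \<phi> x p = ?s n p"
      by (rule disjoint_combination_eq_sum) (use disj p True in \<open>auto simp: not_less[symmetric]\<close>)
    then show ?thesis using e by simp
  next
    case False
    then obtain j where j: "j \<ge> n" "\<phi> j p \<noteq> 0" by blast
    have "disjoint_combination \<phi> x p = (\<Sum>i\<in>{j}. x i * \<phi> i p)"
      by (rule disjoint_combination_eq_sum) (use disj[OF _ p] j in auto)
    moreover have "?s n p = 0"
      using disj[OF _ p] j by (intro sum.neutral) (metis lessThan_iff mult_zero_right not_le)
    moreover have "\<bar>x j\<bar> * \<bar>\<phi> j p\<bar> \<le> \<bar>x j\<bar> * 1" by (intro mult_left_mono \<phi>(2)) simp
    ultimately show ?thesis using n[OF j(1)] by (simp add: abs_mult)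
  qed
  have "continuous_map X Met_TC.mtopology (disjoint_combination \<phi> x)"
  proof (rule Met_TC.continuous_map_uniform_limit[where F = sequentially and f = ?s])
    show "eventually (\<lambda>n. continuous_map X Met_TC.mtopology (?s n)) sequentially"
      using \<phi>(1) by (auto intro!: always_eventually continuous_map_sum continuous_map_real_mult_left)
    fix e :: real assume e: "e > 0"
    obtain n0 where n0: "\<And>j. j \<ge> n0 \<Longrightarrow> \<bar>x j\<bar> < e" using LIMSEQ_D[OF x e] by auto
    show "eventually (\<lambda>n. \<forall>p\<in>topspace X. disjoint_combination \<phi> x p \<in> UNIV \<and>
        dist (?s n p) (disjoint_combination \<phi> x p) < e) sequentially"
      using eventually_ge_at_top[of n0]
      by eventually_elim (use close n0 e in \<open>auto simp: dist_real_def\<close>)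
  qed simp
  then show ?thesis by simp
qed

text \<open>
  The matrix of the measures against the humps has diagonal entries at least \<open>3/16\<close>, off-diagonal row
  sums at most a third of that, and null columns. So it can be solved within \<open>c\<^sub>0\<close>, and the solution gives
  functionals biorthogonal to the humps.
\<close>
lemma complemented_c0_of_JNP:
  assumes X: "tychonoff_space X" and "Cp_JNP X"
  shows "has_complemented_copy (Cp X) c0"
proof -
  obtain \<mu> :: "nat \<Rightarrow> 'a \<Rightarrow> real" where \<mu>: "\<And>n. sign_measure_on X (\<mu> n)" "\<And>n. sm_norm (\<mu> n) = 1"
      "\<And>f. f \<in> carrier (Cp X) \<Longrightarrow> (\<lambda>n. sm_apply (\<mu> n) f) \<longlonglongrightarrow> 0"
    using assms(2) unfolding Cp_JNP_def by blast
  interpret jn_sequence X \<mu> by unfold_locales (use X \<mu> in auto)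
  obtain m :: "nat \<Rightarrow> nat" and \<phi> where h: "strict_mono m" "\<And>k. continuous_map X euclideanreal (\<phi> k)"
    "\<And>k x. \<bar>\<phi> k x\<bar> \<le> 1" "\<And>i j x. i \<noteq> j \<Longrightarrow> x \<in> topspace X \<Longrightarrow> \<phi> i x = 0 \<or> \<phi> j x = 0"
    "\<And>j k x. k < j \<Longrightarrow> x \<in> supp (m k) \<Longrightarrow> \<phi> j x = 0"
    "\<And>k. sm_apply (\<mu> (m k)) (\<phi> k) \<ge> 3/16"
    "\<And>k. (\<Sum>j<k. \<bar>sm_apply (\<mu> (m k)) (\<phi> j)\<bar>) \<le> 1/16"
    using hump_sequence by blast
  define a where "a k j = sm_apply (\<mu> (m k)) (\<phi> j)" for k j
  define s where "s f = tri_solve a (\<lambda>k. sm_apply (\<mu> (m k)) f)" for f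
  have sub_null: "(\<lambda>k. sm_apply (\<mu> (m k)) f) \<longlonglongrightarrow> 0" if "continuous_map X euclideanreal f" for f
    using LIMSEQ_subseq_LIMSEQ[OF null_continuous[OF that] h(1)] by (simp add: o_def)
  have "has_complemented_copy (Cp X) (subspace_tvs RN {x. x \<longlonglongrightarrow> 0})"
  proof (rule has_complemented_copy_disjoint_functions[where s = s and \<phi> = \<phi>])
    show "VectorSpace.subspace real_field {x. x \<longlonglongrightarrow> 0} RN"
      by (rule subspaceI[OF vectorspace_RN]) (auto intro: tendsto_add_zero tendsto_mult_right_zero)
    show "continuous_map X euclideanreal (disjoint_combination \<phi> x)" if "x \<in> {x. x \<longlonglongrightarrow> 0}" for x
      using that h by (intro continuous_map_null_combination) auto
    show "continuous_map (vtop (Cp X)) euclideanreal (\<lambda>f. s f k)" for k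
      unfolding s_def by (intro continuous_map_tri_solve continuous_map_sm_apply \<mu>(1))
    show "s f \<in> {x. x \<longlonglongrightarrow> 0}" if "f \<in> carrier (Cp X)" for f
    proof -
      have "s f \<longlonglongrightarrow> 0"
        unfolding s_def
      proof (rule tri_solve_tendsto_0[where c = "3/16"])
        show "(\<lambda>k. a k j) \<longlonglongrightarrow> 0" for j
          unfolding a_def by (rule sub_null[OF h(2)])
        show "(\<lambda>k. sm_apply (\<mu> (m k)) f) \<longlonglongrightarrow> 0"
          using that by (intro sub_null) simp
      qed (use h(6,7) in \<open>auto simp: a_def\<close>)
      then show ?thesis by simp
    qed
    fix f g :: "'a \<Rightarrow> real" and c k
    have "sm_apply (\<mu> (m k)) (f \<oplus>\<^bsub>Cp X\<^esub> g) = sm_apply (\<mu> (m k)) f + sm_apply (\<mu> (m k)) g" for k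
      using sm_apply_cong[OF \<mu>(1), of "f \<oplus>\<^bsub>Cp X\<^esub> g" "\<lambda>x. f x + g x"] by (simp add: sm_apply_add)
    then show "s (f \<oplus>\<^bsub>Cp X\<^esub> g) k = s f k + s g k"
      unfolding s_def by (simp only: tri_solve_add)
    have "sm_apply (\<mu> (m k)) (c \<odot>\<^bsub>Cp X\<^esub> f) = c * sm_apply (\<mu> (m k)) f" for k
      using sm_apply_cong[OF \<mu>(1), of "c \<odot>\<^bsub>Cp X\<^esub> f" "\<lambda>x. c * f x"] by (simp add: sm_apply_mult)
    then show "s (c \<odot>\<^bsub>Cp X\<^esub> f) k = c * s f k"
      unfolding s_def by (simp only: tri_solve_mult)
  next
    fix x k
    let ?g = "restrict (disjoint_combination \<phi> x) (topspace X)"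
    have "sm_apply (\<mu> (m k)) ?g = (\<Sum>j\<le>k. a k j * x j)" for k
    proof -
      have "?g p = (\<Sum>j\<le>k. x j * \<phi> j p)" if p: "p \<in> supp (m k)" for p
      proof -
        have pX: "p \<in> topspace X" using p supp_subset by auto
        have "disjoint_combination \<phi> x p = (\<Sum>j\<in>{..k}. x j * \<phi> j p)"
        proof (rule disjoint_combination_eq_sum)
          show "\<phi> i p = 0 \<or> \<phi> j p = 0" if "i \<noteq> j" for i j using h(4)[OF that pX] .
          show "j \<in> {..k}" if "\<phi> j p \<noteq> 0" for j using h(5)[of k j p] p that by force
        qed simp
        then show ?thesis using pX by simp
      qed
      then have "sm_apply (\<mu> (m k)) ?g = sm_apply (\<mu> (m k)) (\<lambda>p. \<Sum>j\<le>k. x j * \<phi> j p)"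
        unfolding sm_apply_def by (intro sum.cong) auto
      then show ?thesis by (simp add: sm_apply_sum a_def mult.commute)
    qed
    moreover have "a k k \<noteq> 0" for k using h(6)[of k] by (auto simp: a_def)
    ultimately show "s ?g k = x k"
      unfolding s_def by (intro tri_solve_unique)
  qed
  then show ?thesis by (simp add: c0_def)
qed

section \<open>Annihilators of closed subspaces\<close>

text \<open>
  Elimination of one point at a time: either every \<open>v \<in> V\<close> vanishes at the point, or it can be used to
  normalise \<open>V\<close> there.
\<close>
lemma finite_separating_functional:
  fixes V :: "('a \<Rightarrow> real) set"
  assumes "finite F"
    and "(\<lambda>x. 0) \<in> V"
    and "\<And>u v. u \<in> V \<Longrightarrow> v \<in> V \<Longrightarrow> (\<lambda>x. u x + v x) \<in> V"
    and "\<And>c v. v \<in> V \<Longrightarrow> (\<lambda>x. c * v x) \<in> V"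
    and "\<And>v. v \<in> V \<Longrightarrow> \<exists>x\<in>F. v x \<noteq> h x"
  shows "\<exists>\<mu>. (\<forall>x. x \<notin> F \<longrightarrow> \<mu> x = 0) \<and> (\<forall>v\<in>V. (\<Sum>x\<in>F. \<mu> x * v x) = 0) \<and> (\<Sum>x\<in>F. \<mu> x * h x) \<noteq> 0"
  using assms
proof (induction F arbitrary: V h rule: finite_induct)
  case empty
  then show ?case by auto
next
  case (insert y F)
  note V = insert.prems
  have sum_upd: "(\<Sum>x\<in>insert y F. (\<mu>(y := c)) x * v x) = c * v y + (\<Sum>x\<in>F. \<mu> x * v x)" for \<mu> c and v :: "'a \<Rightarrow> real"
  proof -
    have "(\<Sum>x\<in>F. (\<mu>(y := c)) x * v x) = (\<Sum>x\<in>F. \<mu> x * v x)"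
      using insert.hyps(2) by (intro sum.cong) auto
    then show ?thesis using insert.hyps by simp
  qed
  show ?case
  proof (cases "\<forall>v\<in>V. v y = 0")
    case True
    show ?thesis
    proof (cases "h y = 0")
      case hy: True
      have "\<exists>x\<in>F. v x \<noteq> h x" if "v \<in> V" for v
        using V(4)[OF that] True that hy by auto
      then obtain \<mu> where \<mu>: "\<forall>x. x \<notin> F \<longrightarrow> \<mu> x = 0" "\<forall>v\<in>V. (\<Sum>x\<in>F. \<mu> x * v x) = 0"
          "(\<Sum>x\<in>F. \<mu> x * h x) \<noteq> 0"
        using insert.IH[of V h] V(1-3) by auto
      show ?thesis
        using \<mu> insert.hyps by (intro exI[of _ \<mu>]) auto
    next
      case False
      show ?thesis
        using True False by (intro exI[of _ "(\<lambda>x. 0)(y := 1)"]) (simp add: sum_upd del: fun_upd_apply, simp)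
    qed
  next
    case False
    then obtain w where w: "w \<in> V" "w y \<noteq> 0" by auto
    define u where "u x = (1 / w y) * w x" for x
    have u: "u \<in> V" "u y = 1" using V(3)[OF w(1), of "1 / w y"] w(2) by (simp_all add: u_def[abs_def])
    let ?V = "{v \<in> V. v y = 0}"
    let ?h = "\<lambda>x. h x - h y * u x"
    have "\<exists>x\<in>F. v x \<noteq> ?h x" if v: "v \<in> ?V" for v
    proof (rule ccontr)
      assume "\<not> ?thesis"
      then have eq: "v x = ?h x" if "x \<in> F" for x using that by auto
      have "(\<lambda>x. v x + h y * u x) \<in> V" using V(2,3) u v by simp
      then obtain x where "x \<in> insert y F" "v x + h y * u x \<noteq> h x" using V(4) by blast
      then show False using eq[of x] v u(2) by auto
    qed
    moreover have "(\<lambda>x. 0) \<in> ?V" using V(1) by simp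
    moreover have "(\<lambda>x. v x + v' x) \<in> ?V" if "v \<in> ?V" "v' \<in> ?V" for v v' using that V(2) by simp
    moreover have "(\<lambda>x. c * v x) \<in> ?V" if "v \<in> ?V" for v c using that V(3) by simp
    ultimately obtain \<mu> where \<mu>: "\<forall>x. x \<notin> F \<longrightarrow> \<mu> x = 0" "\<forall>v\<in>?V. (\<Sum>x\<in>F. \<mu> x * v x) = 0"
        "(\<Sum>x\<in>F. \<mu> x * ?h x) \<noteq> 0"
      using insert.IH[of ?V ?h] by (auto simp del: Collect_mem_eq)
    let ?m = "\<lambda>v. \<Sum>x\<in>F. \<mu> x * v x"
    have lin: "?m (\<lambda>x. v x - c * u x) = ?m v - c * ?m u" for v c
      by (simp add: right_diff_distrib sum_subtractf sum_distrib_left mult.left_commute)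
    show ?thesis
    proof (intro exI conjI ballI)
      let ?\<mu> = "\<mu>(y := - ?m u)"
      show "\<forall>x. x \<notin> insert y F \<longrightarrow> ?\<mu> x = 0" using \<mu>(1) by auto
      show "(\<Sum>x\<in>insert y F. ?\<mu> x * v x) = 0" if v: "v \<in> V" for v
      proof -
        have "(\<lambda>x. v x + (- v y) * u x) \<in> V" by (rule V(2)[OF v V(3)[OF u(1)]])
        then have "(\<lambda>x. v x - v y * u x) \<in> ?V" using u(2) by simp
        from bspec[OF \<mu>(2) this] have "?m (\<lambda>x. v x - v y * u x) = 0" .
        then show ?thesis unfolding sum_upd lin by simp
      qed
      show "(\<Sum>x\<in>insert y F. ?\<mu> x * h x) \<noteq> 0"
        using \<mu>(3) unfolding sum_upd lin by (simp add: mult.commute)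
    qed
  qed
qed

lemma sm_apply_superset:
  assumes "finite A" "{x. \<mu> x \<noteq> 0} \<subseteq> A"
  shows "sm_apply \<mu> f = (\<Sum>x\<in>A. \<mu> x * f x)"
  unfolding sm_apply_def using assms by (intro sum.mono_neutral_left) auto

lemma sign_measure_on_combine:
  assumes "sign_measure_on X \<mu>" "sign_measure_on X \<nu>"
  shows "sign_measure_on X (\<lambda>x. \<mu> x + c * \<nu> x)"
    and "sm_apply (\<lambda>x. \<mu> x + c * \<nu> x) f = sm_apply \<mu> f + c * sm_apply \<nu> f"
proof -
  let ?A = "{x. \<mu> x \<noteq> 0} \<union> {x. \<nu> x \<noteq> 0}"
  have A: "finite ?A" "?A \<subseteq> topspace X" "{x. \<mu> x + c * \<nu> x \<noteq> 0} \<subseteq> ?A"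
    using assms by (auto simp: sign_measure_on_def)
  then show "sign_measure_on X (\<lambda>x. \<mu> x + c * \<nu> x)"
    unfolding sign_measure_on_def using finite_subset by blast
  show "sm_apply (\<lambda>x. \<mu> x + c * \<nu> x) f = sm_apply \<mu> f + c * sm_apply \<nu> f"
    using A(1,3) by (simp add: sm_apply_superset[of ?A] sum.distrib distrib_right sum_distrib_left mult.assoc)
qed

lemma sm_apply_diff: "sm_apply \<mu> (\<lambda>x. f x - g x) = sm_apply \<mu> f - sm_apply \<mu> g"
  by (simp add: sm_apply_def sum_subtractf right_diff_distrib)

lemma sm_apply_bound:
  assumes "sign_measure_on X \<mu>" "\<And>x. x \<in> topspace X \<Longrightarrow> \<bar>f x\<bar> \<le> e"
  shows "\<bar>sm_apply \<mu> f\<bar> \<le> e * sm_norm \<mu>"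
proof -
  have "\<bar>sm_apply \<mu> f\<bar> \<le> (\<Sum>x | \<mu> x \<noteq> 0. \<bar>\<mu> x\<bar> * e)"
    unfolding sm_apply_def using assms
    by (intro order_trans[OF sum_abs sum_mono]) (auto simp: abs_mult sign_measure_on_def intro!: mult_left_mono)
  then show ?thesis by (simp add: sm_norm_def sum_distrib_left mult.commute)
qed

lemma sign_measure_normalize:
  assumes \<mu>: "sign_measure_on X \<mu>" "\<mu> x \<noteq> 0"
  obtains c where "sign_measure_on X (\<lambda>x. c * \<mu> x)" "sm_norm (\<lambda>x. c * \<mu> x) = 1"
    "\<And>f. sm_apply (\<lambda>x. c * \<mu> x) f = c * sm_apply \<mu> f"
proof -
  have fin: "finite {x. \<mu> x \<noteq> 0}" using \<mu> by (simp add: sign_measure_on_def)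
  have "\<bar>\<mu> x\<bar> \<le> sm_norm \<mu>"
    unfolding sm_norm_def using \<mu>(2) fin by (intro member_le_sum) auto
  then have pos: "sm_norm \<mu> > 0" using \<mu>(2) by linarith
  define c where "c = 1 / sm_norm \<mu>"
  have c: "c > 0" using pos by (simp add: c_def)
  have supp: "{x. c * \<mu> x \<noteq> 0} = {x. \<mu> x \<noteq> 0}" using c by auto
  show thesis
  proof (rule that[of c])
    show "sign_measure_on X (\<lambda>x. c * \<mu> x)"
      using \<mu>(1) unfolding sign_measure_on_def supp .
    show "sm_apply (\<lambda>x. c * \<mu> x) f = c * sm_apply \<mu> f" for f
      unfolding sm_apply_def supp by (simp add: sum_distrib_left mult.assoc)
    have "sm_norm (\<lambda>x. c * \<mu> x) = c * sm_norm \<mu>"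
      unfolding sm_norm_def supp using c by (simp add: abs_mult sum_distrib_left)
    then show "sm_norm (\<lambda>x. c * \<mu> x) = 1" using pos by (simp add: c_def)
  qed
qed

locale Cp_quotient =
  fixes X :: "'a topology" and Z :: "('a \<Rightarrow> real) set"
  assumes closed: "closed_subspace (Cp X) Z"
begin

abbreviation cont :: "('a \<Rightarrow> real) \<Rightarrow> bool" where
  "cont f \<equiv> continuous_map X euclideanreal f"

text \<open>The members of \<open>Z\<close>, regardless of their values outside the space.\<close>
definition V :: "('a \<Rightarrow> real) set" where
  "V = {f. restrict f (topspace X) \<in> Z}"

definition q :: "('a \<Rightarrow> real) \<Rightarrow> ('a \<Rightarrow> real) set" where
  "q f = Z +>\<^bsub>Cp X\<^esub> restrict f (topspace X)"

abbreviation Q :: "('a \<Rightarrow> real) set tvs" where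
  "Q \<equiv> quotient_tvs (Cp X) Z"

lemma Z_subspace: "VectorSpace.subspace real_field Z (Cp X)"
  using closed by (simp add: closed_subspace_def)

lemma restrict_add:
  "restrict f (topspace X) \<oplus>\<^bsub>Cp X\<^esub> restrict g (topspace X) = (\<lambda>x\<in>topspace X. f x + g x)"
  by (auto simp: restrict_def fun_eq_iff)

lemma restrict_smult: "a \<odot>\<^bsub>Cp X\<^esub> restrict f (topspace X) = (\<lambda>x\<in>topspace X. a * f x)"
  by (auto simp: restrict_def fun_eq_iff)

lemma V_cont: "f \<in> V \<Longrightarrow> cont f"
  using subspaceD(2)[OF Z_subspace] continuous_map_eq[of X euclideanreal "restrict f (topspace X)" f]
  by (auto simp: V_def)

lemma V_add: "f \<in> V \<Longrightarrow> g \<in> V \<Longrightarrow> (\<lambda>x. f x + g x) \<in> V"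
  using subspaceD(4)[OF Z_subspace, of "restrict f (topspace X)" "restrict g (topspace X)"]
  unfolding V_def restrict_add by simp

lemma V_mult: "f \<in> V \<Longrightarrow> (\<lambda>x. a * f x) \<in> V"
  using subspaceD(5)[OF Z_subspace, of "restrict f (topspace X)" a]
  unfolding V_def restrict_smult by simp

lemma V_zero: "(\<lambda>x. 0) \<in> V"
  using subspaceD(3)[OF Z_subspace] by (simp add: V_def)

lemma q_carrier: "cont f \<Longrightarrow> q f \<in> carrier Q"
  unfolding q_def quotient_tvs_simps carrier_quotient[OF Z_subspace]
  using restrict_in_Cp by blast

lemma carrier_Q: "carrier Q = q ` {f. cont f}"
proof
  show "carrier Q \<subseteq> q ` {f. cont f}"
  proof
    fix y assume "y \<in> carrier Q"
    then obtain f where "f \<in> carrier (Cp X)" "y = Z +>\<^bsub>Cp X\<^esub> f"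
      by (auto simp: carrier_quotient[OF Z_subspace] simp del: Cp_simps)
    moreover from this have "restrict f (topspace X) = f" by (simp add: extensional_restrict)
    ultimately show "y \<in> q ` {f. cont f}" unfolding q_def by (intro image_eqI[of _ _ f]) auto
  qed
qed (use q_carrier in auto)

lemma q_add: "cont f \<Longrightarrow> cont g \<Longrightarrow> q (\<lambda>x. f x + g x) = q f \<oplus>\<^bsub>Q\<^esub> q g"
  unfolding q_def quotient_tvs_simps
  by (subst quotient_add[OF Z_subspace restrict_in_Cp restrict_in_Cp]) (simp_all only: restrict_add)

lemma q_mult: "cont f \<Longrightarrow> q (\<lambda>x. a * f x) = a \<odot>\<^bsub>Q\<^esub> q f"
  unfolding q_def
  by (subst quotient_smult[OF Z_subspace restrict_in_Cp]) (simp_all only: restrict_smult)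

lemma q_eq_iff: "cont f \<Longrightarrow> cont g \<Longrightarrow> q f = q g \<longleftrightarrow> (\<lambda>x. f x - g x) \<in> V"
proof -
  assume f: "cont f" and g: "cont g"
  have "restrict f (topspace X) \<oplus>\<^bsub>Cp X\<^esub> ((-1) \<odot>\<^bsub>Cp X\<^esub> restrict g (topspace X)) =
      (\<lambda>x\<in>topspace X. f x - g x)"
    by (auto simp: restrict_def fun_eq_iff)
  then show ?thesis
    using coset_eq_iff[OF Z_subspace restrict_in_Cp[OF f] restrict_in_Cp[OF g]]
    by (simp add: q_def V_def)
qed

definition annihilates :: "('a \<Rightarrow> real) \<Rightarrow> bool" where
  "annihilates \<mu> \<longleftrightarrow> sign_measure_on X \<mu> \<and> (\<forall>v\<in>V. sm_apply \<mu> v = 0)"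

text \<open>
  A basic neighbourhood of \<open>h\<close> that misses \<open>Z\<close> constrains the values on a finite set only, where no
  member of \<open>Z\<close> can agree with \<open>h\<close>.
\<close>
lemma annihilator_separates:
  assumes h: "cont h" "h \<notin> V"
  shows "\<exists>\<mu>. annihilates \<mu> \<and> sm_apply \<mu> h \<noteq> 0"
proof -
  let ?h = "restrict h (topspace X)"
  have "openin (vtop (Cp X)) (carrier (Cp X) - Z)"
    using closed unfolding closed_subspace_def closedin_def topspace_Cp by blast
  then obtain W where W: "openin (powertop_real (topspace X)) W" "carrier (Cp X) - Z = W \<inter> carrier (Cp X)"
    unfolding vtop_Cp openin_subtopology by blast
  have "?h \<in> W" using restrict_in_Cp[OF h(1)] h(2) W(2) unfolding V_def by blast
  from product_topology_open_contains_basis[OF W(1) this]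
  obtain U where U': "?h \<in> Pi\<^sub>E (topspace X) U \<and> (\<forall>x. openin euclideanreal (U x)) \<and>
      finite {x. U x \<noteq> topspace euclideanreal} \<and> Pi\<^sub>E (topspace X) U \<subseteq> W"
    by (rule exE)
  have U: "?h \<in> Pi\<^sub>E (topspace X) U" "finite {x. U x \<noteq> UNIV}" "Pi\<^sub>E (topspace X) U \<subseteq> W"
    using U' by (simp_all only: topspace_euclidean)
  define F where "F = {x \<in> topspace X. U x \<noteq> UNIV}"
  have F: "finite F" using U(2) by (rule rev_finite_subset) (auto simp: F_def)
  have differ: "\<exists>x\<in>F. v x \<noteq> h x" if v: "v \<in> V" for v
  proof (rule ccontr)
    assume "\<not> ?thesis"
    then have eq: "v x = h x" if "x \<in> F" for x using that by auto
    have "restrict v (topspace X) \<in> Pi\<^sub>E (topspace X) U"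
    proof (rule PiE_I)
      fix x assume x: "x \<in> topspace X"
      show "restrict v (topspace X) x \<in> U x"
      proof (cases "U x = UNIV")
        case False
        then have "v x = ?h x" using eq x by (simp add: F_def)
        then show ?thesis using PiE_mem[OF U(1) x] x by simp
      qed simp
    qed simp
    then have "restrict v (topspace X) \<in> W \<inter> carrier (Cp X)"
      using restrict_in_Cp[OF V_cont[OF v]] subsetD[OF U(3)] by (intro IntI)
    then show False using v unfolding W(2)[symmetric] V_def by simp
  qed
  have "\<exists>\<mu>. (\<forall>x. x \<notin> F \<longrightarrow> \<mu> x = 0) \<and> (\<forall>v\<in>V. (\<Sum>x\<in>F. \<mu> x * v x) = 0) \<and> (\<Sum>x\<in>F. \<mu> x * h x) \<noteq> 0"
  proof (rule finite_separating_functional[OF F V_zero])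
    show "(\<lambda>x. u x + v x) \<in> V" if "u \<in> V" "v \<in> V" for u v using V_add[OF that] .
    show "(\<lambda>x. c * v x) \<in> V" if "v \<in> V" for c v using V_mult[OF that] .
    show "\<exists>x\<in>F. v x \<noteq> h x" if "v \<in> V" for v using differ[OF that] .
  qed
  then obtain \<mu> where \<mu>: "\<forall>x. x \<notin> F \<longrightarrow> \<mu> x = 0" "\<forall>v\<in>V. (\<Sum>x\<in>F. \<mu> x * v x) = 0" "(\<Sum>x\<in>F. \<mu> x * h x) \<noteq> 0"
    by (elim exE conjE)
  have supp: "{x. \<mu> x \<noteq> 0} \<subseteq> F" using \<mu>(1) by auto
  then have "sign_measure_on X \<mu>"
    using F finite_subset[OF supp F] by (auto simp: sign_measure_on_def F_def)
  then have "annihilates \<mu>"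
    using \<mu>(2) unfolding annihilates_def sm_apply_superset[OF F supp] by (intro conjI)
  then show ?thesis
    using \<mu>(3) sm_apply_superset[OF F supp, of h] by (intro exI[of _ \<mu>]) simp
qed

text \<open>
  Adding one function to a subspace that is cut out by annihilating measures gives another such
  subspace. So \<open>Z\<close> and finitely many functions span a proper subspace only if some non-zero measure
  annihilates them all.
\<close>
lemma annihilator_separates_span:
  fixes f :: "nat \<Rightarrow> 'a \<Rightarrow> real"
  assumes f: "\<And>i. cont (f i)" and g: "cont g"
  shows "(\<exists>c. (\<lambda>x. g x - (\<Sum>i<n. c i * f i x)) \<in> V) \<or>
    (\<exists>\<mu>. annihilates \<mu> \<and> (\<forall>i<n. sm_apply \<mu> (f i) = 0) \<and> sm_apply \<mu> g \<noteq> 0)"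
  using g
proof (induction n arbitrary: g)
  case 0
  then show ?case using annihilator_separates[of g] by auto
next
  case (Suc n)
  have extend: "\<exists>c. (\<lambda>x. g x - (\<Sum>i<Suc n. c i * f i x)) \<in> V"
    if "(\<lambda>x. (g x - a * f n x) - (\<Sum>i<n. c i * f i x)) \<in> V" for a c
  proof (intro exI)
    have "(\<Sum>i<Suc n. (c(n := a)) i * f i x) = a * f n x + (\<Sum>i<n. c i * f i x)" for x
      by simp
    then have "(\<lambda>x. g x - (\<Sum>i<Suc n. (c(n := a)) i * f i x)) = (\<lambda>x. (g x - a * f n x) - (\<Sum>i<n. c i * f i x))"
      by (simp only: diff_diff_eq)
    then show "(\<lambda>x. g x - (\<Sum>i<Suc n. (c(n := a)) i * f i x)) \<in> V" using that by simp
  qed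
  show ?case
  proof (cases "\<forall>\<mu>. annihilates \<mu> \<and> (\<forall>i<n. sm_apply \<mu> (f i) = 0) \<longrightarrow> sm_apply \<mu> (f n) = 0")
    case True
    from Suc.IH[OF Suc.prems] show ?thesis
    proof
      assume "\<exists>c. (\<lambda>x. g x - (\<Sum>i<n. c i * f i x)) \<in> V"
      then show ?thesis using extend[of 0] by auto
    qed (use True less_Suc_eq in blast)
  next
    case False
    then obtain \<nu> where \<nu>: "annihilates \<nu>" "\<forall>i<n. sm_apply \<nu> (f i) = 0" "sm_apply \<nu> (f n) \<noteq> 0" by blast
    define a where "a = sm_apply \<nu> g / sm_apply \<nu> (f n)"
    let ?g = "\<lambda>x. g x - a * f n x"
    have "cont ?g"
      by (intro continuous_map_diff Suc.prems continuous_map_real_mult_left f)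
    from Suc.IH[OF this] show ?thesis
    proof
      assume "\<exists>c. (\<lambda>x. ?g x - (\<Sum>i<n. c i * f i x)) \<in> V"
      then show ?thesis using extend by blast
    next
      assume "\<exists>\<mu>. annihilates \<mu> \<and> (\<forall>i<n. sm_apply \<mu> (f i) = 0) \<and> sm_apply \<mu> ?g \<noteq> 0"
      then obtain \<mu> where \<mu>: "annihilates \<mu>" "\<forall>i<n. sm_apply \<mu> (f i) = 0" "sm_apply \<mu> ?g \<noteq> 0" by blast
      define c where "c = - (sm_apply \<mu> (f n) / sm_apply \<nu> (f n))"
      let ?\<mu> = "\<lambda>x. \<mu> x + c * \<nu> x"
      note comb = sign_measure_on_combine[OF \<mu>(1)[unfolded annihilates_def, THEN conjunct1]
          \<nu>(1)[unfolded annihilates_def, THEN conjunct1]]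
      have "annihilates ?\<mu>"
        using \<mu>(1) \<nu>(1) comb by (simp add: annihilates_def)
      moreover have "\<forall>i<Suc n. sm_apply ?\<mu> (f i) = 0"
        using \<mu>(2) \<nu>(2,3) unfolding comb(2) by (auto simp: less_Suc_eq c_def)
      moreover have "sm_apply ?\<mu> g = sm_apply \<mu> ?g"
        using \<nu>(3) unfolding comb(2) sm_apply_diff sm_apply_mult by (simp add: a_def c_def)
      ultimately show ?thesis using \<mu>(3) by auto
    qed
  qed
qed

lemma infinite_dimensional_not_spanned:
  fixes f :: "nat \<Rightarrow> 'a \<Rightarrow> real"
  assumes vs: "VectorSpace.vectorspace real_field Q" and inf: "infinite_dimensional Q"
    and f: "\<And>i. cont (f i)"
  shows "\<exists>g. cont g \<and> (\<forall>c. (\<lambda>x. g x - (\<Sum>i<n. c i * f i x)) \<notin> V)"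
proof (rule ccontr)
  assume "\<not> ?thesis"
  then have spanned: "\<exists>c. (\<lambda>x. g x - (\<Sum>i<n. c i * f i x)) \<in> V" if "cont g" for g using that by blast
  interpret vs: VectorSpace.vectorspace real_field Q by fact
  let ?A = "(\<lambda>i. q (f i)) ` {..<n}"
  have A: "?A \<subseteq> carrier Q" using q_carrier f by auto
  interpret sp: submodule real_field "vs.span ?A" Q
    by (rule vs.span_is_submodule[OF A])
  have "q (\<lambda>x. \<Sum>i<k. c i * f i x) \<in> vs.span ?A" if "k \<le> n" for k c
    using that
  proof (induction k)
    case 0
    have "q (\<lambda>x. 0) = zero Q"
      using quotient_zero[OF Z_subspace] by (simp add: q_def)
    then show ?case using sp.zero_closed by simp
  next
    case (Suc k)
    have c: "cont (\<lambda>x. \<Sum>i<k. c i * f i x)" "cont (\<lambda>x. c k * f k x)"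
      by (intro continuous_map_sum continuous_map_real_mult_left f finite_lessThan)+
    have "q (f k) \<in> vs.span ?A" using Suc.prems vs.in_own_span[OF A] by auto
    then have "q (\<lambda>x. c k * f k x) \<in> vs.span ?A"
      unfolding q_mult[OF f] using sp.smult_closed by simp
    then show ?case
      using q_add[OF c] sp.m_closed Suc by simp
  qed
  then have in_span: "q (\<lambda>x. \<Sum>i<n. c i * f i x) \<in> vs.span ?A" for c by blast
  have "carrier Q \<subseteq> vs.span ?A"
  proof
    fix y assume "y \<in> carrier Q"
    then obtain g where g: "cont g" "y = q g" using carrier_Q by auto
    then obtain c where "(\<lambda>x. g x - (\<Sum>i<n. c i * f i x)) \<in> V" using spanned by blast
    moreover have "cont (\<lambda>x. \<Sum>i<n. c i * f i x)"
      by (intro continuous_map_sum continuous_map_real_mult_left f finite_lessThan)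
    ultimately have "y = q (\<lambda>x. \<Sum>i<n. c i * f i x)" using q_eq_iff g by blast
    then show "y \<in> vs.span ?A" using in_span by simp
  qed
  then have "vs.span ?A = carrier Q" using sp.subset by blast
  then have "vs.fin_dim"
    unfolding vs.fin_dim_def using A by (intro exI[of _ ?A]) auto
  then show False using inf by (simp add: infinite_dimensional_def)
qed

end

section \<open>Polishable quotients of pseudocompact function spaces\<close>

text \<open>
  From here on the carrier of the quotient stays folded, so that the rules of its metric space apply.
\<close>
declare quotient_tvs_simps [simp del]

locale pseudocompact_polishable_quotient = Cp_quotient X Z
  for X :: "'a topology" and Z :: "('a \<Rightarrow> real) set" +
  fixes T :: "('a \<Rightarrow> real) set topology" and d :: "('a \<Rightarrow> real) set \<Rightarrow> ('a \<Rightarrow> real) set \<Rightarrow> real"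
  assumes bounded: "\<And>f. continuous_map X euclideanreal f \<Longrightarrow> bounded (f ` topspace X)"
    and infinite_dim: "infinite_dimensional (quotient_tvs (Cp X) Z)"
    and finer: "\<And>U. openin (quotient_topology (Cp X) Z) U \<Longrightarrow> openin T U"
    and frechet: "frechet_space (quotient_tvs (Cp X) Z\<lparr>vtop := T\<rparr>)"
    and separable: "separable_space T"
    and metric: "Metric_space (a_rcosets\<^bsub>Cp X\<^esub> Z) d" "Metric_space.mtopology (a_rcosets\<^bsub>Cp X\<^esub> Z) d = T"
      "Metric_space.mcomplete (a_rcosets\<^bsub>Cp X\<^esub> Z) d"
    and invariant: "\<And>x y z. x \<in> a_rcosets\<^bsub>Cp X\<^esub> Z \<Longrightarrow> y \<in> a_rcosets\<^bsub>Cp X\<^esub> Z \<Longrightarrow> z \<in> a_rcosets\<^bsub>Cp X\<^esub> Z \<Longrightarrow>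
       d (x <+>\<^bsub>Cp X\<^esub> z) (y <+>\<^bsub>Cp X\<^esub> z) = d x y"
begin

sublocale M: Metric_space "carrier Q" d
  using metric(1) by (simp add: quotient_tvs_simps)

lemma mtopology_eq: "M.mtopology = T" and mcomplete: "M.mcomplete"
  using metric by (simp_all add: quotient_tvs_simps)

lemma vectorspace_Q: "VectorSpace.vectorspace real_field Q"
proof -
  interpret F: frechet_space "Q\<lparr>vtop := T\<rparr>" by (rule frechet)
  have vs: "VectorSpace.vectorspace real_field (Q\<lparr>vtop := T\<rparr>)" ..
  show ?thesis
    by (rule vectorspace_subset[OF vs]) (use vectorspaceD(1-3)[OF vs] in simp_all)
qed

text \<open>The distance from zero in the quotient, an F-seminorm on the continuous functions.\<close>
definition p :: "('a \<Rightarrow> real) \<Rightarrow> real" where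
  "p f = d (q f) (q (\<lambda>x. 0))"

lemma cont_0: "cont (\<lambda>x. 0)" by simp

lemma dist_q:
  assumes "cont f" "cont g"
  shows "d (q f) (q g) = p (\<lambda>x. f x - g x)"
proof -
  have c: "cont (\<lambda>x. f x - g x)" using assms by (rule continuous_map_diff)
  have f: "q (\<lambda>x. f x - g x) \<oplus>\<^bsub>Q\<^esub> q g = q f"
    using q_add[OF c assms(2)] unfolding diff_add_cancel by (rule sym)
  have g: "q (\<lambda>x. 0) \<oplus>\<^bsub>Q\<^esub> q g = q g"
    using q_add[OF cont_0 assms(2)] unfolding add_0 by (rule sym)
  have "d (q f) (q g) = d (q (\<lambda>x. f x - g x) \<oplus>\<^bsub>Q\<^esub> q g) (q (\<lambda>x. 0) \<oplus>\<^bsub>Q\<^esub> q g)"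
    unfolding f g ..
  also have "\<dots> = p (\<lambda>x. f x - g x)"
    unfolding p_def quotient_tvs_simps
    using q_carrier[OF c] q_carrier[OF assms(2)] q_carrier[OF cont_0] by (intro invariant) (simp_all add: quotient_tvs_simps)
  finally show ?thesis .
qed

lemma p_zero: "p (\<lambda>x. 0) = 0"
  using q_carrier[OF cont_0] by (simp add: p_def)

lemma p_diff:
  assumes "cont f" "cont g"
  shows "p (\<lambda>x. f x - g x) \<le> p f + p g"
proof -
  have "d (q f) (q g) \<le> d (q f) (q (\<lambda>x. 0)) + d (q (\<lambda>x. 0)) (q g)"
    using assms cont_0 q_carrier by (intro M.triangle) blast+
  then show ?thesis using dist_q[OF assms] M.commute[of "q g"] by (simp add: p_def)
qed

lemma in_mball_q:
  assumes "cont f" "cont g"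
  shows "q f \<in> M.mball (q g) r \<longleftrightarrow> p (\<lambda>x. f x - g x) < r"
  using assms q_carrier[OF assms(1)] q_carrier[OF assms(2)] dist_q[OF assms] M.commute[of "q f" "q g"]
  by simp

lemma nbhd_zero:
  assumes "openin T U" "q (\<lambda>x. 0) \<in> U"
  shows "\<exists>r>0. \<forall>f. cont f \<longrightarrow> p f < r \<longrightarrow> q f \<in> U"
proof -
  obtain r where r: "r > 0" "M.mball (q (\<lambda>x. 0)) r \<subseteq> U"
    using assms unfolding mtopology_eq[symmetric] M.openin_mtopology by blast
  have "q f \<in> U" if "cont f" "p f < r" for f
    using r(2) in_mball_q[OF that(1) cont_0, of r] that(2) by auto
  then show ?thesis using r(1) by blast
qed

lemma p_scale:
  assumes e: "e > 0"
  shows "\<exists>r>0. \<forall>f. cont f \<longrightarrow> p f < r \<longrightarrow> p (\<lambda>x. a * f x) < e"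
proof -
  interpret F: frechet_space "Q\<lparr>vtop := T\<rparr>" by (rule frechet)
  have top: "topspace T = carrier Q" using mtopology_eq M.topspace_mtopology by metis
  have "continuous_map T (prod_topology euclideanreal T) (\<lambda>y. (a, y))"
    by (intro continuous_map_pairedI) auto
  then have "continuous_map T T ((\<lambda>(a, y). a \<odot>\<^bsub>Q\<^esub> y) \<circ> (\<lambda>y. (a, y)))"
    using F.continuous_scale by (intro continuous_map_compose) auto
  then have "openin T {y \<in> topspace T. a \<odot>\<^bsub>Q\<^esub> y \<in> M.mball (q (\<lambda>x. 0)) e}"
    using M.openin_mball mtopology_eq by (intro openin_continuous_map_preimage[of T T]) (auto simp: o_def)
  moreover have "a \<odot>\<^bsub>Q\<^esub> q (\<lambda>x. 0) = q (\<lambda>x. 0)"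
    using q_mult[OF cont_0, of a] by simp
  ultimately obtain r where r: "r > 0"
      "\<And>f. cont f \<Longrightarrow> p f < r \<Longrightarrow> q f \<in> {y \<in> topspace T. a \<odot>\<^bsub>Q\<^esub> y \<in> M.mball (q (\<lambda>x. 0)) e}"
    using nbhd_zero[of "{y \<in> topspace T. a \<odot>\<^bsub>Q\<^esub> y \<in> M.mball (q (\<lambda>x. 0)) e}"] e top
      q_carrier[OF cont_0] M.centre_in_mball_iff by auto
  have "p (\<lambda>x. a * f x) < e" if "cont f" "p f < r" for f
  proof -
    have "q (\<lambda>x. a * f x) \<in> M.mball (q (\<lambda>x. 0)) e" using r(2)[OF that] q_mult[OF that(1)] by simp
    then show ?thesis
      using in_mball_q[OF continuous_map_real_mult_left[OF that(1)] cont_0, of a e] by simp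
  qed
  then show ?thesis using r(1) by blast
qed

text \<open>
  A measure annihilating \<open>Z\<close> is a pointwise continuous functional on the quotient, hence continuous for
  every finer topology.
\<close>
lemma annihilator_continuous:
  assumes \<mu>: "annihilates \<mu>" and e: "e > 0"
  shows "\<exists>r>0. \<forall>f. cont f \<longrightarrow> p f < r \<longrightarrow> \<bar>sm_apply \<mu> f\<bar> < e"
proof -
  have sm: "sign_measure_on X \<mu>" "\<And>v. v \<in> V \<Longrightarrow> sm_apply \<mu> v = 0"
    using \<mu> by (auto simp: annihilates_def)
  have eq: "sm_apply \<mu> f = sm_apply \<mu> g" if "cont f" "cont g" "q f = q g" for f g
    using sm(2)[of "\<lambda>x. f x - g x"] q_eq_iff[OF that(1,2)] that(3) by (simp add: sm_apply_diff)
  let ?U = "q ` {f. cont f \<and> \<bar>sm_apply \<mu> f\<bar> < e}"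
  have "Z +>\<^bsub>Cp X\<^esub> f \<in> ?U \<longleftrightarrow> sm_apply \<mu> f \<in> {-e<..<e}" if f: "f \<in> carrier (Cp X)" for f
  proof -
    have qf: "Z +>\<^bsub>Cp X\<^esub> f = q f" "cont f"
      using f by (simp_all add: q_def extensional_restrict)
    have "q f \<in> ?U \<longleftrightarrow> \<bar>sm_apply \<mu> f\<bar> < e"
    proof
      assume "q f \<in> ?U"
      then obtain g where "cont g" "\<bar>sm_apply \<mu> g\<bar> < e" "q f = q g" by blast
      then show "\<bar>sm_apply \<mu> f\<bar> < e" using eq[OF qf(2)] by simp
    qed (use qf(2) in blast)
    then show ?thesis unfolding qf(1) by (simp add: abs_less_iff) linarith
  qed
  then have "{f \<in> topspace (vtop (Cp X)). Z +>\<^bsub>Cp X\<^esub> f \<in> ?U} =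
      {f \<in> topspace (vtop (Cp X)). sm_apply \<mu> f \<in> {-e<..<e}}"
    unfolding topspace_Cp by blast
  moreover have "openin (vtop (Cp X)) {f \<in> topspace (vtop (Cp X)). sm_apply \<mu> f \<in> {-e<..<e}}"
    by (rule openin_continuous_map_preimage[OF continuous_map_sm_apply[OF sm(1)]]) simp
  moreover have "?U \<subseteq> a_rcosets\<^bsub>Cp X\<^esub> Z" using carrier_Q by (auto simp: quotient_tvs_simps)
  ultimately have "openin T ?U"
    by (intro finer) (simp add: openin_quotient_topology)
  moreover have "q (\<lambda>x. 0) \<in> ?U" using e by (auto simp: sm_apply_def)
  ultimately obtain r where r: "r > 0" "\<And>f. cont f \<Longrightarrow> p f < r \<Longrightarrow> q f \<in> ?U"
    using nbhd_zero by blast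
  have "\<bar>sm_apply \<mu> f\<bar> < e" if f: "cont f" "p f < r" for f
  proof -
    obtain g where "cont g" "\<bar>sm_apply \<mu> g\<bar> < e" "q f = q g" using r(2)[OF f] by auto
    then show ?thesis using eq[OF f(1)] by simp
  qed
  then show ?thesis using r(1) by blast
qed

text \<open>The ball of radius \<open>b\<close> for the supremum norm.\<close>
definition B :: "real \<Rightarrow> ('a \<Rightarrow> real) set" where
  "B b = {f. cont f \<and> (\<forall>x\<in>topspace X. \<bar>f x\<bar> \<le> b)}"

lemma B_cont: "f \<in> B b \<Longrightarrow> cont f" by (simp add: B_def)

text \<open>The balls exhaust the continuous functions, so the Baire category theorem applies to their images.\<close>
lemma baire_ball:
  obtains b r where "b > 0" "r > 0" "\<And>f e. cont f \<Longrightarrow> p f < r \<Longrightarrow> e > 0 \<Longrightarrow> \<exists>a\<in>B b. p (\<lambda>x. f x - a x) < e"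
proof -
  let ?G = "range (\<lambda>n::nat. M.mtopology closure_of (q ` B (real n)))"
  have "\<exists>S\<in>?G. M.mtopology interior_of S \<noteq> {}"
  proof (rule ccontr)
    assume "\<not> ?thesis"
    then have "M.mtopology interior_of \<Union>?G = {}"
      by (intro M.metric_Baire_category_alt mcomplete) auto
    moreover have "\<Union>?G = carrier Q"
    proof
      show "\<Union>?G \<subseteq> carrier Q"
        using closure_of_subset_topspace[of M.mtopology] M.topspace_mtopology by blast
      show "carrier Q \<subseteq> \<Union>?G"
      proof
        fix y assume y: "y \<in> carrier Q"
        then obtain f where f: "cont f" "y = q f" using carrier_Q by auto
        obtain b where b: "\<And>x. x \<in> topspace X \<Longrightarrow> \<bar>f x\<bar> \<le> b"
          using bounded[OF f(1)] unfolding bounded_iff by auto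
        obtain n :: nat where "b \<le> real n" using real_arch_simple by blast
        then have "f \<in> B (real n)" using f(1) b by (force simp: B_def)
        moreover have "q ` B (real n) \<subseteq> M.mtopology closure_of (q ` B (real n))"
          using q_carrier B_cont by (intro closure_of_subset) auto
        ultimately show "y \<in> \<Union>?G" using f(2) by blast
      qed
    qed
    moreover have "M.mtopology interior_of carrier Q = carrier Q"
      using interior_of_topspace[of M.mtopology] M.topspace_mtopology by metis
    ultimately have "carrier Q = {}" by (simp only:)
    then show False using q_carrier[OF cont_0] by (simp only: empty_iff)
  qed
  then obtain n :: nat and y where y: "y \<in> M.mtopology interior_of (M.mtopology closure_of (q ` B (real n)))"
    by blast
  let ?cl = "M.mtopology closure_of (q ` B (real n))"
  have yQ: "y \<in> carrier Q"
    using y interior_of_subset_topspace[of M.mtopology ?cl] unfolding M.topspace_mtopology by (rule rev_subsetD)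
  have "openin M.mtopology (M.mtopology interior_of ?cl)" by (rule openin_interior_of)
  then have "\<exists>r>0. M.mball y r \<subseteq> M.mtopology interior_of ?cl"
    using y unfolding M.openin_mtopology by (elim conjE allE impE)
  then obtain r where r: "r > 0" and sub: "M.mball y r \<subseteq> M.mtopology interior_of ?cl" by (elim exE conjE)
  have ball: "M.mball y r \<subseteq> ?cl"
    using sub interior_of_subset[of M.mtopology ?cl] by (rule subset_trans)
  obtain f0 where f0: "cont f0" "y = q f0" using yQ carrier_Q by auto
  \<comment> \<open>The ball of radius \<open>r\<close> is centred at \<open>f0\<close>; differences of approximants move it to zero at the cost of
    doubling \<open>n\<close>.\<close>
  have near: "\<exists>a\<in>B (real n). p (\<lambda>x. f x - a x) < e"
    if f: "cont f" "p (\<lambda>x. f x - f0 x) < r" and e: "e > 0" for f e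
  proof -
    have "q f \<in> M.mtopology closure_of (q ` B (real n))"
      using ball in_mball_q[OF f(1) f0(1)] f(2) f0(2) by (auto simp del: M.in_mball)
    then obtain a where a: "a \<in> B (real n)" "q a \<in> M.mball (q f) e"
      using e unfolding M.metric_closure_of by auto
    then have "d (q f) (q a) < e" by simp
    then show ?thesis using dist_q[OF f(1) B_cont[OF a(1)]] a(1) by auto
  qed
  have "\<exists>a\<in>B (2 * real n + 1). p (\<lambda>x. f x - a x) < e" if f: "cont f" "p f < r" and e: "e > 0" for f e
  proof -
    obtain a1 where a1: "a1 \<in> B (real n)" "p (\<lambda>x. (f x + f0 x) - a1 x) < e / 2"
      using near[of "\<lambda>x. f x + f0 x" "e / 2"] f e f0(1) by (auto intro: continuous_map_add)
    obtain a2 where a2: "a2 \<in> B (real n)" "p (\<lambda>x. f0 x - a2 x) < e / 2"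
      using near[of f0 "e / 2"] e f0(1) r by (auto simp: p_zero)
    have "cont (\<lambda>x. (f x + f0 x) - a1 x)" "cont (\<lambda>x. f0 x - a2 x)"
      using f(1) f0(1) B_cont[OF a1(1)] B_cont[OF a2(1)] by (auto intro!: continuous_map_add continuous_map_diff)
    from p_diff[OF this] have "p (\<lambda>x. ((f x + f0 x) - a1 x) - (f0 x - a2 x)) < e"
      using a1(2) a2(2) by linarith
    moreover have "(\<lambda>x. ((f x + f0 x) - a1 x) - (f0 x - a2 x)) = (\<lambda>x. f x - (a1 x - a2 x))" by auto
    moreover have "(\<lambda>x. a1 x - a2 x) \<in> B (2 * real n + 1)"
    proof -
      have "\<bar>a1 x - a2 x\<bar> \<le> 2 * real n + 1" if "x \<in> topspace X" for x
      proof -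
        have "\<bar>a1 x\<bar> \<le> real n" "\<bar>a2 x\<bar> \<le> real n" using a1(1) a2(1) that by (auto simp: B_def)
        then show ?thesis by linarith
      qed
      then show ?thesis using B_cont[OF a1(1)] B_cont[OF a2(1)] by (simp add: B_def continuous_map_diff)
    qed
    ultimately show ?thesis by (intro bexI[of _ "\<lambda>x. a1 x - a2 x"]) simp_all
  qed
  then show thesis using that[of "2 * real n + 1" r] r by auto
qed

text \<open>Rescaling the ball found by the Baire category theorem to any prescribed radius.\<close>
lemma small_approximation:
  assumes \<delta>: "\<delta> > 0"
  shows "\<exists>r>0. \<forall>f. cont f \<longrightarrow> p f < r \<longrightarrow> (\<forall>e>0. \<exists>a\<in>B \<delta>. p (\<lambda>x. f x - a x) < e)"
proof -
  obtain b r0 where b: "b > 0" "r0 > 0"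
      "\<And>f e. cont f \<Longrightarrow> p f < r0 \<Longrightarrow> e > 0 \<Longrightarrow> \<exists>a\<in>B b. p (\<lambda>x. f x - a x) < e"
    using baire_ball by blast
  obtain r where r: "r > 0" "\<And>f. cont f \<Longrightarrow> p f < r \<Longrightarrow> p (\<lambda>x. b / \<delta> * f x) < r0"
    using p_scale[OF b(2), of "b / \<delta>"] by blast
  have "\<exists>a\<in>B \<delta>. p (\<lambda>x. f x - a x) < e" if f: "cont f" "p f < r" and e: "e > 0" for f e
  proof -
    obtain r' where r': "r' > 0" "\<And>f. cont f \<Longrightarrow> p f < r' \<Longrightarrow> p (\<lambda>x. \<delta> / b * f x) < e"
      using p_scale[OF e, of "\<delta> / b"] by blast
    have c: "cont (\<lambda>x. b / \<delta> * f x)" by (intro continuous_map_real_mult_left f)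
    obtain a where a: "a \<in> B b" "p (\<lambda>x. b / \<delta> * f x - a x) < r'"
      using b(3)[OF c r(2)[OF f] r'(1)] by blast
    have "p (\<lambda>x. \<delta> / b * (b / \<delta> * f x - a x)) < e"
      by (rule r'(2)[OF continuous_map_diff[OF c B_cont[OF a(1)]] a(2)])
    moreover have "(\<lambda>x. \<delta> / b * (b / \<delta> * f x - a x)) = (\<lambda>x. f x - \<delta> / b * a x)"
      using \<delta> b(1) by (auto simp: field_simps)
    moreover have "(\<lambda>x. \<delta> / b * a x) \<in> B \<delta>"
    proof -
      have bound: "\<bar>\<delta> / b * a x\<bar> \<le> \<delta>" if "x \<in> topspace X" for x
      proof -
        have "\<bar>\<delta> / b * a x\<bar> = \<delta> / b * \<bar>a x\<bar>" using \<delta> b(1) by (simp add: abs_mult)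
        also have "\<dots> \<le> \<delta> / b * b"
          using a(1) that \<delta> b(1) by (intro mult_left_mono) (auto simp: B_def)
        finally show ?thesis using b(1) by simp
      qed
      have "cont (\<lambda>x. \<delta> / b * a x)" by (rule continuous_map_real_mult_left[OF B_cont[OF a(1)]])
      then show ?thesis using bound unfolding B_def by blast
    qed
    ultimately show ?thesis by (intro bexI[of _ "\<lambda>x. \<delta> / b * a x"]) simp_all
  qed
  then show ?thesis using r(1) by blast
qed

text \<open>
  The successive approximation of the open mapping theorem. Its limit differs from \<open>f\<close> by a function
  on which every annihilator of \<open>Z\<close> vanishes, since these measures are continuous for both the finer
  topology and pointwise convergence; such a function belongs to \<open>Z\<close>.
\<close>
lemma quotient_map_open:
  assumes e: "e > 0"
  shows "\<exists>r>0. \<forall>f. cont f \<longrightarrow> p f < r \<longrightarrow> (\<exists>v\<in>V. (\<lambda>x. f x - v x) \<in> B e)"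
proof -
  \<comment> \<open>The step sizes sum up to \<open>e / 2\<close>. The bound \<open>1 / 2 ^ k\<close> in \<open>s\<close> below forces the remainders to tend to zero
    in the finer topology.\<close>
  define \<delta> where "\<delta> k = e / 2 / 2 ^ Suc k" for k :: nat
  have "\<exists>r>0. \<forall>f. cont f \<longrightarrow> p f < r \<longrightarrow> (\<forall>e>0. \<exists>a\<in>B (\<delta> k). p (\<lambda>x. f x - a x) < e)" for k
    using e by (intro small_approximation) (simp add: \<delta>_def)
  then obtain r where r: "\<And>k. r k > 0"
      "\<And>k f e. cont f \<Longrightarrow> p f < r k \<Longrightarrow> e > 0 \<Longrightarrow> \<exists>a\<in>B (\<delta> k). p (\<lambda>x. f x - a x) < e" by metis
  define s where "s k = min (r k) (1 / 2 ^ k)" for k :: nat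
  have s: "s k > 0" for k using r(1) by (simp add: s_def)
  have "\<exists>v\<in>V. (\<lambda>x. f x - v x) \<in> B e" if f: "cont f" "p f < s 0" for f
  proof -
    have "\<exists>g. \<forall>k. (cont (g k) \<and> p (g k) < s k \<and> (k = 0 \<longrightarrow> g k = f)) \<and> (\<lambda>x. g k x - g (Suc k) x) \<in> B (\<delta> k)"
    proof (rule dependent_nat_choice)
      show "\<exists>g. cont g \<and> p g < s 0 \<and> (0 = 0 \<longrightarrow> g = f)" using f by simp
      fix g and k :: nat assume g: "cont g \<and> p g < s k \<and> (k = 0 \<longrightarrow> g = f)"
      then obtain a where a: "a \<in> B (\<delta> k)" "p (\<lambda>x. g x - a x) < s (Suc k)"
        using r(2)[of g k "s (Suc k)"] s by (auto simp: s_def)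
      then show "\<exists>g'. (cont g' \<and> p g' < s (Suc k) \<and> (Suc k = 0 \<longrightarrow> g' = f)) \<and> (\<lambda>x. g x - g' x) \<in> B (\<delta> k)"
        using g B_cont[OF a(1)] by (intro exI[of _ "\<lambda>x. g x - a x"]) (simp add: continuous_map_diff)
    qed
    then obtain g where g: "\<And>k. cont (g k)" "\<And>k. p (g k) < s k" "g 0 = f"
        "\<And>k. (\<lambda>x. g k x - g (Suc k) x) \<in> B (\<delta> k)" by blast
    define w where "w k = e / 2 / 2 ^ k" for k :: nat
    have w: "w k \<ge> 0" "\<delta> k = w k - w (Suc k)" for k using e by (simp_all add: w_def \<delta>_def)
    have gdiff: "\<bar>g k x - g (k + j) x\<bar> \<le> w k - w (k + j)" if x: "x \<in> topspace X" for k j x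
    proof (induction j)
      case (Suc j)
      have "\<bar>g (k + j) x - g (Suc (k + j)) x\<bar> \<le> \<delta> (k + j)" using g(4)[of "k + j"] x by (simp add: B_def)
      then show ?case using Suc w(2)[of "k + j"] by simp
    qed simp
    have gdiff': "\<bar>g k x - g m x\<bar> \<le> w k" if x: "x \<in> topspace X" and km: "k \<le> m" for k m x
    proof -
      obtain j where "m = k + j" using km le_Suc_ex by blast
      then show ?thesis using gdiff[OF x, of k j] w(1)[of "k + j"] by simp
    qed
    have cauchy: "\<exists>N. \<forall>m n x. N \<le> m \<longrightarrow> N \<le> n \<longrightarrow> x \<in> topspace X \<longrightarrow> dist (g m x) (g n x) < \<epsilon>"
      if \<epsilon>: "\<epsilon> > 0" for \<epsilon>
    proof -
      obtain N where "(1/2) ^ N < \<epsilon> / e" using real_arch_pow_inv[of "\<epsilon> / e" "1/2"] e \<epsilon> by auto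
      then have "(1/2) ^ N * e < \<epsilon>" using e by (simp only: pos_less_divide_eq)
      then have N: "w N + w N < \<epsilon>" by (simp add: w_def power_one_over)
      have "dist (g m x) (g n x) < \<epsilon>" if "N \<le> m" "N \<le> n" "x \<in> topspace X" for m n x
        using gdiff'[OF that(3,1)] gdiff'[OF that(3,2)] N unfolding dist_real_def by linarith
      then show ?thesis by blast
    qed
    obtain v where v: "continuous_map X Met_TC.mtopology v"
        "\<And>\<epsilon>. 0 < \<epsilon> \<Longrightarrow> eventually (\<lambda>n. \<forall>x\<in>topspace X. dist (g n x) (v x) < \<epsilon>) sequentially"
    proof (rule Met_TC.continuous_map_uniformly_Cauchy_limit[of X g])
      show "Met_TC.mcomplete TYPE(real)" using complete_UNIV mcomplete_iff_complete by blast
      show "eventually (\<lambda>n. continuous_map X Met_TC.mtopology (g n)) sequentially"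
        using g(1) by simp
    qed (use cauchy in auto)
    then have vc: "cont v" by simp
    have lim: "(\<lambda>n. g n x) \<longlonglongrightarrow> v x" if "x \<in> topspace X" for x
      unfolding tendsto_iff
    proof (intro allI impI)
      fix \<epsilon> :: real assume "\<epsilon> > 0"
      from v(2)[OF this] show "eventually (\<lambda>n. dist (g n x) (v x) < \<epsilon>) sequentially"
        by eventually_elim (use that in blast)
    qed
    have "v \<in> V"
    proof (rule ccontr)
      assume "v \<notin> V"
      then obtain \<mu> where \<mu>: "annihilates \<mu>" "sm_apply \<mu> v \<noteq> 0" using annihilator_separates[OF vc] by blast
      have "{x. \<mu> x \<noteq> 0} \<subseteq> topspace X" using \<mu>(1) by (simp add: annihilates_def sign_measure_on_def)
      then have "(\<lambda>n. sm_apply \<mu> (g n)) \<longlonglongrightarrow> sm_apply \<mu> v"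
        unfolding sm_apply_def by (intro tendsto_sum tendsto_mult_left lim) auto
      moreover have "(\<lambda>n. sm_apply \<mu> (g n)) \<longlonglongrightarrow> 0"
        unfolding tendsto_iff dist_real_def
      proof (intro allI impI)
        fix \<epsilon> :: real assume "\<epsilon> > 0"
        then obtain t where t: "t > 0" "\<And>f. cont f \<Longrightarrow> p f < t \<Longrightarrow> \<bar>sm_apply \<mu> f\<bar> < \<epsilon>"
          using annihilator_continuous[OF \<mu>(1)] by blast
        have "(\<lambda>k. (1/2) ^ k :: real) \<longlonglongrightarrow> 0" by (intro LIMSEQ_realpow_zero) auto
        then have "eventually (\<lambda>k. (1/2) ^ k < t) sequentially" using t(1) by (rule order_tendstoD)
        then show "eventually (\<lambda>n. \<bar>sm_apply \<mu> (g n) - 0\<bar> < \<epsilon>) sequentially"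
        proof eventually_elim
          case (elim k)
          have "p (g k) < 1 / 2 ^ k" using g(2)[of k] by (simp add: s_def)
          then have "p (g k) < t" using elim by (simp add: power_one_over)
          then show ?case using t(2)[OF g(1)] by simp
        qed
      qed
      ultimately show False using \<mu>(2) LIMSEQ_unique by blast
    qed
    moreover have "\<bar>f x - v x\<bar> \<le> e" if x: "x \<in> topspace X" for x
    proof (rule LIMSEQ_le_const2)
      show "(\<lambda>n. \<bar>f x - g n x\<bar>) \<longlonglongrightarrow> \<bar>f x - v x\<bar>"
        by (intro tendsto_rabs tendsto_diff tendsto_const lim x)
      show "\<exists>N. \<forall>n\<ge>N. \<bar>f x - g n x\<bar> \<le> e"
      proof (intro exI allI impI)
        fix n
        have "\<bar>f x - g n x\<bar> \<le> w 0" using gdiff'[OF x, of 0 n] by (simp add: g(3))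
        also have "w 0 \<le> e" using e by (simp add: w_def)
        finally show "\<bar>f x - g n x\<bar> \<le> e" .
      qed
    qed
    moreover have "cont (\<lambda>x. f x - v x)" by (rule continuous_map_diff[OF f(1) vc])
    ultimately show ?thesis
      unfolding B_def by (intro bexI[of _ v]) simp_all
  qed
  then show ?thesis using s[of 0] by blast
qed

text \<open>
  Openness of the quotient map carries a countable dense set over to the quotient norm. Let \<open>\<mu> n\<close> be a
  measure of norm one that annihilates \<open>Z\<close> and the first \<open>n\<close> functions of a dense sequence; it exists
  because the quotient is infinite-dimensional. Every function is uniformly close, modulo \<open>Z\<close>, to some
  function of the sequence, so \<open>\<mu> n\<close> tends to zero on it.
\<close>
lemma JNP: "Cp_JNP X"
proof -
  have top: "topspace T = carrier Q" using mtopology_eq M.topspace_mtopology by metis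
  obtain D where D: "countable D" "D \<subseteq> carrier Q" "T closure_of D = carrier Q"
    using separable unfolding separable_space_def top by blast
  have "D \<noteq> {}" using D(3) q_carrier[OF cont_0] by auto
  then have rD: "range (from_nat_into D) = D" using D(1) by (rule range_from_nat_into)
  have "\<exists>f. cont f \<and> from_nat_into D i = q f" for i
  proof -
    have "from_nat_into D i \<in> carrier Q" using rD D(2) by blast
    then show ?thesis using carrier_Q by auto
  qed
  then obtain F where F: "\<And>i::nat. cont (F i)" "\<And>i. from_nat_into D i = q (F i)" by metis
  have dense: "\<exists>i. p (\<lambda>x. f x - F i x) < r" if f: "cont f" and r: "r > 0" for f r
  proof -
    have "q f \<in> M.mtopology closure_of D" using q_carrier[OF f] D(3) mtopology_eq by simp
    then obtain y where "y \<in> D" "y \<in> M.mball (q f) r" using r unfolding M.metric_closure_of by auto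
    then obtain i where "q (F i) \<in> M.mball (q f) r" using rD F(2) by (metis imageE)
    then have "d (q f) (q (F i)) < r" by simp
    then show ?thesis using dist_q[OF f F(1)] by auto
  qed
  have "\<exists>\<mu>. annihilates \<mu> \<and> (\<forall>i<n. sm_apply \<mu> (F i) = 0) \<and> sm_norm \<mu> = 1" for n
  proof -
    from infinite_dimensional_not_spanned[where f = F and n = n, OF vectorspace_Q infinite_dim F(1)]
    obtain g where g: "cont g" "\<forall>c. (\<lambda>x. g x - (\<Sum>i<n. c i * F i x)) \<notin> V" by (elim exE conjE)
    from annihilator_separates_span[where f = F and n = n, OF F(1) g(1)]
    obtain \<mu> where \<mu>: "annihilates \<mu>" "\<forall>i<n. sm_apply \<mu> (F i) = 0" "sm_apply \<mu> g \<noteq> 0"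
    proof (elim disjE exE conjE)
      fix c assume "(\<lambda>x. g x - (\<Sum>i<n. c i * F i x)) \<in> V"
      then show thesis by (rule notE[OF spec[OF g(2)]])
    qed
    have "\<exists>x. \<mu> x \<noteq> 0"
    proof (rule ccontr)
      assume "\<not> ?thesis"
      then have "sm_apply \<mu> g = 0" by (simp add: sm_apply_def)
      then show False using \<mu>(3) by simp
    qed
    then obtain x where x: "\<mu> x \<noteq> 0" by blast
    have "sign_measure_on X \<mu>" using \<mu>(1) by (simp add: annihilates_def)
    then obtain c where c: "sign_measure_on X (\<lambda>x. c * \<mu> x)" "sm_norm (\<lambda>x. c * \<mu> x) = 1"
        "\<And>f. sm_apply (\<lambda>x. c * \<mu> x) f = c * sm_apply \<mu> f"
      using sign_measure_normalize[of X \<mu> x] x by blast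
    then show ?thesis
      using \<mu>(1,2) by (intro exI[of _ "\<lambda>x. c * \<mu> x"]) (simp add: annihilates_def)
  qed
  then obtain \<mu> where \<mu>: "\<And>n. annihilates (\<mu> n)" "\<And>n i. i < n \<Longrightarrow> sm_apply (\<mu> n) (F i) = 0"
      "\<And>n. sm_norm (\<mu> n) = 1" by metis
  have sm: "sign_measure_on X (\<mu> n)" for n using \<mu>(1) by (simp add: annihilates_def)
  have "(\<lambda>n. sm_apply (\<mu> n) f) \<longlonglongrightarrow> 0" if "f \<in> carrier (Cp X)" for f
    unfolding tendsto_iff dist_real_def
  proof (intro allI impI)
    have f: "cont f" using that by simp
    fix e :: real assume e: "e > 0"
    then obtain r where r: "r > 0" "\<And>f. cont f \<Longrightarrow> p f < r \<Longrightarrow> \<exists>v\<in>V. (\<lambda>x. f x - v x) \<in> B (e / 2)"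
      using quotient_map_open[of "e / 2"] by auto
    obtain i where i: "p (\<lambda>x. f x - F i x) < r" using dense[OF f r(1)] by blast
    then obtain v where v: "v \<in> V" "(\<lambda>x. (f x - F i x) - v x) \<in> B (e / 2)"
      using r(2)[OF continuous_map_diff[OF f F(1)]] by blast
    show "eventually (\<lambda>n. \<bar>sm_apply (\<mu> n) f - 0\<bar> < e) sequentially"
      using eventually_gt_at_top[of i]
    proof eventually_elim
      case (elim n)
      have "sm_apply (\<mu> n) (\<lambda>x. (f x - F i x) - v x) = sm_apply (\<mu> n) f"
        using \<mu>(1)[of n] \<mu>(2)[OF elim] v(1) by (simp add: sm_apply_diff annihilates_def)
      moreover have "\<bar>sm_apply (\<mu> n) (\<lambda>x. (f x - F i x) - v x)\<bar> \<le> e / 2 * sm_norm (\<mu> n)"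
        using v(2) by (intro sm_apply_bound[OF sm]) (simp add: B_def)
      ultimately show ?case using e \<mu>(3)[of n] by simp
    qed
  qed
  then show ?thesis
    unfolding Cp_JNP_def using sm \<mu>(3) by blast
qed

end

lemma JNP_of_polishable_quotient:
  assumes X: "pseudocompact_space X" and "has_inf_dim_polishable_quotient (Cp X)"
  shows "Cp_JNP X"
proof -
  obtain Z T where Z: "closed_subspace (Cp X) Z" "infinite_dimensional (quotient_tvs (Cp X) Z)"
      and T: "\<And>U. openin (quotient_topology (Cp X) Z) U \<Longrightarrow> openin T U"
        "frechet_space (quotient_tvs (Cp X) Z\<lparr>vtop := T\<rparr>)" "separable_space T"
    using assms(2) unfolding has_inf_dim_polishable_quotient_def polishable_def quotient_tvs_simps
    by (elim exE conjE) blast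
  interpret F: frechet_space "quotient_tvs (Cp X) Z\<lparr>vtop := T\<rparr>" by (rule T(2))
  have "\<exists>d. Metric_space (a_rcosets\<^bsub>Cp X\<^esub> Z) d \<and> Metric_space.mtopology (a_rcosets\<^bsub>Cp X\<^esub> Z) d = T \<and>
      Metric_space.mcomplete (a_rcosets\<^bsub>Cp X\<^esub> Z) d \<and>
      (\<forall>x\<in>a_rcosets\<^bsub>Cp X\<^esub> Z. \<forall>y\<in>a_rcosets\<^bsub>Cp X\<^esub> Z. \<forall>z\<in>a_rcosets\<^bsub>Cp X\<^esub> Z.
         d (x <+>\<^bsub>Cp X\<^esub> z) (y <+>\<^bsub>Cp X\<^esub> z) = d x y)"
    using F.complete_metrizable by (simp add: quotient_tvs_def)
  then obtain d where d: "Metric_space (a_rcosets\<^bsub>Cp X\<^esub> Z) d" "Metric_space.mtopology (a_rcosets\<^bsub>Cp X\<^esub> Z) d = T"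
      "Metric_space.mcomplete (a_rcosets\<^bsub>Cp X\<^esub> Z) d"
      "\<forall>x\<in>a_rcosets\<^bsub>Cp X\<^esub> Z. \<forall>y\<in>a_rcosets\<^bsub>Cp X\<^esub> Z. \<forall>z\<in>a_rcosets\<^bsub>Cp X\<^esub> Z.
         d (x <+>\<^bsub>Cp X\<^esub> z) (y <+>\<^bsub>Cp X\<^esub> z) = d x y"
    by (elim exE conjE)
  interpret pseudocompact_polishable_quotient X Z T d
  proof (intro pseudocompact_polishable_quotient.intro pseudocompact_polishable_quotient_axioms.intro
      Cp_quotient.intro)
    show "openin T U" if "openin (quotient_topology (Cp X) Z) U" for U
      using T(1)[OF that] .
    show "bounded (f ` topspace X)" if "continuous_map X euclideanreal f" for f
      using X that by (simp add: pseudocompact_space_def)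
    show "d (x <+>\<^bsub>Cp X\<^esub> z) (y <+>\<^bsub>Cp X\<^esub> z) = d x y"
      if "x \<in> a_rcosets\<^bsub>Cp X\<^esub> Z" "y \<in> a_rcosets\<^bsub>Cp X\<^esub> Z" "z \<in> a_rcosets\<^bsub>Cp X\<^esub> Z" for x y z
      using d(4) that by blast
  qed (fact Z T(2) T(3) d(1-3))+
  show ?thesis by (rule JNP)
qed

section \<open>The equivalence\<close>

theorem corollary1:
  fixes X :: "'a topology"
  assumes "tychonoff_space X"
  shows "(has_inf_dim_polishable_quotient (Cp X) \<longleftrightarrow>
            has_complemented_inf_dim_polishable_subspace (Cp X)) \<and>
         (has_complemented_inf_dim_polishable_subspace (Cp X) \<longleftrightarrow>
            has_complemented_copy (Cp X) RN \<or> has_complemented_copy (Cp X) c0) \<and>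
         (has_complemented_copy (Cp X) RN \<or> has_complemented_copy (Cp X) c0 \<longleftrightarrow>
            \<not> pseudocompact_space X \<or> Cp_JNP X)"
proof -
  let ?quotient = "has_inf_dim_polishable_quotient (Cp X)"
  let ?subspace = "has_complemented_inf_dim_polishable_subspace (Cp X)"
  let ?copy = "has_complemented_copy (Cp X) RN \<or> has_complemented_copy (Cp X) c0"
  let ?jnp = "\<not> pseudocompact_space X \<or> Cp_JNP X"
  have "?quotient" if "?subspace"
    using polishable_quotient_of_complemented_subspace[OF that topspace_Cp Hausdorff_Cp] .
  moreover have "?subspace" if "?copy"
    using that
  proof
    assume "has_complemented_copy (Cp X) RN"
    then show ?thesis
      by (rule complemented_polishable_subspace_of_copy[OF _ topspace_Cp polishable_RN infinite_dimensional_RN])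
        (simp add: PiE_UNIV_domain)
  next
    assume "has_complemented_copy (Cp X) c0"
    then show ?thesis
      by (rule complemented_polishable_subspace_of_copy[OF _ topspace_Cp polishable_c0 infinite_dimensional_c0])
        (simp add: PiE_UNIV_domain)
  qed
  moreover have "?copy" if "?jnp"
  proof (cases "pseudocompact_space X")
    case True
    then show ?thesis using complemented_c0_of_JNP[OF assms] that by blast
  next
    case False
    then obtain f where "continuous_map X euclideanreal f" "\<not> bounded (f ` topspace X)"
      using assms unfolding pseudocompact_space_def by blast
    then show ?thesis using complemented_RN_of_unbounded by blast
  qed
  moreover have "?jnp" if "?quotient"
    using JNP_of_polishable_quotient that by blast
  ultimately show ?thesis by argo
qed

end
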